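(* Let $d\in\mathbb{N}$ and let $X$ be a Banach space of Fourier type $p_0\in(1,2]$. Let $p_0<q\le\infty$. Then the Fourier transform $f\mapsto(\widehat f(n))_{n\in\mathbb{Z}^d}$ is bounded from $L^{p_0,q}(\mathbb{T}^d;X)$ into $\ell^{p_0',q}(\log\ell)^{-1/p_0+1/\max\{p_0',q\}}(\mathbb{Z}^d;X)$. In particular, there is a constant $C$ such that for all $f\in L^{p_0,q}(\mathbb{T}^d;X)$, $$\widehat f^{\,*}(n)\le C\,n^{-1/p_0'}(1+\log n)^{1/p_0-1/\max\{p_0',q\}}\,\|f\|_{L^{p_0,q}(\mathbb{T}^d;X)},\qquad n\in\mathbb{N}.$$
   Context: Banach spaces are nonzero and over $\mathbb{C}$; $1/p+1/p'=1$, $1/\infty=0$; $\mathbb{N}=\{1,2,\dots\}$. $\mathbb{T}^d=[-\frac12,\frac12]^d$ and $\widehat f(n)=\int_{\mathbb{T}^d}f(x)e^{-2\pi i x\cdot n}\,dx$; $(\widehat f^{\,*}(n))_{n\in\mathbb{N}}$ is the non-increasing rearrangement of $(\|\widehat f(m)\|_X)_{m\in\mathbb{Z}^d}$. $X$ has Fourier type $p_0$ if there is $C$ with $\|\widehat f\|_{L^{p_0'}(\mathbb{R}^d;X)}\le C\|f\|_{L^{p_0}(\mathbb{R}^d;X)}$ for all $f\in\mathcal{S}(\mathbb{R}^d;X)$, where $\widehat f(\xi)=\int_{\mathbb{R}^d}f(t)e^{-2\pi it\cdot\xi}dt$. For strongly measurable $f:\mathbb{T}^d\to X$ with $f^*$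 the non-increasing rearrangement of $\|f(\cdot)\|_X$, $\|f\|_{L^{p,q}(\mathbb{T}^d;X)}=\big(\int_0^1(t^{1/p}f^*(t))^q\frac{dt}{t}\big)^{1/q}$; for a sequence $(x_n)_{n\in\mathbb{Z}^d}$ in $X$ with $(x_k^* )_{k\ge1}$ the non-increasing rearrangement of $(\|x_n\|_X)_n$, $\|(x_n)\|_{\ell^{p,q}(\log\ell)^c(\mathbb{Z}^d;X)}=\big(\sum_{k\ge1}(k^{1/p}(1+\log k)^cx_k^* )^q\frac1k\big)^{1/q}$ (suprema if $q=\infty$). *)

theory Defs
  imports "HOL-Analysis.Analysis"
begin

section \<open>Complex Banach spaces\<close>

class complex_banach = banach +
  fixes scaleC :: "complex \<Rightarrow> 'a \<Rightarrow> 'a"  (infixr "*\<^sub>C" 75)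
  assumes scaleC_add_right: "c *\<^sub>C (x + y) = c *\<^sub>C x + c *\<^sub>C y"
    and scaleC_add_left: "(b + c) *\<^sub>C x = b *\<^sub>C x + c *\<^sub>C x"
    and scaleC_scaleC: "b *\<^sub>C c *\<^sub>C x = (b * c) *\<^sub>C x"
    and scaleC_of_real: "complex_of_real r *\<^sub>C x = r *\<^sub>R x"
    and norm_scaleC: "norm (c *\<^sub>C x) = cmod c * norm x"

section \<open>Strong measurability and the Bochner integral\<close>

text \<open>The Bochner integral of HOL-Analysis requires a second countable target space. Here
  the target may be non-separable, so Borel measurability is replaced by strong measurability
  (almost everywhere limit of simple functions). The measures used below are complete.\<close>

definition strongly_measurable :: "'a measure \<Rightarrow> ('a \<Rightarrow> 'x::real_normed_vector) \<Rightarrow> bool" where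
  "strongly_measurable M f \<longleftrightarrow>
     (\<exists>s. (\<forall>i::nat. simple_function M (s i)) \<and> (AE x in M. (\<lambda>i. s i x) \<longlonglongrightarrow> f x))"

definition has_strong_bochner_integral ::
    "'a measure \<Rightarrow> ('a \<Rightarrow> 'x::real_normed_vector) \<Rightarrow> 'x \<Rightarrow> bool" where
  "has_strong_bochner_integral M f I \<longleftrightarrow>
     strongly_measurable M f \<and>
     (\<exists>s. (\<forall>i::nat. Bochner_Integration.simple_bochner_integrable M (s i)) \<and>
          (\<lambda>i. \<integral>\<^sup>+x. norm (f x - s i x) \<partial>M) \<longlonglongrightarrow> 0 \<and>
          (\<lambda>i. Bochner_Integration.simple_bochner_integral M (s i)) \<longlonglongrightarrow> I)"

definition strong_bochner_integral ::
    "'a measure \<Rightarrow> ('a \<Rightarrow> 'x::real_normed_vector) \<Rightarrow> 'x" where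
  "strong_bochner_integral M f =
     (if \<exists>I. has_strong_bochner_integral M f I
      then THE I. has_strong_bochner_integral M f I else 0)"

section \<open>Exponents and the Lebesgue norm\<close>

text \<open>Only used for \<open>1 < p < \<infinity>\<close>, where \<open>1/p + 1/p' = 1\<close>.\<close>

definition conj_exp :: "real \<Rightarrow> real" where
  "conj_exp p = p / (p - 1)"

text \<open>Only used for positive exponents.\<close>

definition ennpowr :: "ennreal \<Rightarrow> real \<Rightarrow> ennreal" where
  "ennpowr x r = (if x = \<infinity> then \<infinity> else ennreal (enn2real x powr r))"

definition Lp_norm :: "real \<Rightarrow> 'a measure \<Rightarrow> ('a \<Rightarrow> 'x::real_normed_vector) \<Rightarrow> ennreal" where
  "Lp_norm p M f = ennpowr (\<integral>\<^sup>+x. ennreal (norm (f x) powr p) \<partial>M) (1 / p)"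

section \<open>Schwartz functions and Fourier type\<close>

definition partial_deriv :: "'d::finite \<Rightarrow> (real^'d \<Rightarrow> 'x::real_normed_vector) \<Rightarrow> real^'d \<Rightarrow> 'x" where
  "partial_deriv j f x = vector_derivative (\<lambda>t. f (x + t *\<^sub>R axis j 1)) (at 0)"

primrec iter_partial_deriv ::
    "'d::finite list \<Rightarrow> (real^'d \<Rightarrow> 'x::real_normed_vector) \<Rightarrow> real^'d \<Rightarrow> 'x" where
  "iter_partial_deriv [] f = f"
| "iter_partial_deriv (j # js) f = partial_deriv j (iter_partial_deriv js f)"

text \<open>Differentiability of all iterated partial derivatives amounts to smoothness; lists of
  directions play the role of multi-indices.\<close>

definition schwartz :: "(real^'d::finite \<Rightarrow> 'x::real_normed_vector) \<Rightarrow> bool" where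
  "schwartz f \<longleftrightarrow>
     (\<forall>js. (\<forall>x. iter_partial_deriv js f differentiable (at x)) \<and>
           (\<forall>N::nat. bounded (range (\<lambda>x. norm x ^ N *\<^sub>R iter_partial_deriv js f x))))"

definition fourier_transform :: "(real^'d::finite \<Rightarrow> 'x::complex_banach) \<Rightarrow> real^'d \<Rightarrow> 'x" where
  "fourier_transform f \<xi> =
     strong_bochner_integral lebesgue (\<lambda>t. cis (- 2 * pi * (t \<bullet> \<xi>)) *\<^sub>C f t)"

definition fourier_type :: "'d::finite itself \<Rightarrow> 'x::complex_banach itself \<Rightarrow> real \<Rightarrow> bool" where
  "fourier_type d X p \<longleftrightarrow>
     (\<exists>C::real. \<forall>f :: real^'d \<Rightarrow> 'x. schwartz f \<longrightarrow>
        Lp_norm (conj_exp p) lebesgue (fourier_transform f) \<le> ennreal C * Lp_norm p lebesgue f)"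

section \<open>Fourier coefficients on the torus\<close>

definition torus :: "(real^'d::finite) set" where
  "torus = cbox (\<chi> j. - 1 / 2) (\<chi> j. 1 / 2)"

definition fourier_coeff :: "(real^'d::finite \<Rightarrow> 'x::complex_banach) \<Rightarrow> int^'d \<Rightarrow> 'x" where
  "fourier_coeff f n =
     strong_bochner_integral (lebesgue_on torus)
       (\<lambda>x. cis (- 2 * pi * (x \<bullet> (\<chi> j. of_int (n $ j)))) *\<^sub>C f x)"

section \<open>Rearrangements and Lorentz (quasi-)norms\<close>

definition rearrangement ::
    "'a measure \<Rightarrow> ('a \<Rightarrow> 'x::real_normed_vector) \<Rightarrow> real \<Rightarrow> ennreal" where
  "rearrangement M f t =
     Inf {s. emeasure M {x \<in> space M. s < ennreal (norm (f x))} \<le> ennreal t}"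

text \<open>For \<open>k \<ge> 1\<close>, the \<open>k\<close>-th term is the least \<open>s\<close> such that at most \<open>k - 1\<close> of the norms exceed \<open>s\<close>;
  for null sequences it is the \<open>k\<close>-th largest norm, counted with multiplicity.\<close>

definition seq_rearrangement :: "('i \<Rightarrow> 'x::real_normed_vector) \<Rightarrow> nat \<Rightarrow> ennreal" where
  "seq_rearrangement x k = rearrangement (count_space UNIV) x (real k - 1)"

definition lorentz_norm ::
    "real \<Rightarrow> ennreal \<Rightarrow> (real^'d::finite \<Rightarrow> 'x::real_normed_vector) \<Rightarrow> ennreal" where
  "lorentz_norm p q f =
     (let g = (\<lambda>t. ennreal (t powr (1 / p)) * rearrangement (lebesgue_on torus) f t) in
      if q = \<infinity> then (SUP t\<in>{0<..<1}. g t)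
      else ennpowr (\<integral>\<^sup>+t\<in>{0<..<1}. ennpowr (g t) (enn2real q) * ennreal (1 / t) \<partial>lborel)
             (1 / enn2real q))"

definition lorentz_space ::
    "real \<Rightarrow> ennreal \<Rightarrow> (real^'d::finite \<Rightarrow> 'x::real_normed_vector) set" where
  "lorentz_space p q = {f. strongly_measurable (lebesgue_on torus) f \<and> lorentz_norm p q f < \<infinity>}"

definition lorentz_log_seq_norm ::
    "real \<Rightarrow> ennreal \<Rightarrow> real \<Rightarrow> (int^'d::finite \<Rightarrow> 'x::real_normed_vector) \<Rightarrow> ennreal" where
  "lorentz_log_seq_norm p q c x =
     (let a = (\<lambda>k::nat. ennreal (real k powr (1 / p) * (1 + ln (real k)) powr c)
                          * seq_rearrangement x k) in
      if q = \<infinity> then (SUP k\<in>{1..}. a k)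
      else ennpowr (\<Sum>k. ennpowr (a (Suc k)) (enn2real q) * ennreal (1 / real (Suc k)))
             (1 / enn2real q))"

end

theory Submission
  imports Defs "HOL-Probability.Characteristic_Functions"
begin

text \<open>
  Multiplying a trigonometric polynomial by a wide Gaussian transfers the Fourier type inequality
  from \<open>\<real>\<^sup>d\<close> to the torus, and density of the trigonometric polynomials turns it into a
  Hausdorff--Young inequality from \<open>L\<^sup>p\<close> to \<open>\<ell>\<^sup>p\<^sup>'\<close> for bounded functions. Cutting \<open>f\<close> at the height
  \<open>f\<^sup>*(2\<^sup>-\<^sup>m)\<close> then splits its Fourier coefficients into a part that is uniformly at most a multiple
  of \<open>2\<^sup>-\<^sup>m\<^sup>/\<^sup>p\<^sup>'\<close> times the norm of \<open>f\<close>, and a part whose \<open>\<ell>\<^sup>p\<^sup>'\<close> norm to the power \<open>p\<close> is at most a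
  multiple of the sum of \<open>b\<^sub>i\<^sup>p\<close> over \<open>i \<le> m\<close>, where \<open>b\<^sub>i = 2\<^sup>-\<^sup>i\<^sup>/\<^sup>p f\<^sup>*(2\<^sup>-\<^sup>i)\<close>. The \<open>\<ell>\<^sup>q\<close> norm of \<open>b\<close> is controlled
  by the Lorentz norm of \<open>f\<close>.

  For a single index \<open>k\<close>, taking \<open>2\<^sup>m\<close> comparable to \<open>k\<close> and applying Hoelder's inequality to \<open>b\<close> gives the
  pointwise bound. For the norm estimate the indices are grouped into blocks in which \<open>log k\<close> is
  comparable to \<open>2\<^sup>j\<close>, with a single cut at \<open>m = M 2\<^sup>j\<close> per block. Using the full \<open>\<ell>\<^sup>p\<^sup>'\<close> norm on each block
  saves the logarithm that the pointwise bound would lose, and the sum over the blocks becomes a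
  Hardy inequality for the sequence \<open>b\<^sub>i\<^sup>p\<close>.
\<close>

text \<open>For q > p_0 the space L^{p_0,q} is larger than L^{p_0}, so a Hausdorff--Young inequality
  need not apply to f itself. It applies to truncations because its constant does not depend on the
  height of the cut. What is cut off stays under control in L^1: since p_0 > 1, its L^1 norm decays
  by the factor 2^(-1/p_0') per level.

  The maximum in the logarithmic exponent has a single source. On the indices up to 2^(2^j), passing
  from an l^{p'} bound to the weighted l^q sum is free for q >= p', and costs 2^(j(1 - q/p')) for q
  < p', because the harmonic sum over these indices is of order 2^j. Together with the logarithmic
  weight this leaves exactly 2^(j(1 - q/p)), the weight of Hardy's inequality with exponent q/p > 1.

  The pointwise bound is not deduced from the norm estimate: it comes out directly with the exponent
  1/p_0 - 1/q, which is at most the stated one. For q = infinity the norm estimate is read off from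
  it instead.

  Since X may be non-separable, the integral of strongly measurable functions has to be developed
  before Fourier coefficients can be handled.\<close>

lemma bounded_bilinear_scaleC:
  "bounded_bilinear (scaleC :: complex \<Rightarrow> 'x::complex_banach \<Rightarrow> 'x)"
proof
  fix a :: complex and b :: 'x and r :: real
  show "(r *\<^sub>R a) *\<^sub>C b = r *\<^sub>R a *\<^sub>C b"
    by (metis scaleC_of_real scaleC_scaleC scaleR_conv_of_real)
  show "a *\<^sub>C r *\<^sub>R b = r *\<^sub>R a *\<^sub>C b"
    by (metis scaleC_of_real scaleC_scaleC mult.commute)
  show "\<exists>K. \<forall>(a::complex) b::'x. norm (a *\<^sub>C b) \<le> norm a * norm b * K"
    by (rule exI[of _ 1]) (simp add: norm_scaleC)
qed (simp_all add: scaleC_add_left scaleC_add_right)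

interpretation scaleC: bounded_bilinear "scaleC :: complex \<Rightarrow> 'x::complex_banach \<Rightarrow> 'x"
  by (rule bounded_bilinear_scaleC)

lemma scaleC_one [simp]: "1 *\<^sub>C (x::'x::complex_banach) = x"
  using scaleC_of_real[of 1 x] by simp

text \<open>Off a null set the function agrees with the everywhere defined \<open>lim\<close>, and
  completeness makes every subset of that null set measurable.\<close>

lemma (in complete_measure) borel_measurable_AE_limit:
  fixes h :: "'a \<Rightarrow> 'b::{banach, second_countable_topology}"
  assumes g [measurable]: "\<And>i::nat. g i \<in> borel_measurable M"
    and lim: "AE x in M. (\<lambda>i. g i x) \<longlonglongrightarrow> h x"
  shows "h \<in> borel_measurable M"
proof -
  define h' where "h' = (\<lambda>x. lim (\<lambda>i. g i x))"
  have h' [measurable]: "h' \<in> borel_measurable M"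
    unfolding h'_def by measurable
  have "AE x in M. h x = h' x"
    using lim unfolding h'_def by eventually_elim (simp add: limI)
  then obtain N where N: "N \<in> null_sets M" "\<And>x. x \<in> space M \<Longrightarrow> x \<notin> N \<Longrightarrow> h x = h' x"
    by (metis (mono_tags, lifting) AE_E3 DiffI)
  show ?thesis
  proof (rule measurableI)
    fix A :: "'b set" assume A [measurable]: "A \<in> sets borel"
    have "h -` A \<inter> space M = ((h' -` A \<inter> space M) - N) \<union> (h -` A \<inter> space M \<inter> N)"
      using N(2) by auto
    moreover have "h -` A \<inter> space M \<inter> N \<in> sets M"
      using N(1) by (intro complete[of _ N]) auto
    moreover have "N \<in> sets M" using N(1) by auto
    ultimately show "h -` A \<inter> space M \<in> sets M"
      by (metis A h' measurable_sets sets.Diff sets.Un)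
  qed auto
qed

section \<open>Strong measurability\<close>

lemma strongly_measurable_simple: "simple_function M f \<Longrightarrow> strongly_measurable M f"
  unfolding strongly_measurable_def by (intro exI[of _ "\<lambda>_. f"]) auto

text \<open>The operation is applied to the approximating simple functions, so joint sequential
  continuity suffices. The two arguments may have different types, which covers sums, differences
  and both scalar multiplications.\<close>

lemma strongly_measurable_compose2:
  assumes f: "strongly_measurable M f" and g: "strongly_measurable M g"
    and p: "\<And>a b s t. s \<longlonglongrightarrow> a \<Longrightarrow> t \<longlonglongrightarrow> b \<Longrightarrow> (\<lambda>i. p (s i) (t i)) \<longlonglongrightarrow> p a b"
  shows "strongly_measurable M (\<lambda>x. p (f x) (g x))"
proof -
  from f obtain s where s: "\<And>i. simple_function M (s i)" "AE x in M. (\<lambda>i. s i x) \<longlonglongrightarrow> f x"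
    unfolding strongly_measurable_def by auto
  from g obtain t where t: "\<And>i. simple_function M (t i)" "AE x in M. (\<lambda>i. t i x) \<longlonglongrightarrow> g x"
    unfolding strongly_measurable_def by auto
  show ?thesis
    unfolding strongly_measurable_def
  proof (intro exI[of _ "\<lambda>i x. p (s i x) (t i x)"] conjI allI)
    show "AE x in M. (\<lambda>i. p (s i x) (t i x)) \<longlonglongrightarrow> p (f x) (g x)"
      using s(2) t(2) by eventually_elim (rule p)
  qed (intro simple_function_compose2[where h=p] s t)
qed

lemma strongly_measurable_add:
  "strongly_measurable M f \<Longrightarrow> strongly_measurable M g \<Longrightarrow> strongly_measurable M (\<lambda>x. f x + g x)"
  by (rule strongly_measurable_compose2[where p="(+)"]) (auto intro: tendsto_add)

lemma strongly_measurable_diff: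
  "strongly_measurable M f \<Longrightarrow> strongly_measurable M g \<Longrightarrow> strongly_measurable M (\<lambda>x. f x - g x)"
  by (rule strongly_measurable_compose2[where p="(-)"]) (auto intro: tendsto_diff)

lemma borel_measurable_imp_strongly_measurable:
  fixes f :: "'a \<Rightarrow> 'b::{real_normed_vector, second_countable_topology}"
  assumes "f \<in> borel_measurable M"
  shows "strongly_measurable M f"
proof -
  obtain F where F: "\<forall>i. simple_function M (F i)" "\<forall>x\<in>space M. (\<lambda>i. F i x) \<longlonglongrightarrow> f x"
    using borel_measurable_implies_sequence_metric[OF assms, of 0] by blast
  then show ?thesis
    unfolding strongly_measurable_def by (intro exI[of _ F]) auto
qed

lemma strongly_measurable_scaleC:
  fixes f :: "'a \<Rightarrow> 'x::complex_banach"
  assumes h: "h \<in> borel_measurable M" and f: "strongly_measurable M f"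
  shows "strongly_measurable M (\<lambda>x. h x *\<^sub>C f x)"
  by (rule strongly_measurable_compose2[where p=scaleC,
        OF borel_measurable_imp_strongly_measurable[OF h] f]) (rule scaleC.tendsto)

lemma strongly_measurable_indicator_scaleR:
  assumes f: "strongly_measurable M f" and A: "A \<in> sets M"
  shows "strongly_measurable M (\<lambda>x. indicator A x *\<^sub>R f x)"
proof (rule strongly_measurable_compose2[where p=scaleR, OF _ f])
  show "strongly_measurable M (indicat_real A)"
    using A by (intro borel_measurable_imp_strongly_measurable) simp
qed (rule tendsto_scaleR)

lemma (in complete_measure) strongly_measurable_norm:
  assumes "strongly_measurable M f"
  shows "(\<lambda>x. norm (f x)) \<in> borel_measurable M"
proof -
  from assms obtain s where s: "\<And>i. simple_function M (s i)" "AE x in M. (\<lambda>i. s i x) \<longlonglongrightarrow> f x"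
    unfolding strongly_measurable_def by auto
  show ?thesis
  proof (rule borel_measurable_AE_limit)
    show "(\<lambda>x. norm (s i x)) \<in> borel_measurable M" for i
      by (intro borel_measurable_simple_function simple_function_compose1[where g=norm] s)
    show "AE x in M. (\<lambda>i. norm (s i x)) \<longlonglongrightarrow> norm (f x)"
      using s(2) by eventually_elim (rule tendsto_norm)
  qed
qed

lemma (in complete_measure) norm_diff_simple_measurable:
  assumes "strongly_measurable M f" "simple_function M s"
  shows "(\<lambda>x. norm (f x - s x)) \<in> borel_measurable M"
  by (rule strongly_measurable_norm[OF strongly_measurable_diff[OF assms(1)
          strongly_measurable_simple[OF assms(2)]]])

section \<open>The strong Bochner integral\<close>

lemma simple_bochner_integrableD:
  "Bochner_Integration.simple_bochner_integrable M s \<Longrightarrow> simple_function M s"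
  by (auto elim: Bochner_Integration.simple_bochner_integrable.cases)

lemma has_bochner_integral_imp_strong:
  assumes "has_bochner_integral M f I"
  shows "has_strong_bochner_integral M f I"
  using assms unfolding has_strong_bochner_integral_def
  by (cases rule: has_bochner_integral.cases)
     (auto intro!: borel_measurable_imp_strongly_measurable)

lemma has_strong_bochner_integral_diff:
  assumes M: "complete_measure M"
    and f: "has_strong_bochner_integral M f I" and g: "has_strong_bochner_integral M g J"
  shows "has_strong_bochner_integral M (\<lambda>x. f x - g x) (I - J)"
proof -
  interpret complete_measure M by fact
  from f obtain s where sf: "strongly_measurable M f"
    and s: "\<And>i. Bochner_Integration.simple_bochner_integrable M (s i)"
      "(\<lambda>i. \<integral>\<^sup>+x. norm (f x - s i x) \<partial>M) \<longlonglongrightarrow> 0" "(\<lambda>i. Bochner_Integration.simple_bochner_integral M (s i)) \<longlonglongrightarrow> I"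
    unfolding has_strong_bochner_integral_def by auto
  from g obtain t where sg: "strongly_measurable M g"
    and t: "\<And>i. Bochner_Integration.simple_bochner_integrable M (t i)"
      "(\<lambda>i. \<integral>\<^sup>+x. norm (g x - t i x) \<partial>M) \<longlonglongrightarrow> 0" "(\<lambda>i. Bochner_Integration.simple_bochner_integral M (t i)) \<longlonglongrightarrow> J"
    unfolding has_strong_bochner_integral_def by auto
  have m [measurable]: "(\<lambda>x. norm (f x - s i x)) \<in> borel_measurable M" 
    "(\<lambda>x. norm (g x - t i x)) \<in> borel_measurable M" for i
    using s(1) t(1) sf sg
    by (auto intro!: norm_diff_simple_measurable dest: simple_bochner_integrableD)
  show ?thesis
    unfolding has_strong_bochner_integral_def
  proof (intro exI[of _ "\<lambda>i x. s i x - t i x"] conjI allI)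
    show "strongly_measurable M (\<lambda>x. f x - g x)"
      by (rule strongly_measurable_diff) fact+
    show "Bochner_Integration.simple_bochner_integrable M (\<lambda>x. s i x - t i x)" for i
      by (intro simple_bochner_integrable_compose2[where p="(-)"] s t) simp
    show "(\<lambda>i. Bochner_Integration.simple_bochner_integral M (\<lambda>x. s i x - t i x)) \<longlonglongrightarrow> I - J"
      using tendsto_diff[OF s(3) t(3)] by (simp add: simple_bochner_integral_diff s t)
    have "(\<lambda>i. (\<integral>\<^sup>+x. norm (f x - s i x) \<partial>M) + (\<integral>\<^sup>+x. norm (g x - t i x) \<partial>M)) \<longlonglongrightarrow> 0 + 0"
      by (intro tendsto_add s t)
    then have lim: "(\<lambda>i. (\<integral>\<^sup>+x. norm (f x - s i x) \<partial>M) + (\<integral>\<^sup>+x. norm (g x - t i x) \<partial>M)) \<longlonglongrightarrow> 0"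
      by simp
    have le: "(\<integral>\<^sup>+x. norm (f x - g x - (s i x - t i x)) \<partial>M)
        \<le> (\<integral>\<^sup>+x. norm (f x - s i x) \<partial>M) + (\<integral>\<^sup>+x. norm (g x - t i x) \<partial>M)" for i
    proof -
      have "(\<integral>\<^sup>+x. norm (f x - g x - (s i x - t i x)) \<partial>M)
          \<le> (\<integral>\<^sup>+x. ennreal (norm (f x - s i x)) + ennreal (norm (g x - t i x)) \<partial>M)"
      proof (rule nn_integral_mono)
        fix x
        have "norm (f x - g x - (s i x - t i x)) \<le> norm (f x - s i x) + norm (g x - t i x)"
          using norm_triangle_ineq4[of "f x - s i x" "g x - t i x"] by (simp add: algebra_simps)
        then show "ennreal (norm (f x - g x - (s i x - t i x)))
            \<le> ennreal (norm (f x - s i x)) + ennreal (norm (g x - t i x))"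
          by (simp flip: ennreal_plus)
      qed
      also have "\<dots> = (\<integral>\<^sup>+x. norm (f x - s i x) \<partial>M) + (\<integral>\<^sup>+x. norm (g x - t i x) \<partial>M)"
        by (rule nn_integral_add) auto
      finally show ?thesis .
    qed
    show "(\<lambda>i. \<integral>\<^sup>+x. norm (f x - g x - (s i x - t i x)) \<partial>M) \<longlonglongrightarrow> 0"
      by (rule tendsto_sandwich[OF _ _ tendsto_const lim]) (use le in auto)
  qed
qed

lemma has_strong_bochner_integral_bounded_linear:
  assumes M: "complete_measure M"
    and T: "bounded_linear T" and f: "has_strong_bochner_integral M f I"
  shows "has_strong_bochner_integral M (\<lambda>x. T (f x)) (T I)"
proof -
  interpret complete_measure M by fact
  interpret T: bounded_linear T by fact
  from T.bounded obtain K where K: "\<And>x. norm (T x) \<le> norm x * K" by auto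
  define K' where "K' = max K 0"
  have K': "norm (T x) \<le> K' * norm x" "0 \<le> K'" for x
    using K[of x] mult_left_mono[of K "max K 0" "norm x"]
    by (auto simp: K'_def mult.commute intro: order_trans)
  from f obtain s s' where
      s': "\<And>i. simple_function M (s' i)" "AE x in M. (\<lambda>i. s' i x) \<longlonglongrightarrow> f x"
    and s: "\<And>i. Bochner_Integration.simple_bochner_integrable M (s i)"
      "(\<lambda>i. \<integral>\<^sup>+x. norm (f x - s i x) \<partial>M) \<longlonglongrightarrow> 0" "(\<lambda>i. Bochner_Integration.simple_bochner_integral M (s i)) \<longlonglongrightarrow> I"
    unfolding has_strong_bochner_integral_def strongly_measurable_def by auto
  have m: "(\<lambda>x. norm (f x - s i x)) \<in> borel_measurable M" for i
    using s(1) f unfolding has_strong_bochner_integral_def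
    by (auto intro!: norm_diff_simple_measurable dest: simple_bochner_integrableD)
  have le: "(\<integral>\<^sup>+x. norm (T (f x) - T (s i x)) \<partial>M) \<le> ennreal K' * (\<integral>\<^sup>+x. norm (f x - s i x) \<partial>M)"
    for i
  proof -
    have "(\<integral>\<^sup>+x. norm (T (f x) - T (s i x)) \<partial>M) \<le> (\<integral>\<^sup>+x. ennreal K' * norm (f x - s i x) \<partial>M)"
    proof (rule nn_integral_mono)
      fix x
      show "ennreal (norm (T (f x) - T (s i x))) \<le> ennreal K' * ennreal (norm (f x - s i x))"
        using K' by (simp flip: T.diff ennreal_mult add: ennreal_leI)
    qed
    also have "\<dots> = ennreal K' * (\<integral>\<^sup>+x. norm (f x - s i x) \<partial>M)"
      by (rule nn_integral_cmult) (use m[of i] in measurable)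
    finally show ?thesis .
  qed
  have sm: "strongly_measurable M (\<lambda>x. T (f x))"
    unfolding strongly_measurable_def
  proof (intro exI[of _ "\<lambda>i x. T (s' i x)"] conjI allI)
    show "simple_function M (\<lambda>x. T (s' i x))" for i
      by (intro simple_function_compose1[where g=T] s')
    show "AE x in M. (\<lambda>i. T (s' i x)) \<longlonglongrightarrow> T (f x)"
      using s'(2) by eventually_elim (rule T.tendsto)
  qed
  show ?thesis
    unfolding has_strong_bochner_integral_def
  proof (intro exI[of _ "\<lambda>i x. T (s i x)"] conjI allI sm)
    show "Bochner_Integration.simple_bochner_integrable M (\<lambda>x. T (s i x))" for i
      using simple_bochner_integrable_compose2[where p="\<lambda>x y. T x", OF _ s(1) s(1)]
      by (simp add: T.zero)
    show "(\<lambda>i. Bochner_Integration.simple_bochner_integral M (\<lambda>x. T (s i x))) \<longlonglongrightarrow> T I"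
      using T.tendsto[OF s(3)] by (subst simple_bochner_integral_linear[OF T.linear_axioms s(1)])
    have "(\<lambda>i. ennreal K' * (\<integral>\<^sup>+x. norm (f x - s i x) \<partial>M)) \<longlonglongrightarrow> ennreal K' * 0"
      by (rule ennreal_tendsto_cmult[OF _ s(2)]) simp
    then have lim: "(\<lambda>i. ennreal K' * (\<integral>\<^sup>+x. norm (f x - s i x) \<partial>M)) \<longlonglongrightarrow> 0"
      by simp
    show "(\<lambda>i. \<integral>\<^sup>+x. norm (T (f x) - T (s i x)) \<partial>M) \<longlonglongrightarrow> 0"
      by (rule tendsto_sandwich[OF _ _ tendsto_const lim]) (use le in auto)
  qed
qed

lemma has_strong_bochner_integral_norm_bound:
  assumes M: "complete_measure M" and f: "has_strong_bochner_integral M f I"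
  shows "ennreal (norm I) \<le> (\<integral>\<^sup>+x. norm (f x) \<partial>M)"
proof -
  interpret complete_measure M by fact
  from f obtain s where sf: "strongly_measurable M f"
    and s: "\<And>i. Bochner_Integration.simple_bochner_integrable M (s i)"
      "(\<lambda>i. \<integral>\<^sup>+x. norm (f x - s i x) \<partial>M) \<longlonglongrightarrow> 0" "(\<lambda>i. Bochner_Integration.simple_bochner_integral M (s i)) \<longlonglongrightarrow> I"
    unfolding has_strong_bochner_integral_def by auto
  have m [measurable]: "(\<lambda>x. norm (f x - s i x)) \<in> borel_measurable M" "(\<lambda>x. norm (f x)) \<in> borel_measurable M" for i
    using s(1) sf strongly_measurable_norm[OF sf]
    by (auto intro!: norm_diff_simple_measurable dest: simple_bochner_integrableD)
  have le: "ennreal (norm (Bochner_Integration.simple_bochner_integral M (s i)))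
      \<le> (\<integral>\<^sup>+x. norm (f x) \<partial>M) + (\<integral>\<^sup>+x. norm (f x - s i x) \<partial>M)" for i
  proof -
    have "ennreal (norm (Bochner_Integration.simple_bochner_integral M (s i)))
        \<le> ennreal (Bochner_Integration.simple_bochner_integral M (\<lambda>x. norm (s i x)))"
      by (intro ennreal_leI simple_bochner_integral_norm_bound s)
    also have "\<dots> = (\<integral>\<^sup>+x. norm (s i x) \<partial>M)"
      by (rule simple_bochner_integral_eq_nn_integral)
         (use simple_bochner_integrable_compose2[where p="\<lambda>x y. norm x", OF _ s(1) s(1)] in auto)
    also have "\<dots> \<le> (\<integral>\<^sup>+x. ennreal (norm (f x)) + ennreal (norm (f x - s i x)) \<partial>M)"
    proof (rule nn_integral_mono)
      fix x
      have "norm (s i x) \<le> norm (f x) + norm (f x - s i x)"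
        using norm_triangle_ineq4[of "f x" "f x - s i x"] by simp
      then show "ennreal (norm (s i x)) \<le> ennreal (norm (f x)) + ennreal (norm (f x - s i x))"
        by (simp flip: ennreal_plus)
    qed
    also have "\<dots> = (\<integral>\<^sup>+x. norm (f x) \<partial>M) + (\<integral>\<^sup>+x. norm (f x - s i x) \<partial>M)"
      by (rule nn_integral_add) auto
    finally show ?thesis .
  qed
  have 1: "(\<lambda>i. ennreal (norm (Bochner_Integration.simple_bochner_integral M (s i)))) \<longlonglongrightarrow> ennreal (norm I)"
    by (intro tendsto_ennrealI tendsto_norm s)
  have 2: "(\<lambda>i. (\<integral>\<^sup>+x. norm (f x) \<partial>M) + (\<integral>\<^sup>+x. norm (f x - s i x) \<partial>M))
       \<longlonglongrightarrow> (\<integral>\<^sup>+x. norm (f x) \<partial>M) + 0"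
    by (intro tendsto_add tendsto_const s)
  show ?thesis
    using LIMSEQ_le[OF 1 2] le by auto
qed

text \<open>The zero function \<open>f - f\<close> has integral \<open>I - J\<close>, so the norm
  bound forces \<open>I = J\<close>.\<close>

lemma has_strong_bochner_integral_unique:
  assumes "complete_measure M" "has_strong_bochner_integral M f I" "has_strong_bochner_integral M f J"
  shows "I = J"
  using has_strong_bochner_integral_norm_bound[OF assms(1)
      has_strong_bochner_integral_diff[OF assms]] by simp

lemma strong_bochner_integral_eq:
  assumes "complete_measure M" "has_strong_bochner_integral M f I"
  shows "strong_bochner_integral M f = I"
  unfolding strong_bochner_integral_def
  using assms has_strong_bochner_integral_unique[OF assms(1)] by (auto intro!: the_equality)

lemma has_strong_bochner_integral_zero:
  "has_strong_bochner_integral M (\<lambda>x. 0) (0::'x::real_normed_vector)"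
proof -
  have "Bochner_Integration.simple_bochner_integral M (\<lambda>x. 0::'x) = 0"
    unfolding simple_bochner_integral_def by (rule sum.neutral) auto
  then show ?thesis
    unfolding has_strong_bochner_integral_def
    by (auto intro!: strongly_measurable_simple exI[of _ "\<lambda>i x. 0"]
        Bochner_Integration.simple_bochner_integrable.intros)
qed

lemma has_strong_bochner_integral_add:
  assumes M: "complete_measure M"
    and f: "has_strong_bochner_integral M f I" and g: "has_strong_bochner_integral M g J"
  shows "has_strong_bochner_integral M (\<lambda>x. f x + g x) (I + J)"
  using has_strong_bochner_integral_diff[OF M f
      has_strong_bochner_integral_diff[OF M has_strong_bochner_integral_zero g]] by simp

lemma has_strong_bochner_integral_sum:
  assumes M: "complete_measure M" and "finite F"
    and "\<And>i. i \<in> F \<Longrightarrow> has_strong_bochner_integral M (f i) (I i)"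
  shows "has_strong_bochner_integral M (\<lambda>x. \<Sum>i\<in>F. f i x) (\<Sum>i\<in>F. I i)"
  using assms(2,3)
proof (induction F rule: finite_induct)
  case empty
  then show ?case by (simp add: has_strong_bochner_integral_zero)
next
  case (insert i F)
  then show ?case
    using has_strong_bochner_integral_add[OF M, of "f i" "I i" "\<lambda>x. \<Sum>i\<in>F. f i x" "\<Sum>i\<in>F. I i"]
    by simp
qed

lemma has_strong_bochner_integral_scaleC_const:
  assumes "complete_measure M" "has_bochner_integral M h I"
  shows "has_strong_bochner_integral M (\<lambda>x. h x *\<^sub>C (c::'x::complex_banach)) (I *\<^sub>C c)"
  by (rule has_strong_bochner_integral_bounded_linear[OF assms(1) scaleC.bounded_linear_left
      has_bochner_integral_imp_strong[OF assms(2)]])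

text \<open>Truncating the approximating simple functions where they exceed \<open>2 \<parallel>f\<parallel>\<close> supplies the
  dominating function for the limit.\<close>
lemma strongly_measurable_L1_approx:
  assumes M: "complete_measure M" and f: "strongly_measurable M f"
    and fin: "(\<integral>\<^sup>+x. norm (f x) \<partial>M) < \<infinity>"
  obtains s where "\<And>i::nat. simple_function M (s i)"
    "(\<lambda>i. \<integral>\<^sup>+x. norm (f x - s i x) \<partial>M) \<longlonglongrightarrow> 0"
    "\<And>i x. norm (s i x) \<le> 2 * norm (f x)"
proof -
  interpret complete_measure M by fact
  from f obtain t where t: "\<And>i. simple_function M (t i)" "AE x in M. (\<lambda>i. t i x) \<longlonglongrightarrow> f x"
    unfolding strongly_measurable_def by auto
  define s where "s i x = (if norm (t i x) \<le> 2 * norm (f x) then t i x else 0)" for i x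
  have nf [measurable]: "(\<lambda>x. norm (f x)) \<in> borel_measurable M"
    by (rule strongly_measurable_norm) fact
  have nt [measurable]: "(\<lambda>x. norm (t i x)) \<in> borel_measurable M" for i
    by (intro borel_measurable_simple_function simple_function_compose1[where g=norm] t)
  have s: "simple_function M (s i)" for i
    unfolding s_def by (rule simple_function_If) (auto intro!: t)
  have bound: "norm (s i x) \<le> 2 * norm (f x)" for i x
    by (simp add: s_def)
  have lim: "AE x in M. (\<lambda>i. s i x) \<longlonglongrightarrow> f x"
    using t(2)
  proof eventually_elim
    case (elim x)
    show ?case
    proof (cases "f x = 0")
      case True
      then have "s i x = 0" for i by (simp add: s_def)
      then show ?thesis using True by simp
    next
      case False
      have "eventually (\<lambda>i. norm (t i x) < 2 * norm (f x)) sequentially"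
        using order_tendstoD(2)[OF tendsto_norm[OF elim], of "2 * norm (f x)"] False by simp
      then have "eventually (\<lambda>i. t i x = s i x) sequentially"
        by eventually_elim (simp add: s_def)
      then show ?thesis using elim by (rule Lim_transform_eventually[rotated])
    qed
  qed
  have "(\<lambda>i. \<integral>\<^sup>+x. norm (f x - s i x) \<partial>M) \<longlonglongrightarrow> (\<integral>\<^sup>+x. 0 \<partial>M)"
  proof (rule nn_integral_dominated_convergence[where w="\<lambda>x. ennreal 3 * norm (f x)"])
    show "(\<lambda>x. ennreal (norm (f x - s i x))) \<in> borel_measurable M" for i
      using strongly_measurable_norm[OF strongly_measurable_diff[OF f strongly_measurable_simple[OF s]]]
      by measurable
    show "(\<integral>\<^sup>+x. ennreal 3 * norm (f x) \<partial>M) < \<infinity>"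
      using fin by (subst nn_integral_cmult) (auto simp: ennreal_mult_less_top)
    show "AE x in M. ennreal (norm (f x - s i x)) \<le> ennreal 3 * ennreal (norm (f x))" for i
    proof (rule AE_I2)
      fix x
      have "norm (f x - s i x) \<le> 3 * norm (f x)"
        using norm_triangle_ineq4[of "f x" "s i x"] bound[of i x] by simp
      then show "ennreal (norm (f x - s i x)) \<le> ennreal 3 * ennreal (norm (f x))"
        by (metis ennreal_leI ennreal_mult' zero_le_numeral)
    qed
    show "AE x in M. (\<lambda>i. ennreal (norm (f x - s i x))) \<longlonglongrightarrow> 0"
      using lim
    proof eventually_elim
      case (elim x)
      have "(\<lambda>i. ennreal (norm (f x - s i x))) \<longlonglongrightarrow> ennreal (norm (f x - f x))"
        by (intro tendsto_ennrealI tendsto_norm tendsto_diff tendsto_const elim)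
      then show ?case by simp
    qed
  qed auto
  then show ?thesis
    using that[of s] s bound by simp
qed

text \<open>The integrals of L^1 approximants form a Cauchy sequence, and completeness of the target
  yields the value. Finiteness of the measure makes every simple function integrable, whatever its
  support.\<close>

lemma has_strong_bochner_integral_exists:
  fixes f :: "'a \<Rightarrow> 'x::banach"
  assumes M: "complete_measure M" and fM: "emeasure M (space M) < \<infinity>"
    and f: "strongly_measurable M f"
    and fin: "(\<integral>\<^sup>+x. norm (f x) \<partial>M) < \<infinity>"
  obtains I where "has_strong_bochner_integral M f I"
proof -
  interpret complete_measure M by fact
  obtain s where s: "\<And>i::nat. simple_function M (s i)"
    "(\<lambda>i. \<integral>\<^sup>+x. norm (f x - s i x) \<partial>M) \<longlonglongrightarrow> 0"
    using strongly_measurable_L1_approx[OF M f fin] by metis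
  have si: "Bochner_Integration.simple_bochner_integrable M (s i)" for i
  proof
    have "emeasure M {y \<in> space M. s i y \<noteq> 0} \<le> emeasure M (space M)"
      by (rule emeasure_space)
    then show "emeasure M {y \<in> space M. s i y \<noteq> 0} \<noteq> \<infinity>"
      using fM by auto
  qed (rule s)
  have m [measurable]: "(\<lambda>x. norm (f x - s i x)) \<in> borel_measurable M" for i
    using s(1) f
    by (auto intro!: norm_diff_simple_measurable)
  have "Cauchy (\<lambda>i. Bochner_Integration.simple_bochner_integral M (s i))"
  proof (rule metric_CauchyI)
    fix e :: real assume "0 < e"
    then have "eventually (\<lambda>i. (\<integral>\<^sup>+x. norm (f x - s i x) \<partial>M) < ennreal (e/2)) sequentially"
      by (intro order_tendstoD(2)[OF s(2)]) auto
    then obtain N where N: "\<And>i. i \<ge> N \<Longrightarrow> (\<integral>\<^sup>+x. norm (f x - s i x) \<partial>M) < ennreal (e/2)"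
      by (auto simp: eventually_sequentially)
    show "\<exists>N. \<forall>i\<ge>N. \<forall>j\<ge>N. dist (Bochner_Integration.simple_bochner_integral M (s i)) (Bochner_Integration.simple_bochner_integral M (s j)) < e"
    proof (intro exI[of _ N] allI impI)
      fix i j assume ij: "N \<le> i" "N \<le> j"
      have "ennreal (norm (Bochner_Integration.simple_bochner_integral M (s i) - Bochner_Integration.simple_bochner_integral M (s j)))
        \<le> (\<integral>\<^sup>+x. norm (f x - s i x) \<partial>M) + (\<integral>\<^sup>+x. norm (f x - s j x) \<partial>M)"
      proof -
        have "ennreal (norm (Bochner_Integration.simple_bochner_integral M (s i) - Bochner_Integration.simple_bochner_integral M (s j)))
          = ennreal (norm (Bochner_Integration.simple_bochner_integral M (\<lambda>x. s i x - s j x)))"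
          by (simp add: simple_bochner_integral_diff si)
        also have "\<dots> \<le> ennreal (Bochner_Integration.simple_bochner_integral M (\<lambda>x. norm (s i x - s j x)))"
          by (intro ennreal_leI simple_bochner_integral_norm_bound
              simple_bochner_integrable_compose2[where p="(-)"] si) simp
        also have "\<dots> = (\<integral>\<^sup>+x. norm (s i x - s j x) \<partial>M)"
          by (intro simple_bochner_integral_eq_nn_integral
              simple_bochner_integrable_compose2[where p="\<lambda>x y. norm (x - y)"] si) auto
        also have "\<dots> \<le> (\<integral>\<^sup>+x. ennreal (norm (f x - s i x)) + ennreal (norm (f x - s j x)) \<partial>M)"
        proof (rule nn_integral_mono)
          fix x
          have "norm (s i x - s j x) \<le> norm (f x - s i x) + norm (f x - s j x)"
            using norm_triangle_ineq4[of "f x - s j x" "f x - s i x"] by simp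
          then show "ennreal (norm (s i x - s j x))
              \<le> ennreal (norm (f x - s i x)) + ennreal (norm (f x - s j x))"
            by (simp flip: ennreal_plus)
        qed
        also have "\<dots> = (\<integral>\<^sup>+x. norm (f x - s i x) \<partial>M) + (\<integral>\<^sup>+x. norm (f x - s j x) \<partial>M)"
          by (rule nn_integral_add) auto
        finally show ?thesis .
      qed
      also have "\<dots> < ennreal (e/2) + ennreal (e/2)"
        by (intro add_strict_mono N ij)
      also have "\<dots> = ennreal e" using \<open>0 < e\<close> by (simp flip: ennreal_plus)
      finally show "dist (Bochner_Integration.simple_bochner_integral M (s i)) (Bochner_Integration.simple_bochner_integral M (s j)) < e"
        by (simp add: dist_norm ennreal_less_iff)
    qed
  qed
  then obtain I where "(\<lambda>i. Bochner_Integration.simple_bochner_integral M (s i)) \<longlonglongrightarrow> I"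
    by (auto simp: Cauchy_convergent_iff convergent_def)
  then have "has_strong_bochner_integral M f I"
    unfolding has_strong_bochner_integral_def using f si s by auto
  then show ?thesis by (rule that)
qed

section \<open>Gaussians and characters\<close>

lemma prod_vec_Basis:
  fixes f :: "'d::finite \<Rightarrow> real \<Rightarrow> 'b::comm_monoid_mult"
  shows "(\<Prod>b\<in>Basis. f (axis_index b) (x \<bullet> b)) = (\<Prod>j\<in>UNIV. f j ((x::real^'d) $ j))"
proof -
  have B: "(Basis :: (real^'d) set) = (\<lambda>j. axis j 1) ` UNIV"
    by (auto simp: Basis_vec_def)
  have inj: "inj (\<lambda>j::'d. axis j (1::real))"
    by (auto simp: inj_def axis_eq_axis)
  show ?thesis
    unfolding B by (subst prod.reindex[OF inj]) (simp add: inner_axis)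
qed

text \<open>Fubini's theorem for a product of functions of one coordinate each: Lebesgue measure is
  the image of the product measure over \<open>Basis\<close>. Both the Gaussian and the characters
  on the cube are reduced to dimension one in this way.\<close>

lemma has_bochner_integral_vec_prod:
  fixes f :: "'d::finite \<Rightarrow> real \<Rightarrow> complex"
  assumes f: "\<And>j. has_bochner_integral lborel (f j) (I j)"
  shows "has_bochner_integral lborel (\<lambda>x::real^'d. \<Prod>j\<in>UNIV. f j (x $ j)) (\<Prod>j\<in>UNIV. I j)"
proof -
  interpret product_sigma_finite "\<lambda>_::real^'d. lborel :: real measure" by standard
  define f' where "f' b = f (axis_index b)" for b :: "real^'d"
  have int: "integrable lborel (f j)" "integral\<^sup>L lborel (f j) = I j" for j
    using f[of j] by (auto simp: has_bochner_integral_iff)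
  then have [measurable]: "f j \<in> borel_measurable borel" for j
    using borel_measurable_integrable[OF int(1)[of j]] by simp
  have m: "(\<lambda>x::real^'d. \<Prod>b\<in>Basis. f' b (x \<bullet> b)) \<in> borel_measurable borel"
    unfolding f'_def by measurable
  have in_b: "(\<Sum>b\<in>Basis. y b *\<^sub>R b) \<bullet> c = y c" if "c \<in> Basis" for y and c :: "real^'d"
    using that by (simp add: inner_sum_left inner_Basis if_distrib cong: if_cong)
  have "has_bochner_integral (Pi\<^sub>M Basis (\<lambda>_. lborel)) (\<lambda>y. \<Prod>b\<in>(Basis::(real^'d) set). f' b (y b))
      (\<Prod>b\<in>(Basis::(real^'d) set). I (axis_index b))"
    unfolding has_bochner_integral_iff
    using product_integrable_prod[of Basis f'] product_integral_prod[of Basis f'] int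
    by (simp add: f'_def)
  then have "has_bochner_integral lborel (\<lambda>x::real^'d. \<Prod>b\<in>Basis. f' b (x \<bullet> b))
      (\<Prod>b\<in>(Basis::(real^'d) set). I (axis_index b))"
    apply (subst lborel_eq)
    apply (subst has_bochner_integral_distr)
    using m in_b by (simp_all cong: prod.cong)
  moreover have "(\<Prod>b\<in>(Basis::(real^'d) set). I (axis_index b)) = (\<Prod>j\<in>UNIV. I j)"
    using prod_vec_Basis[of "\<lambda>j _. I j"] by simp
  ultimately show ?thesis
    unfolding f'_def by (simp add: prod_vec_Basis)
qed

lemma has_bochner_integral_gaussian_real:
  assumes e: "0 < (e::real)"
  shows "has_bochner_integral lborel (\<lambda>t. complex_of_real (exp (- pi * e\<^sup>2 * t\<^sup>2)) * cis (- 2 * pi * (t * s)))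
    (complex_of_real (exp (- pi * s\<^sup>2 / e\<^sup>2) / e))"
proof -
  \<comment> \<open>The integral is the characteristic function of the standard normal law,
    rescaled: \<open>c\<close> is chosen so that
    \<open>(c * x)\<^sup>2 / 2 = pi * e\<^sup>2 * x\<^sup>2\<close>, and \<open>u\<close> so that
    \<open>u * (c * x)\<close> is the phase \<open>- 2 * pi * (x * s)\<close>.\<close>
  define c where "c = e * sqrt (2 * pi)"
  have c: "0 < c" "c\<^sup>2 = 2 * pi * e\<^sup>2" using e by (auto simp: c_def power_mult_distrib)
  define u where "u = - 2 * pi * s / c"
  have "integrable std_normal_distribution (\<lambda>x. iexp (u * x))"
    by (intro prob_space.integrable_iexp) (auto intro: prob_space_normal_density)
  moreover have "integral\<^sup>L std_normal_distribution (\<lambda>x. iexp (u * x)) = complex_of_real (exp (- (u^2) / 2))"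
    using char_std_normal_distribution by (auto simp: char_def fun_eq_iff)
  ultimately have "has_bochner_integral std_normal_distribution (\<lambda>x. iexp (u * x)) (complex_of_real (exp (- (u^2) / 2)))"
    by (simp add: has_bochner_integral_iff)
  then have 1: "has_bochner_integral lborel (\<lambda>x. std_normal_density x *\<^sub>R iexp (u * x)) (complex_of_real (exp (- (u^2) / 2)))"
    by (simp add: has_bochner_integral_iff integrable_density integral_density normal_density_nonneg)
  have "has_bochner_integral lborel (\<lambda>x. std_normal_density (0 + c * x) *\<^sub>R iexp (u * (0 + c * x)))
     (complex_of_real (exp (- (u^2) / 2)) /\<^sub>R \<bar>c\<bar>)"
    using c(1) lborel_has_bochner_integral_real_affine_iff[THEN iffD1, of c _ _ 0, OF _ 1] by simp
  from has_bochner_integral_scaleR_right[OF this, of "sqrt (2 * pi)"]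
  have "has_bochner_integral lborel
     (\<lambda>x. sqrt (2 * pi) *\<^sub>R std_normal_density (0 + c * x) *\<^sub>R iexp (u * (0 + c * x)))
     (sqrt (2 * pi) *\<^sub>R (complex_of_real (exp (- (u^2) / 2)) /\<^sub>R \<bar>c\<bar>))" .
  moreover have "sqrt (2 * pi) *\<^sub>R std_normal_density (0 + c * x) *\<^sub>R iexp (u * (0 + c * x))
      = complex_of_real (exp (- pi * e\<^sup>2 * x\<^sup>2)) * cis (- 2 * pi * (x * s))" for x
  proof -
    have "(c * x)\<^sup>2 / 2 = pi * e\<^sup>2 * x\<^sup>2" using c by (simp add: power_mult_distrib)
    moreover have "u * (c * x) = - 2 * pi * (x * s)" using c by (simp add: u_def)
    ultimately show ?thesis
      by (simp add: std_normal_density_def cis_conv_exp scaleR_conv_of_real flip: of_real_mult)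
  qed
  moreover have "sqrt (2 * pi) *\<^sub>R (complex_of_real (exp (- (u^2) / 2)) /\<^sub>R \<bar>c\<bar>)
      = complex_of_real (exp (- pi * s\<^sup>2 / e\<^sup>2) / e)"
  proof -
    have "u\<^sup>2 / 2 = pi * s\<^sup>2 / e\<^sup>2"
      unfolding u_def power_divide c(2) using e by (simp add: power_mult_distrib field_simps power2_eq_square)
    moreover have "sqrt (2 * pi) * (inverse \<bar>c\<bar> * E) = E / e" for E
      using e by (simp add: c_def abs_mult field_simps)
    ultimately show ?thesis
      by (simp add: scaleR_conv_of_real flip: of_real_mult of_real_divide of_real_inverse)
  qed
  ultimately show ?thesis by simp
qed

lemma power2_norm_vec: "x \<bullet> x = (\<Sum>j\<in>UNIV. (x $ j)\<^sup>2)" for x :: "real^'d::finite"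
  by (simp add: inner_vec_def power2_eq_square)

lemma has_bochner_integral_gaussian:
  assumes e: "0 < (e::real)"
  shows "has_bochner_integral lborel
    (\<lambda>x::real^'d::finite. complex_of_real (exp (- pi * e\<^sup>2 * (x \<bullet> x))) * cis (- 2 * pi * (x \<bullet> s)))
    (complex_of_real (exp (- pi * (s \<bullet> s) / e\<^sup>2) / e ^ CARD('d)))"
proof -
  have "has_bochner_integral lborel
    (\<lambda>x::real^'d. \<Prod>j\<in>UNIV. complex_of_real (exp (- pi * e\<^sup>2 * (x$j)\<^sup>2)) * cis (- 2 * pi * ((x$j) * (s$j))))
    (\<Prod>j\<in>UNIV. complex_of_real (exp (- pi * (s$j)\<^sup>2 / e\<^sup>2) / e))"
    by (rule has_bochner_integral_vec_prod) (rule has_bochner_integral_gaussian_real[OF e])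
  moreover have "(\<Prod>j\<in>UNIV. complex_of_real (exp (- pi * e\<^sup>2 * (x$j)\<^sup>2)) * cis (- 2 * pi * ((x$j) * (s$j))))
     = complex_of_real (exp (- pi * e\<^sup>2 * (x \<bullet> x))) * cis (- 2 * pi * (x \<bullet> s))" for x :: "real^'d"
    unfolding prod.distrib cis_conv_exp exp_sum[symmetric, OF finite] of_real_prod[symmetric]
    unfolding power2_norm_vec
    by (simp add: inner_vec_def sum_distrib_left sum_negf)
  moreover have "(\<Prod>j\<in>UNIV. complex_of_real (exp (- pi * (s$j)\<^sup>2 / e\<^sup>2) / e))
     = complex_of_real (exp (- pi * (s \<bullet> s) / e\<^sup>2) / e ^ CARD('d))"
    unfolding of_real_prod[symmetric] prod_dividef exp_sum[symmetric, OF finite] power2_norm_vec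
    by (simp add: sum_distrib_left sum_negf sum_divide_distrib)
  ultimately show ?thesis by simp
qed

lemma nn_integral_gaussian:
  assumes e: "0 < (e::real)"
  shows "(\<integral>\<^sup>+(x::real^'d::finite). ennreal (exp (- pi * e\<^sup>2 * (x \<bullet> x))) \<partial>lborel) = ennreal (1 / e ^ CARD('d))"
proof -
  have "has_bochner_integral lborel
    (\<lambda>x::real^'d. Re (complex_of_real (exp (- pi * e\<^sup>2 * (x \<bullet> x))) * cis (- 2 * pi * (x \<bullet> 0))))
    (Re (complex_of_real (exp (- pi * ((0::real^'d) \<bullet> 0) / e\<^sup>2) / e ^ CARD('d))))"
    by (rule has_bochner_integral_bounded_linear[OF bounded_linear_Re has_bochner_integral_gaussian[OF e]])
  then have "has_bochner_integral lborel (\<lambda>x::real^'d. exp (- pi * e\<^sup>2 * (x \<bullet> x))) (1 / e ^ CARD('d))"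
    by simp
  then show ?thesis
    by (simp add: has_bochner_integral_iff nn_integral_eq_integral)
qed

section \<open>Lebesgue measure on the cube and orthogonality of characters\<close>

lemma has_bochner_integral_lebesgue:
  fixes f :: "'a::euclidean_space \<Rightarrow> 'b::{banach, second_countable_topology}"
  assumes "has_bochner_integral lborel f I"
  shows "has_bochner_integral lebesgue f I"
  using assms borel_measurable_integrable[of lborel f]
  by (simp add: has_bochner_integral_iff integrable_completion integral_completion)

lemma complete_measure_lebesgue_on:
  assumes S: "S \<in> sets lebesgue"
  shows "complete_measure (lebesgue_on (S::'a::euclidean_space set))"
proof
  fix A B :: "'a set" assume "B \<subseteq> A" "A \<in> null_sets (lebesgue_on S)"
  then have A: "A \<in> null_sets lebesgue" "A \<subseteq> S"
    using null_sets_restrict_space[OF S] by auto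
  with \<open>B \<subseteq> A\<close> have "B \<in> sets lebesgue" "B \<subseteq> S" by (auto intro: completion.complete)
  then show "B \<in> sets (lebesgue_on S)" using S by (auto simp: sets_restrict_space_iff)
qed

lemma torus_sets [measurable]: "torus \<in> sets borel" "torus \<in> sets lebesgue"
  unfolding torus_def by auto

lemmas complete_measure_torus = complete_measure_lebesgue_on[OF torus_sets(2)]

lemma mem_torus: "x \<in> torus \<longleftrightarrow> (\<forall>j. - 1 / 2 \<le> x $ j \<and> x $ j \<le> 1 / 2)"
  by (simp add: torus_def mem_box_cart)

lemma emeasure_torus: "emeasure lborel (torus :: (real^'d::finite) set) = 1"
  unfolding torus_def
  by (subst emeasure_lborel_cbox) (auto simp: Basis_vec_def inner_axis intro!: prod.neutral)

lemma emeasure_space_torus: "emeasure (lebesgue_on (torus :: (real^'d::finite) set)) (space (lebesgue_on torus)) = 1"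
  by (simp add: emeasure_restrict_space emeasure_torus)

lemma has_bochner_integral_character_real:
  fixes k :: int
  shows "has_bochner_integral lborel (\<lambda>t. indicator {-1/2..1/2} t * cis (2 * pi * (t * of_int k)))
    (if k = 0 then 1 else 0)"
proof (cases "k = 0")
  case True
  have "has_bochner_integral lborel (\<lambda>t. indicator {-1/2..1/2::real} t *\<^sub>R (1::complex))
      (measure lborel {-1/2..1/2::real} *\<^sub>R 1)"
    by (rule has_bochner_integral_scaleR_left[OF has_bochner_integral_real_indicator]) auto
  moreover have "indicator {-1/2..1/2} t *\<^sub>R (1::complex) = indicator {-1/2..1/2} t" for t :: real
    by (simp add: indicator_def)
  ultimately show ?thesis using True by simp
next
  case False
  define c where "c = 2 * pi * of_int k"
  have c: "c \<noteq> 0" using False by (simp add: c_def)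
  define F where "F t = cis (c * t) / (\<i> * complex_of_real c)" for t
  have "has_bochner_integral lborel (\<lambda>x. indicator {-1/2..1/2} x *\<^sub>R cis (c * x)) (F (1/2) - F (-1/2))"
  proof (rule has_bochner_integral_FTC_Icc)
    fix x :: real
    have "((\<lambda>z. exp (\<i> * (complex_of_real c * z)) / (\<i> * complex_of_real c)) has_field_derivative
        exp (\<i> * (complex_of_real c * complex_of_real x))) (at (complex_of_real x))"
      using c by (auto intro!: derivative_eq_intros simp: mult.commute mult.left_commute)
    from has_vector_derivative_real_field[OF this]
    show "(F has_vector_derivative cis (c * x)) (at x within {-1/2..1/2})"
      unfolding F_def cis_conv_exp by simp
  next
    show "continuous_on {-1/2..1/2} (\<lambda>x. cis (c * x))"
      by (intro continuous_intros)
  qed auto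
  \<comment> \<open>The end points are one period apart: the two \<open>cis\<close> values are
    conjugate to each other, and \<open>sin (pi * k)\<close> vanishes.\<close>
  moreover have "F (1/2) = F (-1/2)"
  proof -
    have "cis (pi * of_int k) = cis (- (pi * of_int k))"
      by (simp add: complex_eq_iff sin_times_pi_eq_0 mult.commute)
    then show ?thesis by (simp add: F_def c_def)
  qed
  moreover have "indicator {-1/2..1/2} x *\<^sub>R cis (c * x)
      = indicator {-1/2..1/2} x * cis (2 * pi * (x * of_int k))" for x
    by (simp add: c_def indicator_def ac_simps)
  ultimately show ?thesis using False by simp
qed

lemma has_bochner_integral_character:
  fixes k :: "int^'d::finite"
  shows "has_bochner_integral (lebesgue_on torus) (\<lambda>x. cis (2 * pi * (x \<bullet> (\<chi> j. of_int (k $ j)))))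
    (if k = 0 then 1 else 0)"
proof -
  have "has_bochner_integral lborel
      (\<lambda>x::real^'d. \<Prod>j\<in>UNIV. indicator {-1/2..1/2} (x$j) * cis (2 * pi * ((x$j) * of_int (k$j))))
      (\<Prod>j\<in>UNIV. if k $ j = 0 then 1 else 0)"
    by (rule has_bochner_integral_vec_prod) (rule has_bochner_integral_character_real)
  moreover have "(\<Prod>j\<in>UNIV. indicator {-1/2..1/2} (x$j) * cis (2 * pi * ((x$j) * of_int (k$j))))
      = indicator torus x *\<^sub>R cis (2 * pi * (x \<bullet> (\<chi> j. of_int (k $ j))))" for x :: "real^'d"
  proof -
    have "(\<Prod>j\<in>UNIV. indicator {-1/2..1/2} (x$j) :: complex) = of_real (indicator torus x)"
    proof (cases "x \<in> torus")
      case True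
      then show ?thesis by (auto simp: mem_torus intro!: prod.neutral)
    next
      case False
      then obtain j where "x $ j \<notin> {-1/2..1/2}" by (auto simp: mem_torus)
      then have "\<exists>j\<in>UNIV. (indicator {-1/2..1/2} (x$j) :: complex) = 0"
        by (intro bexI[of _ j]) auto
      then show ?thesis using False by (simp add: prod_zero_iff)
    qed
    then show ?thesis
      unfolding prod.distrib cis_conv_exp exp_sum[symmetric, OF finite]
      by (simp add: inner_vec_def sum_distrib_left scaleR_conv_of_real)
  qed
  moreover have "(\<Prod>j\<in>UNIV. if k $ j = 0 then 1 else 0 :: complex) = (if k = 0 then 1 else 0)"
    by (auto simp: vec_eq_iff prod_zero_iff intro!: prod.neutral)
  ultimately have "has_bochner_integral lborel
      (\<lambda>x::real^'d. indicator torus x *\<^sub>R cis (2 * pi * (x \<bullet> (\<chi> j. of_int (k $ j))))) (if k = 0 then 1 else 0)"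
    by simp
  from has_bochner_integral_lebesgue[OF this] show ?thesis
    by (simp add: has_bochner_integral_iff integrable_restrict_space integral_restrict_space)
qed

section \<open>Schwartz functions of Gaussian type\<close>

text \<open>Modulated Gaussians of one fixed width times polynomials, with vector coefficients.
  Generating the class by rules instead of writing out polynomials makes closure under
  differentiation a plain induction; complex factors are absorbed into \<open>c\<close>.\<close>

inductive gauss_class :: "real \<Rightarrow> (real^'d::finite \<Rightarrow> 'x::complex_banach) \<Rightarrow> bool" for a where
  base: "gauss_class a (\<lambda>x. (complex_of_real (exp (- a * (x \<bullet> x))) * cis (x \<bullet> s)) *\<^sub>C c)"
| coord: "gauss_class a f \<Longrightarrow> gauss_class a (\<lambda>x. (x $ j) *\<^sub>R f x)"
| scale: "gauss_class a f \<Longrightarrow> gauss_class a (\<lambda>x. r *\<^sub>R f x)"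
| add: "gauss_class a f \<Longrightarrow> gauss_class a g \<Longrightarrow> gauss_class a (\<lambda>x. f x + g x)"

lemma gauss_class_zero: "gauss_class a (\<lambda>x. 0)"
  using gauss_class.scale[OF gauss_class.base, of a 0] by simp

lemma gauss_class_sum:
  "finite F \<Longrightarrow> (\<And>i. i \<in> F \<Longrightarrow> gauss_class a (f i)) \<Longrightarrow> gauss_class a (\<lambda>x. \<Sum>i\<in>F. f i x)"
proof (induction F rule: finite_induct)
  case empty
  then show ?case by (simp add: gauss_class_zero)
next
  case (insert i F)
  then show ?case using gauss_class.add[of a "f i" "\<lambda>x. \<Sum>i\<in>F. f i x"] by simp
qed

text \<open>One induction yields both facts needed for Schwartz functions: differentiability, and
  that the coefficients of the derivative, which are the partial derivatives, lie in the class
  again.\<close>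

lemma gauss_class_derivative:
  fixes f :: "real^'d::finite \<Rightarrow> 'x::complex_banach"
  assumes "gauss_class a f"
  shows "\<exists>f'. (\<forall>j. gauss_class a (f' j)) \<and>
     (\<forall>x. (f has_derivative (\<lambda>h. \<Sum>j\<in>UNIV. (h $ j) *\<^sub>R f' j x)) (at x))"
  using assms
proof induction
  case (base s c)
  define w where "w = (\<lambda>x::real^'d. complex_of_real (exp (- a * (x \<bullet> x))) * cis (x \<bullet> s))"
  \<comment> \<open>Product rule: the Gaussian contributes \<open>- 2 * a * x $ j\<close>, covered
    by the rules \<open>coord\<close> and \<open>scale\<close>; the character contributes
    \<open>\<i> * s $ j\<close>, moved into the vector so that the rule \<open>base\<close>
    applies.\<close>
  define f' where "f' j x = (- 2 * a) *\<^sub>R (x $ j) *\<^sub>R (w x *\<^sub>C c) + w x *\<^sub>C ((\<i> * complex_of_real (s $ j)) *\<^sub>C c)" for j x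
  have "(w has_derivative (\<lambda>h. complex_of_real (- 2 * a * (x \<bullet> h)) * w x + w x * (\<i> * complex_of_real (h \<bullet> s)))) (at x)" for x
  proof -
    have "((\<lambda>x. \<i> * complex_of_real (x \<bullet> s)) has_derivative (\<lambda>h. \<i> * complex_of_real (h \<bullet> s))) (at x)"
      by (auto intro!: derivative_eq_intros)
    from has_derivative_compose[OF this DERIV_exp[unfolded has_field_derivative_def]]
    have 1: "((\<lambda>x. exp (\<i> * complex_of_real (x \<bullet> s))) has_derivative
        (\<lambda>h. exp (\<i> * complex_of_real (x \<bullet> s)) * (\<i> * complex_of_real (h \<bullet> s)))) (at x)" .
    have "((\<lambda>x. - a * (x \<bullet> x)) has_derivative (\<lambda>h. - a * (2 * (x \<bullet> h)))) (at x)"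
      by (auto intro!: derivative_eq_intros simp: inner_commute)
    from has_derivative_of_real[OF has_derivative_compose[OF this DERIV_exp[unfolded has_field_derivative_def]]]
    have 2: "((\<lambda>x. complex_of_real (exp (- a * (x \<bullet> x)))) has_derivative
        (\<lambda>h. complex_of_real (exp (- a * (x \<bullet> x)) * (- a * (2 * (x \<bullet> h)))))) (at x)" .
    show ?thesis
      unfolding w_def cis_conv_exp
      by (rule has_derivative_eq_rhs[OF has_derivative_mult[OF 2 1]]) (simp add: fun_eq_iff algebra_simps)
  qed
  from scaleC.FDERIV[OF this has_derivative_const[of c]]
  have D: "((\<lambda>x. w x *\<^sub>C c) has_derivative (\<lambda>h. (complex_of_real (- 2 * a * (x \<bullet> h)) * w x + w x * (\<i> * complex_of_real (h \<bullet> s))) *\<^sub>C c)) (at x)" for x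
    by (simp add: scaleC.zero_right)
  have E: "(complex_of_real (- 2 * a * (x \<bullet> h)) * w x + w x * (\<i> * complex_of_real (h \<bullet> s))) *\<^sub>C c
     = (\<Sum>j\<in>UNIV. (h $ j) *\<^sub>R f' j x)" for x h
  proof -
    have "(\<Sum>j\<in>UNIV. (h $ j) *\<^sub>R f' j x)
       = (\<Sum>j\<in>UNIV. (complex_of_real (- 2 * a * (x$j * h$j)) * w x + w x * (\<i> * complex_of_real (h$j * s$j))) *\<^sub>C c)"
      unfolding f'_def
    proof (intro sum.cong refl)
      fix j
      have "h $ j *\<^sub>R ((- 2 * a) *\<^sub>R x $ j *\<^sub>R w x *\<^sub>C c + w x *\<^sub>C (\<i> * complex_of_real (s $ j)) *\<^sub>C c)
        = (complex_of_real (h $ j) * (complex_of_real (- 2 * a) * (complex_of_real (x $ j) * w x)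
            + w x * (\<i> * complex_of_real (s $ j)))) *\<^sub>C c"
        by (simp only: scaleC_of_real[symmetric] scaleC_scaleC scaleC_add_left[symmetric])
      also have "complex_of_real (h $ j) * (complex_of_real (- 2 * a) * (complex_of_real (x $ j) * w x)
            + w x * (\<i> * complex_of_real (s $ j)))
          = complex_of_real (- 2 * a * (x$j * h$j)) * w x + w x * (\<i> * complex_of_real (h$j * s$j))"
        by (simp add: algebra_simps)
      finally show "h $ j *\<^sub>R ((- 2 * a) *\<^sub>R x $ j *\<^sub>R w x *\<^sub>C c + w x *\<^sub>C (\<i> * complex_of_real (s $ j)) *\<^sub>C c)
        = (complex_of_real (- 2 * a * (x$j * h$j)) * w x + w x * (\<i> * complex_of_real (h$j * s$j))) *\<^sub>C c" .
    qed
    also have "\<dots> = (\<Sum>j\<in>UNIV. complex_of_real (- 2 * a * (x$j * h$j)) * w x + w x * (\<i> * complex_of_real (h$j * s$j))) *\<^sub>C c"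
      by (rule scaleC.sum_left[symmetric])
    also have "(\<Sum>j\<in>UNIV. complex_of_real (- 2 * a * (x$j * h$j)) * w x + w x * (\<i> * complex_of_real (h$j * s$j)))
       = complex_of_real (- 2 * a * (x \<bullet> h)) * w x + w x * (\<i> * complex_of_real (h \<bullet> s))"
      by (simp add: sum.distrib sum_subtractf inner_vec_def sum_distrib_left sum_distrib_right sum_negf mult.assoc)
    finally show ?thesis by simp
  qed
  show ?case
  proof (intro exI[of _ f'] conjI allI)
    show "gauss_class a (f' j)" for j
      unfolding f'_def w_def
      by (intro gauss_class.add gauss_class.scale gauss_class.coord gauss_class.base)
    show "((\<lambda>x. (complex_of_real (exp (- a * (x \<bullet> x))) * cis (x \<bullet> s)) *\<^sub>C c) has_derivative
          (\<lambda>h. \<Sum>j\<in>UNIV. h $ j *\<^sub>R f' j x)) (at x)" for x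
      using D[of x] unfolding E unfolding w_def .
  qed
next
  case (coord f i)
  then obtain f' where f': "\<And>j. gauss_class a (f' j)"
    "\<And>x. (f has_derivative (\<lambda>h. \<Sum>j\<in>UNIV. (h $ j) *\<^sub>R f' j x)) (at x)" by auto
  define g where "g j = (\<lambda>x. (x $ i) *\<^sub>R f' j x + (if i = j then 1 else 0) *\<^sub>R f x)" for j
  show ?case
  proof (intro exI[of _ g] conjI allI)
    show "gauss_class a (g j)" for j
      unfolding g_def
      by (rule gauss_class.add[OF gauss_class.coord[OF f'(1)] gauss_class.scale[OF coord(1)]])
    fix x
    have "((\<lambda>x. (x $ i) *\<^sub>R f x) has_derivative
        (\<lambda>h. (x $ i) *\<^sub>R (\<Sum>j\<in>UNIV. (h $ j) *\<^sub>R f' j x) + (h $ i) *\<^sub>R f x)) (at x)"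
      by (rule has_derivative_scaleR[OF bounded_linear_imp_has_derivative[OF bounded_linear_vec_nth] f'(2)])
    moreover have "(x $ i) *\<^sub>R (\<Sum>j\<in>UNIV. (h $ j) *\<^sub>R f' j x) + (h $ i) *\<^sub>R f x
       = (\<Sum>j\<in>UNIV. h $ j *\<^sub>R g j x)" for h
    proof -
      have "(\<Sum>j\<in>UNIV. h $ j *\<^sub>R (if i = j then 1 else 0) *\<^sub>R f x) = (\<Sum>j\<in>UNIV. if i = j then h $ i *\<^sub>R f x else 0)"
        by (intro sum.cong) auto
      then show ?thesis
        by (simp add: g_def scaleR_add_right sum.distrib scaleR_sum_right mult.commute)
    qed
    ultimately show "((\<lambda>x. (x $ i) *\<^sub>R f x) has_derivative (\<lambda>h. \<Sum>j\<in>UNIV. h $ j *\<^sub>R g j x)) (at x)"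
      by simp
  qed
next
  case (scale f r)
  then obtain f' where f': "\<And>j. gauss_class a (f' j)"
    "\<And>x. (f has_derivative (\<lambda>h. \<Sum>j\<in>UNIV. (h $ j) *\<^sub>R f' j x)) (at x)" by auto
  show ?case
  proof (intro exI[of _ "\<lambda>j x. r *\<^sub>R f' j x"] conjI allI gauss_class.scale f')
    show "((\<lambda>x. r *\<^sub>R f x) has_derivative (\<lambda>h. \<Sum>j\<in>UNIV. h $ j *\<^sub>R r *\<^sub>R f' j x)) (at x)" for x
      using has_derivative_scaleR_right[OF f'(2)[of x], of r]
      by (simp add: scaleR_sum_right mult.commute)
  qed
next
  case (add f g)
  from add.IH(1) obtain f' where f': "\<And>j. gauss_class a (f' j)"
    "\<And>x. (f has_derivative (\<lambda>h. \<Sum>j\<in>UNIV. (h $ j) *\<^sub>R f' j x)) (at x)" by auto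
  from add.IH(2) obtain g' where g': "\<And>j. gauss_class a (g' j)"
    "\<And>x. (g has_derivative (\<lambda>h. \<Sum>j\<in>UNIV. (h $ j) *\<^sub>R g' j x)) (at x)" by auto
  have "gauss_class a (\<lambda>x. f' j x + g' j x)" for j
    by (rule gauss_class.add[OF f'(1) g'(1)])
  moreover have "((\<lambda>x. f x + g x) has_derivative (\<lambda>h. \<Sum>j\<in>UNIV. h $ j *\<^sub>R (f' j x + g' j x))) (at x)" for x
    using has_derivative_add[OF f'(2)[of x] g'(2)[of x]]
    by (simp add: scaleR_add_right sum.distrib)
  ultimately show ?case by (intro exI[of _ "\<lambda>j x. f' j x + g' j x"]) auto
qed

lemma gauss_class_partial_deriv:
  assumes "gauss_class a f"
  shows "gauss_class a (partial_deriv j f)"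
proof -
  obtain f' where f': "\<And>j. gauss_class a (f' j)"
    "\<And>x. (f has_derivative (\<lambda>h. \<Sum>j\<in>UNIV. (h $ j) *\<^sub>R f' j x)) (at x)"
    using gauss_class_derivative[OF assms] by auto
  have "partial_deriv j f x = f' j x" for x
  proof -
    have 1: "((\<lambda>t. x + t *\<^sub>R axis j 1) has_derivative (\<lambda>t. t *\<^sub>R axis j 1)) (at (0::real))"
      by (auto intro!: derivative_eq_intros)
    have "((\<lambda>t. f (x + t *\<^sub>R axis j 1)) has_derivative
       (\<lambda>t. \<Sum>i\<in>UNIV. ((t *\<^sub>R axis j (1::real)) $ i) *\<^sub>R f' i x)) (at 0)"
    proof -
      have "(f has_derivative (\<lambda>h. \<Sum>i\<in>UNIV. (h $ i) *\<^sub>R f' i x)) (at (x + 0 *\<^sub>R axis j 1))"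
        using f'(2)[of x] by simp
      from has_derivative_compose[OF 1 this] show ?thesis .
    qed
    moreover have "(\<Sum>i\<in>UNIV. ((t *\<^sub>R axis j (1::real)) $ i) *\<^sub>R f' i x) = t *\<^sub>R f' j x" for t :: real
    proof -
      have "(\<Sum>i\<in>UNIV. ((t *\<^sub>R axis j (1::real)) $ i) *\<^sub>R f' i x)
         = (\<Sum>i\<in>UNIV. if i = j then t *\<^sub>R f' j x else 0)"
        by (intro sum.cong) (auto simp: axis_def)
      then show ?thesis by simp
    qed
    ultimately show ?thesis
      unfolding partial_deriv_def
      by (intro vector_derivative_at) (simp add: has_vector_derivative_def)
  qed
  then show ?thesis using f'(1)[of j] by (metis ext)
qed

lemma power_le_exp: "0 \<le> y \<Longrightarrow> y ^ N \<le> real N ^ N * exp (y::real)"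
proof (cases "N = 0")
  case False
  assume y: "0 \<le> y"
  have "(y / N) ^ N \<le> exp (y / N) ^ N"
    using order_trans[OF _ exp_ge_add_one_self[of "y / N"], of "y / N"] y by (intro power_mono) auto
  also have "\<dots> = exp y" using False by (simp flip: exp_of_nat_mult)
  finally show ?thesis using False by (simp add: power_divide field_simps)
qed simp

text \<open>The exponent is arbitrary in the induction because a coordinate factor costs one more
  power of the norm. In the base case \<open>t \<le> 1 + t\<^sup>2\<close> passes to even powers of
  the norm, which are powers of \<open>x \<bullet> x\<close> and dominated by the
  exponential.\<close>

lemma bounded_power_gauss_class:
  fixes f :: "real^'d::finite \<Rightarrow> 'x::complex_banach"
  assumes "gauss_class a f" and a: "0 < a"
  shows "bounded (range (\<lambda>x. norm x ^ N *\<^sub>R f x))"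
  using assms(1)
proof (induction arbitrary: N)
  case (base s c)
  have "norm x ^ N * exp (- a * (x \<bullet> x)) \<le> 1 + real N ^ N / a ^ N" for x :: "real^'d"
  proof -
    have "norm x ^ N \<le> 1 + (norm x ^ N)\<^sup>2"
      using sum_squares_bound[of 1 "norm x ^ N"] by (simp add: power2_eq_square) (smt (verit) mult_nonneg_nonneg norm_ge_zero zero_le_power)
    moreover have "(norm x ^ N)\<^sup>2 \<le> real N ^ N / a ^ N * exp (a * (x \<bullet> x))"
      using power_le_exp[of "a * (x \<bullet> x)" N] a
      by (simp add: power_mult_distrib field_simps power_mult[symmetric] flip: power2_norm_eq_inner)
    moreover have "1 \<le> exp (a * (x \<bullet> x))" using a by simp
    ultimately have "norm x ^ N \<le> 1 * exp (a * (x \<bullet> x)) + real N ^ N / a ^ N * exp (a * (x \<bullet> x))"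
      by linarith
    then have "norm x ^ N * exp (- (a * (x \<bullet> x)))
        \<le> ((1 + real N ^ N / a ^ N) * exp (a * (x \<bullet> x))) * exp (- (a * (x \<bullet> x)))"
      by (intro mult_right_mono) (simp_all only: distrib_right exp_ge_zero)
    then show ?thesis by (simp add: mult.assoc flip: exp_add)
  qed
  then have "norm x ^ N * exp (- a * (x \<bullet> x)) * norm c \<le> (1 + real N ^ N / a ^ N) * norm c" for x :: "real^'d"
    by (rule mult_right_mono) simp
  then show ?case
    by (intro boundedI[where B="(1 + real N ^ N / a ^ N) * norm c"])
       (auto simp: norm_scaleC norm_mult mult.assoc)
next
  case (coord f j)
  obtain B where B: "\<And>x. norm (norm x ^ Suc N *\<^sub>R f x) \<le> B"
    using coord(2)[of "Suc N"] by (auto simp: bounded_iff)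
  have "norm (norm x ^ N *\<^sub>R (x $ j) *\<^sub>R f x) \<le> B" for x
  proof -
    have "norm (norm x ^ N *\<^sub>R (x $ j) *\<^sub>R f x) = \<bar>x $ j\<bar> * (norm x ^ N * norm (f x))"
      by (simp add: abs_mult)
    also have "\<dots> \<le> norm x * (norm x ^ N * norm (f x))"
      by (intro mult_right_mono component_le_norm_cart) auto
    also have "\<dots> \<le> B" using B[of x] by (simp add: mult.assoc)
    finally show ?thesis .
  qed
  then show ?case by (intro boundedI[where B=B]) auto
next
  case (scale f r)
  obtain B where B: "\<And>x. norm (norm x ^ N *\<^sub>R f x) \<le> B"
    using scale(2)[of N] by (auto simp: bounded_iff)
  show ?case
  proof (rule boundedI[where B="\<bar>r\<bar> * B"], safe)
    fix x
    show "norm (norm x ^ N *\<^sub>R r *\<^sub>R f x) \<le> \<bar>r\<bar> * B"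
      using mult_left_mono[OF B[of x], of "\<bar>r\<bar>"] by (simp add: abs_mult mult_ac)
  qed
next
  case (add f g)
  show ?case
    using bounded_plus_comp[OF add(3)[of N] add(4)[of N]] by (simp add: scaleR_add_right)
qed

lemma schwartz_gauss_class:
  assumes f: "gauss_class a f" and a: "0 < a"
  shows "schwartz f"
proof -
  have "gauss_class a (iter_partial_deriv js f)" for js
    by (induction js) (auto intro: f gauss_class_partial_deriv)
  then show ?thesis
    unfolding schwartz_def differentiable_def
    using gauss_class_derivative bounded_power_gauss_class[OF _ a] by blast
qed

section \<open>Periodization\<close>

definition ivec :: "int^'d::finite \<Rightarrow> real^'d" where
  "ivec n = (\<chi> j. of_int (n $ j))"

text \<open>The half-open cube, unlike the closed \<open>torus\<close>, tiles the space exactly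
  under integer translations; the two differ by a null set.\<close>

definition unit_cell :: "(real^'d::finite) set" where
  "unit_cell = {x. \<forall>j. - 1 / 2 \<le> x $ j \<and> x $ j < 1 / 2}"

lemma unit_cell_sets [measurable]: "unit_cell \<in> sets borel"
  unfolding unit_cell_def by measurable

lemma unit_cell_subset_torus: "unit_cell \<subseteq> torus"
  by (auto simp: unit_cell_def mem_torus less_imp_le)

lemma emeasure_unit_cell: "emeasure lborel (unit_cell :: (real^'d::finite) set) = 1"
proof (rule antisym)
  show "emeasure lborel (unit_cell :: (real^'d) set) \<le> 1"
    using emeasure_mono[OF unit_cell_subset_torus, of lborel] by (simp add: emeasure_torus)
  have "emeasure lborel (box (\<chi> j. - 1 / 2) (\<chi> j. 1 / 2) :: (real^'d) set) = 1"
    by (subst emeasure_lborel_box) (auto simp: Basis_vec_def inner_axis intro!: prod.neutral)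
  moreover have "box (\<chi> j. - 1 / 2) (\<chi> j. 1 / 2) \<subseteq> (unit_cell :: (real^'d) set)"
    by (auto simp: unit_cell_def mem_box_cart less_imp_le)
  ultimately show "1 \<le> emeasure lborel (unit_cell :: (real^'d) set)"
    by (metis emeasure_mono unit_cell_sets sets_lborel)
qed

lemma unit_cell_tiling: "\<exists>!m. x - ivec m \<in> unit_cell"
proof (rule ex1I[of _ "\<chi> j. \<lfloor>x $ j + 1 / 2\<rfloor>"])
  show "x - ivec (\<chi> j. \<lfloor>x $ j + 1 / 2\<rfloor>) \<in> unit_cell"
  proof -
    have "- 1 / 2 \<le> x $ j - of_int \<lfloor>x $ j + 1 / 2\<rfloor> \<and> x $ j - of_int \<lfloor>x $ j + 1 / 2\<rfloor> < 1 / 2" for j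
      by linarith
    then show ?thesis by (simp add: unit_cell_def ivec_def)
  qed
  fix m assume m: "x - ivec m \<in> unit_cell"
  have "m $ j = \<lfloor>x $ j + 1 / 2\<rfloor>" for j
  proof -
    have "- 1 / 2 \<le> x $ j - of_int (m $ j)" "x $ j - of_int (m $ j) < 1 / 2"
      using m by (auto simp: unit_cell_def ivec_def)
    then show ?thesis by linarith
  qed
  then show "m = (\<chi> j. \<lfloor>x $ j + 1 / 2\<rfloor>)" by (simp add: vec_eq_iff)
qed

text \<open>Every point lies in exactly one translated cell, so inserting the sum of their
  indicators changes nothing; Tonelli's theorem and translation invariance do the rest.\<close>

lemma nn_integral_unit_cell_tiling:
  fixes H :: "real^'d::finite \<Rightarrow> ennreal"
  assumes [measurable]: "H \<in> borel_measurable borel"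
  shows "(\<integral>\<^sup>+x. H x \<partial>lborel)
    = (\<integral>\<^sup>+m. (\<integral>\<^sup>+x. H (x + ivec m) * indicator unit_cell x \<partial>lborel) \<partial>count_space UNIV)"
proof -
  have "(\<integral>\<^sup>+x. H x \<partial>lborel)
     = (\<integral>\<^sup>+x. (\<integral>\<^sup>+m. H x * indicator unit_cell (x - ivec m) \<partial>count_space UNIV) \<partial>lborel)"
  proof (rule nn_integral_cong)
    fix x :: "real^'d"
    define m0 where "m0 = (THE m. x - ivec m \<in> unit_cell)"
    have m0: "x - ivec m0 \<in> unit_cell" "\<And>m. x - ivec m \<in> unit_cell \<Longrightarrow> m = m0"
      unfolding m0_def
      by (rule theI'[OF unit_cell_tiling]) (rule the1_equality[OF unit_cell_tiling, symmetric])
    have "(\<integral>\<^sup>+m. H x * indicator unit_cell (x - ivec m) \<partial>count_space UNIV)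
        = (\<integral>\<^sup>+m. H x * indicator {m0} m \<partial>count_space UNIV)"
    proof (rule nn_integral_cong)
      fix m
      show "H x * indicator unit_cell (x - ivec m) = H x * indicator {m0} m"
      proof (cases "x - ivec m \<in> unit_cell")
        case True
        then show ?thesis using m0(2)[OF True] by simp
      next
        case False
        then have "m \<noteq> m0" using m0(1) by metis
        with False show ?thesis by simp
      qed
    qed
    then show "H x = (\<integral>\<^sup>+m. H x * indicator unit_cell (x - ivec m) \<partial>count_space UNIV)"
      by simp
  qed
  also have "\<dots> = (\<integral>\<^sup>+m. (\<integral>\<^sup>+x. H x * indicator unit_cell (x - ivec m) \<partial>lborel) \<partial>count_space UNIV)"
    by (rule nn_integral_count_space_nn_integral) (simp, measurable)
  also have "\<dots> = (\<integral>\<^sup>+m. (\<integral>\<^sup>+x. H (x + ivec m) * indicator unit_cell x \<partial>lborel) \<partial>count_space UNIV)"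
  proof (rule nn_integral_cong)
    fix m :: "int^'d"
    have "(\<integral>\<^sup>+x. H x * indicator unit_cell (x - ivec m) \<partial>lborel)
       = (\<integral>\<^sup>+x. H x * indicator unit_cell (x - ivec m) \<partial>distr lborel borel ((+) (ivec m)))"
      by (simp add: lborel_distr_plus)
    also have "\<dots> = (\<integral>\<^sup>+x. H (x + ivec m) * indicator unit_cell x \<partial>lborel)"
      by (subst nn_integral_distr) (auto simp: add.commute)
    finally show "(\<integral>\<^sup>+x. H x * indicator unit_cell (x - ivec m) \<partial>lborel)
       = (\<integral>\<^sup>+x. H (x + ivec m) * indicator unit_cell x \<partial>lborel)" .
  qed
  finally show ?thesis .
qed

text \<open>Within a cell the Gaussian changes by a bounded factor, so its value at a point is
  controlled by the average of a wider Gaussian over the cell.\<close>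
lemma nn_integral_periodic_gaussian:
  fixes P :: "real^'d::finite \<Rightarrow> ennreal"
  assumes [measurable]: "P \<in> borel_measurable borel"
    and per: "\<And>x m. P (x + ivec m) = P x"
    and a: "0 < a"
  shows "(\<integral>\<^sup>+x. P x * ennreal (exp (- a * (x \<bullet> x))) \<partial>lborel)
    \<le> (\<integral>\<^sup>+x. P x * indicator torus x \<partial>lborel) * ennreal (exp (a * CARD('d)))
       * (\<integral>\<^sup>+(y::real^'d). ennreal (exp (- (a / 2) * (y \<bullet> y))) \<partial>lborel)"
proof -
  let ?w = "\<lambda>(y::real^'d). ennreal (exp (- (a / 2) * (y \<bullet> y)))"
  let ?Q = "indicator unit_cell :: real^'d \<Rightarrow> ennreal"
  let ?K = "ennreal (exp (a * CARD('d)))"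
  \<comment> \<open>Two points of one cell have squared distance at most the dimension, and the
    squared norm of \<open>y + v\<close> is at most twice that of \<open>x + v\<close> plus twice
    that of \<open>x - y\<close>. Halving the rate of the Gaussian absorbs the factor 2 and leaves
    the constant \<open>exp (a * CARD('d))\<close>.\<close>
  have w: "ennreal (exp (- a * ((x + v) \<bullet> (x + v)))) \<le> ?K * ?w (y + v)"
    if "x \<in> unit_cell" "y \<in> unit_cell" for x y v :: "real^'d"
  proof -
    have d: "(x - y) \<bullet> (x - y) \<le> CARD('d)"
    proof -
      have "((x - y) $ j)\<^sup>2 \<le> 1" for j
      proof -
        have "- 1 / 2 \<le> x $ j" "x $ j < 1 / 2" "- 1 / 2 \<le> y $ j" "y $ j < 1 / 2"
          using that by (auto simp: unit_cell_def)
        then have "\<bar>(x - y) $ j\<bar> \<le> 1" by (simp add: abs_le_iff)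
        then show ?thesis by (simp add: abs_square_le_1)
      qed
      then have "(\<Sum>j\<in>UNIV. ((x - y) $ j)\<^sup>2) \<le> (\<Sum>j\<in>(UNIV::'d set). 1)"
        by (intro sum_mono)
      then show ?thesis by (simp add: power2_norm_vec)
    qed
    have "(u - z) \<bullet> (u - z) \<le> 2 * (u \<bullet> u) + 2 * (z \<bullet> z)" for u z :: "real^'d"
      using inner_ge_zero[of "u + z"]
      by (simp add: inner_diff_left inner_diff_right inner_add_left inner_add_right inner_commute)
    from this[of "x + v" "x - y"]
    have "(y + v) \<bullet> (y + v) \<le> 2 * ((x + v) \<bullet> (x + v)) + 2 * ((x - y) \<bullet> (x - y))"
      by (simp add: add.commute)
    then have "(y + v) \<bullet> (y + v) \<le> 2 * ((x + v) \<bullet> (x + v)) + 2 * CARD('d)"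
      using d by linarith
    then have "a * ((y + v) \<bullet> (y + v)) \<le> a * (2 * ((x + v) \<bullet> (x + v)) + 2 * CARD('d))"
      using a by (intro mult_left_mono) auto
    then have "- a * ((x + v) \<bullet> (x + v)) \<le> a * CARD('d) + - (a / 2) * ((y + v) \<bullet> (y + v))"
      by (simp add: algebra_simps)
    then have "exp (- a * ((x + v) \<bullet> (x + v))) \<le> exp (a * CARD('d)) * exp (- (a / 2) * ((y + v) \<bullet> (y + v)))"
      by (simp flip: exp_add)
    then show ?thesis by (simp flip: ennreal_mult add: ennreal_leI)
  qed
  have cell: "ennreal (exp (- a * ((x + v) \<bullet> (x + v)))) \<le> ?K * (\<integral>\<^sup>+y. ?w (y + v) * ?Q y \<partial>lborel)"
    if "x \<in> unit_cell" for x v :: "real^'d"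
  proof -
    have "ennreal (exp (- a * ((x + v) \<bullet> (x + v))))
        = (\<integral>\<^sup>+y. ennreal (exp (- a * ((x + v) \<bullet> (x + v)))) * ?Q y \<partial>lborel)"
      by (simp add: nn_integral_cmult_indicator emeasure_unit_cell)
    also have "\<dots> \<le> (\<integral>\<^sup>+y. ?K * (?w (y + v) * ?Q y) \<partial>lborel)"
      using w[OF that] by (intro nn_integral_mono) (auto simp: indicator_def)
    also have "\<dots> = ?K * (\<integral>\<^sup>+y. ?w (y + v) * ?Q y \<partial>lborel)"
      by (rule nn_integral_cmult) measurable
    finally show ?thesis .
  qed
  have "(\<integral>\<^sup>+x. P x * ennreal (exp (- a * (x \<bullet> x))) \<partial>lborel)
     = (\<integral>\<^sup>+m. (\<integral>\<^sup>+x. P (x + ivec m) * ennreal (exp (- a * ((x + ivec m) \<bullet> (x + ivec m)))) * ?Q x \<partial>lborel) \<partial>count_space UNIV)"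
    by (rule nn_integral_unit_cell_tiling) measurable
  also have "\<dots> \<le> (\<integral>\<^sup>+m. (\<integral>\<^sup>+x. (P x * indicator torus x) * (?K * (\<integral>\<^sup>+y. ?w (y + ivec m) * ?Q y \<partial>lborel)) \<partial>lborel) \<partial>count_space UNIV)"
  proof (intro nn_integral_mono)
    fix m :: "int^'d" and x :: "real^'d"
    show "P (x + ivec m) * ennreal (exp (- a * ((x + ivec m) \<bullet> (x + ivec m)))) * ?Q x
        \<le> (P x * indicator torus x) * (?K * (\<integral>\<^sup>+y. ?w (y + ivec m) * ?Q y \<partial>lborel))"
    proof (cases "x \<in> unit_cell")
      case True
      then have "x \<in> torus" using unit_cell_subset_torus by auto
      then show ?thesis
        using mult_left_mono[OF cell[OF True, of "ivec m"], of "P x"] True by (simp add: per)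
    qed simp
  qed
  also have "\<dots> = (\<integral>\<^sup>+m. (\<integral>\<^sup>+x. P x * indicator torus x \<partial>lborel) * (?K * (\<integral>\<^sup>+y. ?w (y + ivec m) * ?Q y \<partial>lborel)) \<partial>count_space UNIV)"
    by (intro nn_integral_cong nn_integral_multc) measurable
  also have "\<dots> = (\<integral>\<^sup>+x. P x * indicator torus x \<partial>lborel) * (?K * (\<integral>\<^sup>+m. (\<integral>\<^sup>+y. ?w (y + ivec m) * ?Q y \<partial>lborel) \<partial>count_space UNIV))"
    by (simp add: nn_integral_cmult)
  also have "(\<integral>\<^sup>+m. (\<integral>\<^sup>+y. ?w (y + ivec m) * ?Q y \<partial>lborel) \<partial>count_space UNIV) = (\<integral>\<^sup>+y. ?w y \<partial>lborel)"
    by (rule nn_integral_unit_cell_tiling[symmetric]) measurable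
  finally show ?thesis by (simp add: mult.assoc)
qed

section \<open>Trigonometric polynomials\<close>

definition trig_poly :: "(int^'d::finite) set \<Rightarrow> (int^'d \<Rightarrow> 'x::complex_banach) \<Rightarrow> real^'d \<Rightarrow> 'x" where
  "trig_poly F c x = (\<Sum>n\<in>F. cis (2 * pi * (x \<bullet> ivec n)) *\<^sub>C c n)"

lemma continuous_on_trig_poly: "continuous_on S (trig_poly F c)"
  unfolding trig_poly_def cis_conv_exp
  by (intro continuous_intros scaleC.continuous_on)

lemma cis_2pi_int: "cis (2 * pi * of_int k) = 1"
  by (simp add: complex_eq_iff cos_int_2pin sin_int_2pin)

lemma trig_poly_periodic: "trig_poly F c (x + ivec m) = trig_poly F c x"
proof -
  have "cis (2 * pi * ((x + ivec m) \<bullet> ivec n)) = cis (2 * pi * (x \<bullet> ivec n))" for n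
  proof -
    have "ivec m \<bullet> ivec n = of_int (\<Sum>j\<in>UNIV. m $ j * n $ j)"
      by (simp add: inner_vec_def ivec_def)
    then have "cis (2 * pi * (ivec m \<bullet> ivec n)) = 1" by (simp only: cis_2pi_int)
    then show ?thesis by (simp add: inner_add_left distrib_left flip: cis_mult)
  qed
  then show ?thesis by (simp add: trig_poly_def)
qed

lemma fourier_coeff_trig_poly:
  assumes "finite F" "n \<in> F"
  shows "has_strong_bochner_integral (lebesgue_on torus)
    (\<lambda>x. cis (- 2 * pi * (x \<bullet> ivec n)) *\<^sub>C trig_poly F c x) (c n)"
proof -
  have "has_strong_bochner_integral (lebesgue_on torus)
    (\<lambda>x. \<Sum>m\<in>F. cis (2 * pi * (x \<bullet> ivec (m - n))) *\<^sub>C c m) (\<Sum>m\<in>F. (if m - n = 0 then 1 else 0) *\<^sub>C c m)"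
    by (rule has_strong_bochner_integral_sum[OF complete_measure_torus assms(1)],
        rule has_strong_bochner_integral_scaleC_const[OF complete_measure_torus],
        rule has_bochner_integral_character[folded ivec_def])
  moreover have "(\<Sum>m\<in>F. (if m - n = 0 then 1 else 0) *\<^sub>C c m) = c n"
    using assms by (simp add: if_distrib[of "\<lambda>z. z *\<^sub>C _"] scaleC.zero_left cong: if_cong)
  moreover have "(\<Sum>m\<in>F. cis (2 * pi * (x \<bullet> ivec (m - n))) *\<^sub>C c m)
      = cis (- 2 * pi * (x \<bullet> ivec n)) *\<^sub>C trig_poly F c x" for x
  proof -
    have "x \<bullet> ivec (m - n) = x \<bullet> ivec m - x \<bullet> ivec n" for m
      by (simp add: ivec_def inner_vec_def right_diff_distrib sum_subtractf)
    then show ?thesis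
      by (simp add: trig_poly_def scaleC.sum_right scaleC_scaleC cis_mult right_diff_distrib)
  qed
  ultimately show ?thesis by simp
qed

section \<open>Powers of extended reals and conjugate exponents\<close>

lemma ennpowr_ennreal: "0 \<le> a \<Longrightarrow> ennpowr (ennreal a) r = ennreal (a powr r)"
  by (simp add: ennpowr_def)

lemma ennpowr_mono: "x \<le> y \<Longrightarrow> 0 \<le> r \<Longrightarrow> ennpowr x r \<le> ennpowr y r"
  unfolding ennpowr_def
  by (auto simp: top_unique less_top intro!: ennreal_leI powr_mono2 enn2real_mono)

lemma ennpowr_powr_inverse: "0 < r \<Longrightarrow> ennpowr (ennpowr x (1 / r)) r = x"
  by (auto simp: ennpowr_def powr_powr less_top[symmetric])

lemma ennpowr_inverse_le:
  assumes "ennpowr x (1 / r) \<le> ennreal R" "0 < r" "0 \<le> R"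
  shows "x \<le> ennreal (R powr r)"
  using ennpowr_mono[OF assms(1), of r] assms(2,3) by (simp add: ennpowr_powr_inverse ennpowr_ennreal)

lemma conj_exp_props:
  assumes "1 < p"
  shows "1 < conj_exp p" "conj_exp p / p = conj_exp p - 1" "1 / conj_exp p = 1 - 1 / p"
    "conj_exp p * (1 / p) = conj_exp p - 1"
  using assms by (auto simp: conj_exp_def field_simps)

section \<open>Trigonometric polynomials under a Gaussian window\<close>

lemma norm_ivec_diff: "n \<noteq> m \<Longrightarrow> 1 \<le> norm (ivec n - ivec m :: real^'d::finite)"
proof -
  assume "n \<noteq> m"
  then obtain j where j: "n $ j \<noteq> m $ j" by (auto simp: vec_eq_iff)
  then have "1 \<le> \<bar>of_int (n $ j - m $ j) :: real\<bar>" by linarith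
  also have "\<dots> = \<bar>(ivec n - ivec m :: real^'d) $ j\<bar>" by (simp add: ivec_def)
  also have "\<dots> \<le> norm (ivec n - ivec m :: real^'d)" by (rule component_le_norm_cart)
  finally show ?thesis .
qed

text \<open>The parameter \<open>e\<close> is a reciprocal width: small \<open>e\<close> means a
  wide window, and bumps of width \<open>e\<close> in the transform.\<close>

definition gauss_trig :: "real \<Rightarrow> (int^'d::finite) set \<Rightarrow> (int^'d \<Rightarrow> 'x::complex_banach) \<Rightarrow> real^'d \<Rightarrow> 'x" where
  "gauss_trig e F c x = exp (- pi * e\<^sup>2 * (x \<bullet> x)) *\<^sub>R trig_poly F c x"

lemma schwartz_gauss_trig:
  assumes "0 < e" "finite F"
  shows "schwartz (gauss_trig e F c)"
proof -
  have "gauss_class (pi * e\<^sup>2) (\<lambda>x. \<Sum>n\<in>F.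
      (complex_of_real (exp (- (pi * e\<^sup>2) * (x \<bullet> x))) * cis (x \<bullet> ((2 * pi) *\<^sub>R ivec n))) *\<^sub>C c n)"
    by (rule gauss_class_sum[OF assms(2)]) (rule gauss_class.base)
  moreover have "(\<Sum>n\<in>F. (complex_of_real (exp (- (pi * e\<^sup>2) * (x \<bullet> x))) * cis (x \<bullet> ((2 * pi) *\<^sub>R ivec n))) *\<^sub>C c n)
     = gauss_trig e F c x" for x
    unfolding gauss_trig_def trig_poly_def
    by (simp add: scaleC.sum_right scaleC_scaleC flip: scaleC_of_real)
  ultimately have "gauss_class (pi * e\<^sup>2) (gauss_trig e F c)" by simp
  then show ?thesis by (rule schwartz_gauss_class) (use assms in auto)
qed

lemma fourier_transform_gauss_trig:
  fixes c :: "int^'d::finite \<Rightarrow> 'x::complex_banach"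
  assumes e: "0 < e" and F: "finite F"
  shows "fourier_transform (gauss_trig e F c) \<xi>
    = (\<Sum>n\<in>F. (exp (- pi * ((\<xi> - ivec n) \<bullet> (\<xi> - ivec n)) / e\<^sup>2) / e ^ CARD('d)) *\<^sub>R c n)"
proof -
  have lc: "complete_measure (lebesgue :: (real^'d) measure)"
    by (rule completion.complete_measure_axioms)
  have "has_strong_bochner_integral lebesgue
    (\<lambda>t. \<Sum>n\<in>F. (complex_of_real (exp (- pi * e\<^sup>2 * (t \<bullet> t))) * cis (- 2 * pi * (t \<bullet> (\<xi> - ivec n)))) *\<^sub>C c n)
    (\<Sum>n\<in>F. complex_of_real (exp (- pi * ((\<xi> - ivec n) \<bullet> (\<xi> - ivec n)) / e\<^sup>2) / e ^ CARD('d)) *\<^sub>C c n)"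
    by (rule has_strong_bochner_integral_sum[OF lc F],
        rule has_strong_bochner_integral_scaleC_const[OF lc],
        rule has_bochner_integral_lebesgue, rule has_bochner_integral_gaussian[OF e])
  moreover have "(\<Sum>n\<in>F. (complex_of_real (exp (- pi * e\<^sup>2 * (t \<bullet> t))) * cis (- 2 * pi * (t \<bullet> (\<xi> - ivec n)))) *\<^sub>C c n)
     = cis (- 2 * pi * (t \<bullet> \<xi>)) *\<^sub>C gauss_trig e F c t" for t
  proof -
    have "cis (- 2 * pi * (t \<bullet> (\<xi> - ivec n))) = cis (- 2 * pi * (t \<bullet> \<xi>)) * cis (2 * pi * (t \<bullet> ivec n))" for n
      by (simp add: cis_mult inner_diff_right algebra_simps)
    then show ?thesis
      unfolding gauss_trig_def trig_poly_def
      by (simp add: scaleR_sum_right scaleC.sum_right scaleC_scaleC mult_ac flip: scaleC_of_real)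
  qed
  ultimately have "has_strong_bochner_integral lebesgue (\<lambda>t. cis (- 2 * pi * (t \<bullet> \<xi>)) *\<^sub>C gauss_trig e F c t)
     (\<Sum>n\<in>F. (exp (- pi * ((\<xi> - ivec n) \<bullet> (\<xi> - ivec n)) / e\<^sup>2) / e ^ CARD('d)) *\<^sub>R c n)"
    by (simp only: scaleC_of_real)
  then show ?thesis
    unfolding fourier_transform_def by (rule strong_bochner_integral_eq[OF lc])
qed

text \<open>Within distance \<open>e\<close> of a frequency its own bump keeps at least the fraction
  \<open>exp (- pi)\<close> of its height, while every other frequency is at distance at least 1/2
  and keeps at most the fraction \<open>exp (- pi / (4 * e\<^sup>2))\<close>. The hypothesis
  \<open>small\<close> ensures that the others cancel no more than half.\<close>

lemma fourier_transform_gauss_trig_lower: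
  fixes c :: "int^'d::finite \<Rightarrow> 'x::complex_banach"
  assumes e: "0 < e" "e \<le> 1 / 2" and F: "finite F" "n \<in> F"
    and small: "(\<Sum>m\<in>F. norm (c m)) * exp (- pi / (4 * e\<^sup>2)) \<le> exp (- pi) * norm (c n) / 2"
    and \<xi>: "dist (ivec n) \<xi> < e"
  shows "norm (c n) * (exp (- pi) / 2) / e ^ CARD('d) \<le> norm (fourier_transform (gauss_trig e F c) \<xi>)"
proof -
  define g where "g m = exp (- pi * ((\<xi> - ivec m) \<bullet> (\<xi> - ivec m)) / e\<^sup>2)" for m :: "int^'d"
  have E: "0 < e ^ CARD('d)" using e by simp
  have FT: "fourier_transform (gauss_trig e F c) \<xi> = (1 / e ^ CARD('d)) *\<^sub>R (\<Sum>m\<in>F. g m *\<^sub>R c m)"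
    using fourier_transform_gauss_trig[OF e(1) F(1)] by (simp add: g_def scaleR_sum_right)
  have gn: "exp (- pi) \<le> g n"
  proof -
    have "norm (\<xi> - ivec n) \<le> e" using \<xi> by (simp add: dist_norm norm_minus_commute)
    then have "(\<xi> - ivec n) \<bullet> (\<xi> - ivec n) \<le> e\<^sup>2"
      by (simp add: power_mono flip: power2_norm_eq_inner)
    then have "((\<xi> - ivec n) \<bullet> (\<xi> - ivec n)) / e\<^sup>2 \<le> 1" using e by simp
    from mult_left_mono[OF this, of pi] show ?thesis
      by (simp add: g_def)
  qed
  have gm: "g m \<le> exp (- pi / (4 * e\<^sup>2))" if "m \<noteq> n" for m
  proof -
    have "1 \<le> norm (ivec m - ivec n :: real^'d)" by (rule norm_ivec_diff[OF that])
    also have "\<dots> \<le> norm (\<xi> - ivec m) + norm (ivec n - \<xi>)"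
      using norm_triangle_ineq4[of "ivec n - \<xi>" "ivec m - \<xi>"]
      by (simp add: norm_minus_commute)
    finally have "1 / 2 \<le> norm (\<xi> - ivec m)" using \<xi> e by (simp add: dist_norm)
    then have "(1 / 2)\<^sup>2 \<le> (norm (\<xi> - ivec m))\<^sup>2" by (intro power_mono) auto
    then have "1 / 4 \<le> (\<xi> - ivec m) \<bullet> (\<xi> - ivec m)"
      by (simp add: power2_norm_eq_inner power_divide)
    then have "pi * (1 / 4) / e\<^sup>2 \<le> pi * ((\<xi> - ivec m) \<bullet> (\<xi> - ivec m)) / e\<^sup>2"
      by (intro divide_right_mono mult_left_mono) auto
    then show ?thesis by (simp add: g_def)
  qed
  have "norm (\<Sum>m\<in>F - {n}. g m *\<^sub>R c m) \<le> (\<Sum>m\<in>F - {n}. norm (g m *\<^sub>R c m))"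
    by (rule norm_sum)
  also have "\<dots> \<le> (\<Sum>m\<in>F - {n}. exp (- pi / (4 * e\<^sup>2)) * norm (c m))"
    by (rule sum_mono) (use gm in \<open>auto simp: g_def intro!: mult_right_mono\<close>)
  also have "\<dots> \<le> (\<Sum>m\<in>F. exp (- pi / (4 * e\<^sup>2)) * norm (c m))"
    by (rule sum_mono2) (use F in auto)
  also have "\<dots> \<le> exp (- pi) * norm (c n) / 2"
  proof -
    have "(\<Sum>m\<in>F. exp (- pi / (4 * e\<^sup>2)) * norm (c m)) = (\<Sum>m\<in>F. norm (c m)) * exp (- pi / (4 * e\<^sup>2))"
      by (subst sum_distrib_right) (simp only: mult.commute)
    then show ?thesis using small by simp
  qed
  finally have rest: "norm (\<Sum>m\<in>F - {n}. g m *\<^sub>R c m) \<le> exp (- pi) * norm (c n) / 2" .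
  have "exp (- pi) * norm (c n) \<le> norm (g n *\<^sub>R c n)"
    using gn by (auto simp: g_def intro!: mult_right_mono)
  also have "g n *\<^sub>R c n = (\<Sum>m\<in>F. g m *\<^sub>R c m) - (\<Sum>m\<in>F - {n}. g m *\<^sub>R c m)"
    using F by (simp add: sum.remove)
  also have "norm \<dots> \<le> norm (\<Sum>m\<in>F. g m *\<^sub>R c m) + norm (\<Sum>m\<in>F - {n}. g m *\<^sub>R c m)"
    by (rule norm_triangle_ineq4)
  finally have "norm (c n) * (exp (- pi) / 2) \<le> norm (\<Sum>m\<in>F. g m *\<^sub>R c m)"
    using rest by (simp only: mult.commute[of "norm (c n)"])
  from divide_right_mono[OF this less_imp_le[OF E]] show ?thesis
    using e by (simp add: FT)
qed

lemma nn_integral_gauss_trig: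
  fixes c :: "int^'d::finite \<Rightarrow> 'x::complex_banach"
  assumes e: "0 < e" "e \<le> 1" and p: "0 < p" and B: "0 \<le> B"
    and le: "(\<integral>\<^sup>+x. ennreal (norm (trig_poly F c x) powr p) * indicator torus x \<partial>lborel) \<le> ennreal B"
  shows "(\<integral>\<^sup>+x. ennreal (norm (gauss_trig e F c x) powr p) \<partial>lebesgue)
    \<le> ennreal (B * (exp (p * pi * CARD('d)) / sqrt (p / 2) ^ CARD('d)) / e ^ CARD('d))"
proof -
  define a where "a = p * pi * e\<^sup>2"
  have a: "0 < a" using e p by (simp add: a_def)
  let ?P = "\<lambda>x. ennreal (norm (trig_poly F c x) powr p)"
  have [measurable]: "trig_poly F c \<in> borel_measurable borel"
    by (intro borel_measurable_continuous_onI continuous_on_trig_poly)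
  have P [measurable]: "?P \<in> borel_measurable borel"
    by measurable
  have "(\<integral>\<^sup>+x. ennreal (norm (gauss_trig e F c x) powr p) \<partial>lebesgue)
      = (\<integral>\<^sup>+x. ?P x * ennreal (exp (- a * (x \<bullet> x))) \<partial>lborel)"
    unfolding nn_integral_completion
    by (intro nn_integral_cong)
       (simp add: gauss_trig_def powr_mult exp_powr_real a_def mult_ac flip: ennreal_mult)
  also have "\<dots> \<le> (\<integral>\<^sup>+x. ?P x * indicator torus x \<partial>lborel) * ennreal (exp (a * CARD('d)))
       * (\<integral>\<^sup>+(y::real^'d). ennreal (exp (- (a / 2) * (y \<bullet> y))) \<partial>lborel)"
    by (rule nn_integral_periodic_gaussian[OF P _ a]) (simp add: trig_poly_periodic)
  \<comment> \<open>Because \<open>a / 2 = pi * (e * sqrt (p / 2))\<^sup>2\<close>, the wider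
    Gaussian is again of the normalised form, with parameter
    \<open>e * sqrt (p / 2)\<close>.\<close>
  also have "(\<integral>\<^sup>+(y::real^'d). ennreal (exp (- (a / 2) * (y \<bullet> y))) \<partial>lborel)
      = ennreal (1 / (e * sqrt (p / 2)) ^ CARD('d))"
    using nn_integral_gaussian[of "e * sqrt (p / 2)", where 'd='d] e p
    by (simp add: a_def power_mult_distrib mult_ac)
  also have "(\<integral>\<^sup>+x. ?P x * indicator torus x \<partial>lborel) * ennreal (exp (a * CARD('d)))
       * ennreal (1 / (e * sqrt (p / 2)) ^ CARD('d))
     \<le> ennreal B * ennreal (exp (p * pi * CARD('d))) * ennreal (1 / (e * sqrt (p / 2)) ^ CARD('d))"
  proof (intro mult_mono le ennreal_leI order_refl)
    have "e\<^sup>2 \<le> 1" using e by (simp add: power_le_one)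
    then show "exp (a * CARD('d)) \<le> exp (p * pi * CARD('d))"
      using p by (auto simp: a_def intro!: mult_right_mono mult_left_le)
  qed auto
  also have "\<dots> = ennreal (B * (exp (p * pi * CARD('d)) / sqrt (p / 2) ^ CARD('d)) / e ^ CARD('d))"
    using B e p by (simp add: power_mult_distrib mult_ac flip: ennreal_mult)
  finally show ?thesis .
qed

lemma exists_small_gauss:
  assumes "0 < k" "0 \<le> (M::real)"
  obtains e where "0 < e" "e \<le> 1 / 2" "M * exp (- pi / (4 * e\<^sup>2)) \<le> k"
proof -
  \<comment> \<open>The crude bound \<open>exp (- y) \<le> 1 / y\<close> is enough: it makes the
    tail a multiple of \<open>e\<^sup>2\<close>, hence at most \<open>2 * e\<close> for
    \<open>e \<le> 1 / 2\<close>. The second entry of the minimum makes this small against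
    \<open>M\<close>, with \<open>M + 1\<close> to avoid division by zero.\<close>
  define e where "e = min (1 / 2) (k / (2 * (M + 1)))"
  have e: "0 < e" "e \<le> 1 / 2" "e \<le> k / (2 * (M + 1))"
  proof -
    show "0 < e" using assms by (auto simp: e_def)
  qed (unfold e_def, (rule min.cobounded1 min.cobounded2)+)
  have y: "0 < pi / (4 * e\<^sup>2)" using e by simp
  have "exp (- pi / (4 * e\<^sup>2)) = 1 / exp (pi / (4 * e\<^sup>2))" by (simp add: exp_minus inverse_eq_divide)
  also have "\<dots> \<le> 1 / (pi / (4 * e\<^sup>2))"
    using y order_trans[OF _ exp_ge_add_one_self[of "pi / (4 * e\<^sup>2)"], of "pi / (4 * e\<^sup>2)"]
    by (intro divide_left_mono mult_pos_pos exp_gt_zero) auto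
  also have "\<dots> = (4 / pi) * e * e" by (simp add: power2_eq_square)
  also have "\<dots> \<le> (4 / pi) * e * (1 / 2)" using e by (intro mult_left_mono) auto
  also have "\<dots> \<le> 2 * e"
    using e pi_gt3 by (simp add: field_simps)
  finally have "M * exp (- pi / (4 * e\<^sup>2)) \<le> M * (2 * e)" using assms by (intro mult_left_mono)
  also have "\<dots> \<le> M * (k / (M + 1))"
    using e assms by (intro mult_left_mono) (auto simp: field_simps)
  also have "\<dots> \<le> k" using assms by (simp add: field_simps)
  finally show ?thesis using that e by blast
qed

text \<open>Distinct lattice points are at distance at least 1, so open balls of radius at most 1/2
  around them are disjoint and at most one term of the sum is nonzero at each point.\<close>

lemma nn_integral_disjoint_balls:
  fixes h :: "real^'d::finite \<Rightarrow> ennreal"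
  assumes F: "finite F" and e: "0 < e" "e \<le> 1 / 2"
    and h: "\<And>n x. n \<in> F \<Longrightarrow> dist (ivec n) x < e \<Longrightarrow> ennreal (k n) \<le> h x"
    and k: "\<And>n. n \<in> F \<Longrightarrow> 0 \<le> k n"
  shows "ennreal ((\<Sum>n\<in>F. k n) * (unit_ball_vol (CARD('d)) * e ^ CARD('d))) \<le> (\<integral>\<^sup>+x. h x \<partial>lborel)"
proof -
  have "ennreal ((\<Sum>n\<in>F. k n) * (unit_ball_vol (CARD('d)) * e ^ CARD('d)))
     = (\<Sum>n\<in>F. ennreal (k n) * ennreal (unit_ball_vol (CARD('d)) * e ^ CARD('d)))"
    using k e by (simp add: sum_distrib_right ennreal_mult sum_nonneg flip: sum_ennreal)
  also have "\<dots> = (\<Sum>n\<in>F. (\<integral>\<^sup>+x. ennreal (k n) * indicator (ball (ivec n :: real^'d) e) x \<partial>lborel))"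
    using e by (intro sum.cong refl) (simp add: nn_integral_cmult_indicator emeasure_ball)
  also have "\<dots> = (\<integral>\<^sup>+x. (\<Sum>n\<in>F. ennreal (k n) * indicator (ball (ivec n :: real^'d) e) x) \<partial>lborel)"
    by (rule nn_integral_sum[symmetric]) (measurable, simp)
  also have "\<dots> \<le> (\<integral>\<^sup>+x. h x \<partial>lborel)"
  proof (rule nn_integral_mono)
    fix x :: "real^'d"
    show "(\<Sum>n\<in>F. ennreal (k n) * indicator (ball (ivec n :: real^'d) e) x) \<le> h x"
    proof (cases "\<exists>n\<in>F. dist (ivec n) x < e")
      case True
      then obtain n where n: "n \<in> F" "dist (ivec n) x < e" by auto
      have "\<not> dist (ivec m) x < e" if "m \<noteq> n" for m
      proof
        assume "dist (ivec m) x < e"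
        then have "dist (ivec m) (ivec n :: real^'d) < e + e"
          using n(2) by (metis add_strict_mono dist_commute dist_triangle order_le_less_trans)
        then show False using norm_ivec_diff[OF that] e by (simp add: dist_norm)
      qed
      then have "(\<Sum>m\<in>F. ennreal (k m) * indicator (ball (ivec m :: real^'d) e) x)
          = (\<Sum>m\<in>F. if m = n then ennreal (k n) else 0)"
        using n by (intro sum.cong) auto
      also have "\<dots> = ennreal (k n)" using n F by simp
      finally show ?thesis using h[OF n] by simp
    next
      case False
      then have "(\<Sum>n\<in>F. ennreal (k n) * indicator (ball (ivec n :: real^'d) e) x) = 0"
        by (intro sum.neutral) auto
      then show ?thesis by simp
    qed
  qed
  finally show ?thesis .
qed

text \<open>The Fourier transform of the polynomial times a wide Gaussian consists of narrow bumps at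
  the frequencies, whose heights are proportional to the coefficients; both sides of the Fourier
  type inequality scale with the same power of the width.\<close>
theorem fourier_type_trig_poly:
  assumes type: "fourier_type TYPE('d::finite) TYPE('x::complex_banach) p" and p: "1 < p"
  obtains K where "0 \<le> K" "\<And>F (c :: int^'d \<Rightarrow> 'x) B. finite F \<Longrightarrow> 0 \<le> B \<Longrightarrow>
     (\<integral>\<^sup>+x. ennreal (norm (trig_poly F c x) powr p) * indicator torus x \<partial>lborel) \<le> ennreal B \<Longrightarrow>
     (\<Sum>n\<in>F. norm (c n) powr conj_exp p) \<le> K * B powr (conj_exp p / p)"
proof -
  define p' where "p' = conj_exp p"
  have p': "1 < p'" "p' / p = p' - 1" using conj_exp_props[OF p] by (auto simp: p'_def)
  from type obtain C0 :: real where C0: "\<And>f :: real^'d \<Rightarrow> 'x. schwartz f \<Longrightarrow>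
        Lp_norm p' lebesgue (fourier_transform f) \<le> ennreal C0 * Lp_norm p lebesgue f"
    unfolding fourier_type_def p'_def by auto
  define C where "C = max C0 0"
  have C: "0 \<le> C" "\<And>f :: real^'d \<Rightarrow> 'x. schwartz f \<Longrightarrow>
        Lp_norm p' lebesgue (fourier_transform f) \<le> ennreal C * Lp_norm p lebesgue f"
  proof -
    fix f :: "real^'d \<Rightarrow> 'x" assume "schwartz f"
    then have "Lp_norm p' lebesgue (fourier_transform f) \<le> ennreal C0 * Lp_norm p lebesgue f" by (rule C0)
    also have "\<dots> \<le> ennreal C * Lp_norm p lebesgue f"
      by (intro mult_right_mono ennreal_leI) (simp_all add: C_def)
    finally show "Lp_norm p' lebesgue (fourier_transform f) \<le> ennreal C * Lp_norm p lebesgue f" .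
  qed (simp add: C_def)
  define d where "d = CARD('d)"
  define V where "V = unit_ball_vol d"
  have V: "0 < V" by (simp add: V_def unit_ball_vol_pos)
  define K1 where "K1 = exp (p * pi * d) / sqrt (p / 2) ^ d"
  have K1: "0 < K1" using p by (simp add: K1_def)
  define L where "L = (exp (- pi) / 2) powr p' * V"
  have L: "0 < L" using V by (simp add: L_def)
  define K where "K = C powr p' * K1 powr (p' / p) / L"
  have "(\<Sum>n\<in>F. norm (c n) powr p') \<le> K * B powr (p' / p)"
    if F: "finite F" and B: "0 \<le> B"
      and le: "(\<integral>\<^sup>+x. ennreal (norm (trig_poly F c x) powr p) * indicator torus x \<partial>lborel) \<le> ennreal B"
    for F and c :: "int^'d \<Rightarrow> 'x" and B
  proof -
    define M where "M = (\<Sum>n\<in>F. norm (c n))"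
    \<comment> \<open>Only nonzero coefficients have to produce a visible bump. As there are
      finitely many of them, the least admissible size of the tail is positive; the inserted 1
      covers the case that there are none. The width \<open>e\<close> thus depends on the
      polynomial.\<close>
    define k where "k = Min (insert 1 ((\<lambda>n. exp (- pi) * norm (c n) / 2) ` {n\<in>F. c n \<noteq> 0}))"
    have k: "0 < k" "\<And>n. n \<in> F \<Longrightarrow> c n \<noteq> 0 \<Longrightarrow> k \<le> exp (- pi) * norm (c n) / 2"
    proof -
      show "0 < k" unfolding k_def using F by (subst Min_gr_iff) auto
      show "k \<le> exp (- pi) * norm (c n) / 2" if "n \<in> F" "c n \<noteq> 0" for n
        unfolding k_def using F that by (intro Min_le) auto
    qed
    obtain e where e: "0 < e" "e \<le> 1 / 2" "M * exp (- pi / (4 * e\<^sup>2)) \<le> k"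
      using exists_small_gauss[OF k(1), of M] by (auto simp: M_def sum_nonneg)
    define E where "E = e ^ d"
    have E: "0 < E" using e by (simp add: E_def)
    let ?f = "gauss_trig e F c"
    have "Lp_norm p lebesgue ?f \<le> ennpowr (ennreal (B * K1 / E)) (1 / p)"
      unfolding Lp_norm_def K1_def E_def d_def
      by (rule ennpowr_mono[OF nn_integral_gauss_trig[OF _ _ _ B le]]) (use e p in auto)
    also have "\<dots> = ennreal ((B * K1 / E) powr (1 / p))"
      using B K1 E by (intro ennpowr_ennreal) auto
    finally have "ennreal C * Lp_norm p lebesgue ?f \<le> ennreal C * ennreal ((B * K1 / E) powr (1 / p))"
      by (rule mult_left_mono) simp
    also have "\<dots> = ennreal (C * (B * K1 / E) powr (1 / p))"
      using C(1) by (simp add: ennreal_mult)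
    finally have "Lp_norm p' lebesgue (fourier_transform ?f) \<le> ennreal (C * (B * K1 / E) powr (1 / p))"
      using C(2)[OF schwartz_gauss_trig[OF e(1) F, of c]] by (rule order_trans[rotated])
    then have up: "(\<integral>\<^sup>+x. ennreal (norm (fourier_transform ?f x) powr p') \<partial>lebesgue)
        \<le> ennreal ((C * (B * K1 / E) powr (1 / p)) powr p')"
      unfolding Lp_norm_def by (rule ennpowr_inverse_le) (use p' C(1) in auto)
    have "ennreal ((\<Sum>n\<in>F. (norm (c n) * (exp (- pi) / 2) / E) powr p') * (unit_ball_vol (CARD('d)) * e ^ CARD('d)))
       \<le> (\<integral>\<^sup>+x. ennreal (norm (fourier_transform ?f x) powr p') \<partial>lborel)"
    proof (rule nn_integral_disjoint_balls[OF F e(1,2)])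
      fix n and x :: "real^'d" assume n: "n \<in> F" "dist (ivec n) x < e"
      show "ennreal ((norm (c n) * (exp (- pi) / 2) / E) powr p') \<le> ennreal (norm (fourier_transform ?f x) powr p')"
      proof (cases "c n = 0")
        case True
        then show ?thesis using p' by simp
      next
        case False
        have "M * exp (- pi / (4 * e\<^sup>2)) \<le> exp (- pi) * norm (c n) / 2"
          using e(3) k(2)[OF n(1) False] by simp
        from fourier_transform_gauss_trig_lower[OF e(1,2) F n(1) this[unfolded M_def] n(2)]
        show ?thesis
          using p' E by (intro ennreal_leI powr_mono2) (auto simp: E_def d_def)
      qed
    qed simp
    also have "\<dots> \<le> ennreal ((C * (B * K1 / E) powr (1 / p)) powr p')"
      using up by (simp add: nn_integral_completion)
    finally have "ennreal ((\<Sum>n\<in>F. (norm (c n) * (exp (- pi) / 2) / E) powr p') * (V * E))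
        \<le> ennreal ((C * (B * K1 / E) powr (1 / p)) powr p')"
      by (simp only: V_def E_def d_def)
    then have ineq: "(\<Sum>n\<in>F. (norm (c n) * (exp (- pi) / 2) / E) powr p') * (V * E)
        \<le> (C * (B * K1 / E) powr (1 / p)) powr p'"
      by (rule ennreal_le_iff[THEN iffD1, rotated]) (rule powr_ge_zero)
    have "(\<Sum>n\<in>F. (norm (c n) * (exp (- pi) / 2) / E) powr p') * (V * E)
        = (\<Sum>n\<in>F. norm (c n) powr p') * L * (E powr (- p') * E)"
    proof -
      have "(norm (c n) * (exp (- pi) / 2) / E) powr p'
          = norm (c n) powr p' * (exp (- pi) / 2) powr p' * E powr (- p')" for n
        using E by (simp add: powr_mult powr_divide powr_minus_divide)
      then have "(\<Sum>n\<in>F. (norm (c n) * (exp (- pi) / 2) / E) powr p')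
          = (\<Sum>n\<in>F. norm (c n) powr p') * (exp (- pi) / 2) powr p' * E powr (- p')"
        by (simp only: sum_distrib_right)
      then show ?thesis by (simp add: L_def)
    qed
    \<comment> \<open>Here \<open>p' / p = p' - 1\<close> enters: both sides carry the same power of
      \<open>E\<close>, so the width cancels and \<open>K\<close> depends neither on
      \<open>F\<close> nor on \<open>c\<close>.\<close>
    also have "E powr (- p') * E = E powr (- (p' / p))"
      using E powr_add[of E "- p'" 1] p'(2) by simp
    finally have lhs: "(\<Sum>n\<in>F. (norm (c n) * (exp (- pi) / 2) / E) powr p') * (V * E)
        = (\<Sum>n\<in>F. norm (c n) powr p') * L * E powr (- (p' / p))" .
    have rhs: "(C * (B * K1 / E) powr (1 / p)) powr p'
        = (C powr p' * K1 powr (p' / p) * B powr (p' / p)) * E powr (- (p' / p))"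
      using C(1) B K1 E by (simp add: powr_mult powr_powr powr_divide powr_minus_divide)
    have "(\<Sum>n\<in>F. norm (c n) powr p') * L \<le> C powr p' * K1 powr (p' / p) * B powr (p' / p)"
      using ineq E unfolding lhs rhs by simp
    then show ?thesis using L by (simp add: K_def field_simps)
  qed
  moreover have "0 \<le> K" using C(1) K1 L by (simp add: K_def)
  ultimately show ?thesis using that[of K] by (simp add: p'_def)
qed

section \<open>Density of trigonometric polynomials\<close>

text \<open>Scalar trigonometric polynomials without a named set of frequencies. In this form
  closure under products takes two inductions; the frequencies are recovered in
  \<open>sum_trig_function_scaleC_is_trig_poly\<close>.\<close>

inductive trig_function :: "(real^'d::finite \<Rightarrow> complex) \<Rightarrow> bool" where
  char: "trig_function (\<lambda>x. a * cis (2 * pi * (x \<bullet> ivec n)))"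
| add: "trig_function f \<Longrightarrow> trig_function g \<Longrightarrow> trig_function (\<lambda>x. f x + g x)"

lemma ivec_zero [simp]: "ivec 0 = 0"
  and ivec_add: "ivec (n + m) = ivec n + ivec m"
  and ivec_uminus: "ivec (- n) = - ivec n"
  and inner_ivec_axis: "x \<bullet> ivec (axis j 1) = x $ j"
proof -
  have "ivec (axis j 1) = axis j 1" by (simp add: ivec_def axis_def vec_eq_iff)
  then show "x \<bullet> ivec (axis j 1) = x $ j" by (simp add: inner_axis)
qed (simp_all add: ivec_def vec_eq_iff)

lemma trig_function_const: "trig_function (\<lambda>x. a)"
  using trig_function.char[of a 0] by simp

lemma trig_function_char_mult:
  assumes "trig_function f"
  shows "trig_function (\<lambda>x. (a * cis (2 * pi * (x \<bullet> ivec n))) * f x)"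
  using assms
proof induction
  case (char b m)
  have eq: "(a * cis (2 * pi * (x \<bullet> ivec n))) * (b * cis (2 * pi * (x \<bullet> ivec m)))
      = a * b * cis (2 * pi * (x \<bullet> ivec (n + m)))" for x :: "real^'a"
    by (simp add: ivec_add inner_add_right distrib_left flip: cis_mult)
  show ?case unfolding eq by (rule trig_function.char)
next
  case (add f g)
  then show ?case by (simp only: distrib_left) (rule trig_function.add)
qed

lemma trig_function_mult:
  assumes "trig_function f" "trig_function g"
  shows "trig_function (\<lambda>x. f x * g x)"
  using assms(1)
proof induction
  case (char a n)
  then show ?case by (rule trig_function_char_mult[OF assms(2)])
next
  case (add f f')
  then show ?case by (simp only: distrib_right) (rule trig_function.add)
qed

lemma trig_function_sum:
  "finite I \<Longrightarrow> (\<And>i. i \<in> I \<Longrightarrow> trig_function (f i)) \<Longrightarrow> trig_function (\<lambda>x. \<Sum>i\<in>I. f i x)"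
proof (induction I rule: finite_induct)
  case empty
  then show ?case by (simp add: trig_function_const)
next
  case (insert i I)
  then show ?case using trig_function.add[of "f i" "\<lambda>x. \<Sum>i\<in>I. f i x"] by simp
qed

section \<open>Approximation of indicator functions through a product of circles\<close>

definition circle_map :: "real^'d::finite \<Rightarrow> complex^'d" where
  "circle_map x = (\<chi> j. cis (2 * pi * x $ j))"

lemma continuous_on_circle_map: "continuous_on S circle_map"
  unfolding circle_map_def by (intro continuous_on_vec_lambda continuous_intros)

text \<open>Opposite faces of the closed cube are glued by \<open>circle_map\<close>, so two
  distinct points are sure to be separated only when one of them is interior. The map turns periodic
  functions on the cube into functions on a compact subset of \<open>complex^'d\<close>, where
  polynomial approximation is available.\<close>

lemma circle_map_eqD:
  assumes eq: "circle_map x = circle_map y" and x: "x \<in> box (\<chi> j. - 1 / 2) (\<chi> j. 1 / 2)"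
    and y: "y \<in> torus"
  shows "x = y"
proof -
  have "x $ j = y $ j" for j
  proof -
    have "cis (2 * pi * x $ j) = cis (2 * pi * y $ j)"
      using eq by (simp add: circle_map_def vec_eq_iff)
    then have "sin (2 * pi * x $ j) = sin (2 * pi * y $ j) \<and> cos (2 * pi * x $ j) = cos (2 * pi * y $ j)"
      by (simp add: complex_eq_iff)
    then obtain n where "2 * pi * x $ j = 2 * pi * y $ j + 2 * pi * of_int n"
      by (auto simp: sin_cos_eq_iff)
    then have "2 * pi * (x $ j) = 2 * pi * (y $ j + of_int n)" by (simp only: distrib_left)
    then have n: "x $ j = y $ j + of_int n" by simp
    moreover have "- 1 / 2 < x $ j \<and> x $ j < 1 / 2" using x[unfolded mem_box_cart, rule_format, of j] by auto
    moreover have "- 1 / 2 \<le> y $ j \<and> y $ j \<le> 1 / 2" using y[unfolded mem_torus, rule_format, of j] by auto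
    ultimately have "\<bar>of_int n :: real\<bar> < 1" by linarith
    then have "n = 0" by linarith
    with n show ?thesis by simp
  qed
  then show ?thesis by (simp add: vec_eq_iff)
qed

lemma trig_function_circle_map_component:
  "trig_function (\<lambda>x::real^'d::finite. complex_of_real (Re (circle_map x $ j)))"
  "trig_function (\<lambda>x::real^'d::finite. complex_of_real (Im (circle_map x $ j)))"
proof -
  let ?n = "axis j 1 :: int^'d"
  have "complex_of_real (Re (circle_map x $ j))
      = (1/2) * cis (2 * pi * (x \<bullet> ivec ?n)) + (1/2) * cis (2 * pi * (x \<bullet> ivec (- ?n)))" for x
    by (simp add: circle_map_def inner_ivec_axis ivec_uminus complex_eq_iff)
  then show "trig_function (\<lambda>x::real^'d. complex_of_real (Re (circle_map x $ j)))"
    by (simp only:) (rule trig_function.add[OF trig_function.char trig_function.char])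
  have "complex_of_real (Im (circle_map x $ j))
      = (- \<i>/2) * cis (2 * pi * (x \<bullet> ivec ?n)) + (\<i>/2) * cis (2 * pi * (x \<bullet> ivec (- ?n)))" for x
    by (simp add: circle_map_def inner_ivec_axis ivec_uminus complex_eq_iff)
  then show "trig_function (\<lambda>x::real^'d. complex_of_real (Im (circle_map x $ j)))"
    by (simp only:) (rule trig_function.add[OF trig_function.char trig_function.char])
qed

text \<open>The real and imaginary parts of \<open>cis (2 * pi * x $ j)\<close> are combinations of
  two characters, and \<open>trig_function\<close> is an algebra. A linear form is first expanded in
  the real basis \<open>axis j 1\<close>, \<open>axis j \<i>\<close>.\<close>

lemma trig_function_real_polynomial:
  assumes "real_polynomial_function q"
  shows "trig_function (\<lambda>x::real^'d::finite. complex_of_real (q (circle_map x)))"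
  using assms
proof induction
  case (linear f)
  interpret bounded_linear f by fact
  have "complex_of_real (f (circle_map x)) =
     (\<Sum>j\<in>UNIV. complex_of_real (f (axis j 1)) * complex_of_real (Re (circle_map x $ j))
        + complex_of_real (f (axis j \<i>)) * complex_of_real (Im (circle_map x $ j)))" for x :: "real^'d"
  proof -
    have "z = (\<Sum>j\<in>UNIV. Re (z $ j) *\<^sub>R axis j 1 + Im (z $ j) *\<^sub>R axis j \<i>)" for z :: "complex^'d"
    proof (simp only: vec_eq_iff, safe)
      fix i
      have "(\<Sum>j\<in>UNIV. Re (z $ j) *\<^sub>R axis j 1 + Im (z $ j) *\<^sub>R axis j \<i>) $ i
         = (\<Sum>j\<in>UNIV. if j = i then z $ i else 0)"
        unfolding sum_component
        by (intro sum.cong) (auto simp: axis_def complex_eq_iff)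
      then show "z $ i = (\<Sum>j\<in>UNIV. Re (z $ j) *\<^sub>R axis j 1 + Im (z $ j) *\<^sub>R axis j \<i>) $ i" by simp
    qed
    from arg_cong[OF this[of "circle_map x"], of f]
    have "f (circle_map x) = (\<Sum>j\<in>UNIV. Re (circle_map x $ j) * f (axis j 1) + Im (circle_map x $ j) * f (axis j \<i>))"
      by (simp add: sum add scaleR)
    then show ?thesis by (simp add: mult.commute)
  qed
  then show ?case
    by (simp only:) (intro trig_function_sum trig_function.add trig_function_mult trig_function_const
        trig_function_circle_map_component; simp)
next
  case (const c)
  then show ?case by (rule trig_function_const)
next
  case (add f g)
  then show ?case by (simp only: of_real_add) (rule trig_function.add)
next
  case (mult f g)
  then show ?case by (simp only: of_real_mult) (rule trig_function_mult)
qed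

lemma sum_trig_function_scaleC_is_trig_poly:
  fixes v :: "'i \<Rightarrow> 'x::complex_banach"
  assumes "finite I" "\<And>i. i \<in> I \<Longrightarrow> trig_function (u i)"
  shows "\<exists>F c. finite F \<and> (\<lambda>x. \<Sum>i\<in>I. u i x *\<^sub>C v i) = trig_poly F c"
proof -
  have trig_poly_add: "\<exists>H e. finite H \<and> (\<lambda>x. trig_poly F c x + trig_poly G d x) = trig_poly H e"
    if "finite F" "finite G" for F G and c d :: "int^'d \<Rightarrow> 'x"
  proof (intro exI conjI ext)
    \<comment> \<open>Coefficients are extended by 0 to the union of the two frequency sets, where
      they can be added.\<close>
    let ?e = "\<lambda>n. (if n \<in> F then c n else 0) + (if n \<in> G then d n else 0)"
    show "finite (F \<union> G)" using that by simp
    fix x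
    have "trig_poly F c x = (\<Sum>n\<in>F \<union> G. cis (2 * pi * (x \<bullet> ivec n)) *\<^sub>C (if n \<in> F then c n else 0))"
      unfolding trig_poly_def by (rule sum.mono_neutral_cong_left) (use that in \<open>auto simp: scaleC.zero_right\<close>)
    moreover have "trig_poly G d x = (\<Sum>n\<in>F \<union> G. cis (2 * pi * (x \<bullet> ivec n)) *\<^sub>C (if n \<in> G then d n else 0))"
      unfolding trig_poly_def by (rule sum.mono_neutral_cong_left) (use that in \<open>auto simp: scaleC.zero_right\<close>)
    ultimately show "trig_poly F c x + trig_poly G d x = trig_poly (F \<union> G) ?e x"
      by (simp add: trig_poly_def[of "F \<union> G"] scaleC_add_right sum.distrib)
  qed
  have single: "\<exists>F c. finite F \<and> (\<lambda>x. f x *\<^sub>C v) = trig_poly F c" if "trig_function f" for f and v :: 'x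
    using that
  proof induction
    case (char a n)
    have "(\<lambda>x. (a * cis (2 * pi * (x \<bullet> ivec n))) *\<^sub>C v) = trig_poly {n} (\<lambda>_. a *\<^sub>C v)"
      by (simp add: trig_poly_def scaleC_scaleC mult.commute fun_eq_iff)
    then show ?case by blast
  next
    case (add f g)
    then obtain F c G d where *: "finite F" "(\<lambda>x. f x *\<^sub>C v) = trig_poly F c"
      "finite G" "(\<lambda>x. g x *\<^sub>C v) = trig_poly G d" by blast
    have "(\<lambda>x. (f x + g x) *\<^sub>C v) = (\<lambda>x. trig_poly F c x + trig_poly G d x)"
      by (simp add: scaleC_add_left flip: *(2,4))
    then show ?case
      using trig_poly_add[OF *(1,3), of c d] by simp
  qed
  show ?thesis
    using assms
  proof (induction I rule: finite_induct)
    case empty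
    have "(\<lambda>x. 0) = trig_poly {} (\<lambda>_. 0)" by (simp add: trig_poly_def fun_eq_iff)
    then show ?case by auto
  next
    case (insert i I)
    obtain F c where 1: "finite F" "(\<lambda>x. u i x *\<^sub>C v i) = trig_poly F c"
      using single[of "u i" "v i"] insert by auto
    obtain G d where 2: "finite G" "(\<lambda>x. \<Sum>i\<in>I. u i x *\<^sub>C v i) = trig_poly G d"
      using insert by auto
    have "(\<lambda>x. \<Sum>i\<in>insert i I. u i x *\<^sub>C v i) = (\<lambda>x. trig_poly F c x + trig_poly G d x)"
      using insert.hyps by (simp add: fun_eq_iff flip: 1(2) 2(2))
    then show ?case using trig_poly_add[OF 1(1) 2(1), of c d] by simp
  qed
qed

lemma emeasure_torus_minus_box:
  "emeasure lebesgue (torus - box (\<chi> j. - 1 / 2) (\<chi> j. 1 / 2) :: (real^'d::finite) set) = 0"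
proof -
  have "emeasure lborel (torus - box (\<chi> j. - 1 / 2) (\<chi> j. 1 / 2) :: (real^'d) set) = 1 - 1"
  proof (subst emeasure_Diff)
    have "emeasure lborel (box (\<chi> j. - 1 / 2) (\<chi> j. 1 / 2) :: (real^'d) set) = 1"
      by (subst emeasure_lborel_box) (auto simp: Basis_vec_def inner_axis intro!: prod.neutral)
    then show "emeasure lborel (torus :: (real^'d) set) - emeasure lborel (box (\<chi> j. - 1 / 2) (\<chi> j. 1 / 2) :: (real^'d) set) = 1 - 1"
      "emeasure lborel (box (\<chi> j. - 1 / 2) (\<chi> j. 1 / 2) :: (real^'d) set) \<noteq> \<infinity>"
      by (simp_all add: emeasure_torus)
  qed (auto simp: torus_def box_subset_cbox)
  then show ?thesis by simp
qed

text \<open>Regularity of Lebesgue measure, then Urysohn's lemma and the Stone--Weierstrass theorem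
  on the image in the product of circles. Besides the L^1 error, a bound independent of
  \<open>e\<close> is recorded, because the limit argument below works with uniformly bounded
  approximants.\<close>

lemma trig_function_approx_indicator:
  fixes A :: "(real^'d::finite) set"
  assumes A: "A \<in> sets lebesgue" "A \<subseteq> torus" and e: "0 < (e::real)"
  obtains u where "trig_function u" "\<And>x. x \<in> torus \<Longrightarrow> cmod (u x) \<le> 2"
    "(\<integral>\<^sup>+x. ennreal (cmod (u x - indicator A x)) * indicator torus x \<partial>lebesgue) \<le> ennreal e"
proof -
  define I :: "(real^'d) set" where "I = box (\<chi> j. - 1 / 2) (\<chi> j. 1 / 2)"
  have I: "open I" "I \<subseteq> torus" "I \<in> sets lebesgue"
    by (auto simp: I_def torus_def box_subset_cbox)
  \<comment> \<open>Three errors of size \<delta> are added: that of the polynomial and those of the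
    inner and the outer regularity estimate. The minimum with 1 gives the bound 2.\<close>
  define \<delta> where "\<delta> = min 1 (e / 3)"
  have \<delta>: "0 < \<delta>" "\<delta> \<le> 1" "\<delta> \<le> e / 3" using e by (auto simp: \<delta>_def)
  have AI: "A \<inter> I \<in> sets lebesgue" using A I by auto
  obtain K where K: "closed K" "K \<subseteq> A \<inter> I" "A \<inter> I - K \<in> lmeasurable" "emeasure lebesgue (A \<inter> I - K) < ennreal \<delta>"
    using sets_lebesgue_inner_closed[OF AI \<delta>(1)] .
  obtain U0 where U0: "open U0" "A \<inter> I \<subseteq> U0" "U0 - A \<inter> I \<in> lmeasurable" "emeasure lebesgue (U0 - A \<inter> I) < ennreal \<delta>"
    using sets_lebesgue_outer_open[OF AI \<delta>(1)] .
  define U where "U = U0 \<inter> I"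
  have tc: "compact (torus :: (real^'d) set)" by (simp add: torus_def compact_cbox)
  have Kc: "compact K"
  proof -
    have "torus \<inter> K = K" using K(2) I(2) by auto
    then show ?thesis using compact_Int_closed[OF tc K(1)] by simp
  qed
  have Uc: "compact (torus - U)"
    using tc U0(1) I(1) by (simp add: U_def compact_diff open_Int)
  have disj: "circle_map ` K \<inter> circle_map ` (torus - U) = {}"
  proof -
    have False if "x \<in> K" "y \<in> torus - U" "circle_map x = circle_map y" for x y
    proof -
      have "x \<in> I" "x \<in> U" using that(1) K(2) U0(2) by (auto simp: U_def)
      then have "x = y" using circle_map_eqD[OF that(3)] that(2) by (auto simp: I_def)
      then show False using \<open>x \<in> U\<close> that(2) by auto
    qed
    then show ?thesis by blast
  qed
  have cl: "closed (circle_map ` K)" "closed (circle_map ` (torus - U))"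
    using compact_continuous_image[OF continuous_on_circle_map Kc]
      compact_continuous_image[OF continuous_on_circle_map Uc] by (auto intro: compact_imp_closed)
  obtain v :: "complex^'d \<Rightarrow> real" where v: "continuous_on UNIV v"
      "\<And>x. v x \<in> closed_segment 1 0" "\<And>x. x \<in> circle_map ` K \<Longrightarrow> v x = 1"
      "\<And>x. x \<in> circle_map ` (torus - U) \<Longrightarrow> v x = 0"
    using Urysohn[OF cl disj, of 1 0] by metis
  have v01: "0 \<le> v x" "v x \<le> 1" for x using v(2)[of x] by (auto simp: closed_segment_eq_real_ivl)
  obtain q where q: "real_polynomial_function q"
     "\<And>x. x \<in> circle_map ` torus \<Longrightarrow> \<bar>v x - q x\<bar> < \<delta>"
    using Stone_Weierstrass_real_polynomial_function[OF
        compact_continuous_image[OF continuous_on_circle_map tc] continuous_on_subset[OF v(1) subset_UNIV] \<delta>(1)]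
    by metis
  define u where "u x = complex_of_real (q (circle_map x))" for x :: "real^'d"
  show ?thesis
  proof
    show "trig_function u" unfolding u_def by (rule trig_function_real_polynomial) fact
    show "cmod (u x) \<le> 2" if "x \<in> torus" for x
      using q(2)[of "circle_map x"] v01[of "circle_map x"] \<delta> that by (auto simp: u_def)
    \<comment> \<open>Where \<open>v\<close> differs from the indicator of \<open>A\<close>, the
      error is at most 1 and is charged to one of three sets: \<open>A\<close> without
      \<open>K\<close> inside the open box, \<open>U0\<close> without \<open>A\<close>, or the null
      boundary of the cube.\<close>
    have pt: "ennreal (cmod (u x - indicator A x)) * indicator torus x
        \<le> ennreal \<delta> * indicator torus x + (indicator (A \<inter> I - K) x + (indicator (U0 - A \<inter> I) x + indicator (torus - I) x))"
      for x
    proof (cases "x \<in> torus")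
      case True
      define k :: real where "k = indicator (A \<inter> I - K) x + (indicator (U0 - A \<inter> I) x + indicator (torus - I) x)"
      have "\<bar>v (circle_map x) - indicator A x\<bar> \<le> k"
      proof (cases "x \<in> K")
        case True
        then show ?thesis using v(3)[of "circle_map x"] K(2) by (auto simp: k_def)
      next
        case False
        show ?thesis
        proof (cases "x \<in> U")
          case True
          then have "1 \<le> k" using False by (auto simp: k_def U_def indicator_def)
          then show ?thesis using v01[of "circle_map x"] by (auto simp: indicator_def)
        next
          case xU: False
          then have "v (circle_map x) = 0" using v(4)[of "circle_map x"] True by auto
          moreover have "indicator A x \<le> k" 
            using False xU True U0(2) by (auto simp: k_def U_def indicator_def)
          ultimately show ?thesis by (simp add: indicator_def)
        qed
      qed
      moreover have "\<bar>q (circle_map x) - v (circle_map x)\<bar> \<le> \<delta>"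
        using q(2)[of "circle_map x"] True by (auto simp: abs_minus_commute less_imp_le)
      ultimately have "\<bar>q (circle_map x) - indicator A x\<bar> \<le> \<delta> + k" by linarith
      moreover have "cmod (u x - indicator A x) = \<bar>q (circle_map x) - indicator A x\<bar>"
      proof -
        have "u x - indicator A x = complex_of_real (q (circle_map x) - indicator A x)"
          by (simp add: u_def indicator_def)
        then show ?thesis by (simp only: norm_of_real)
      qed
      ultimately have "ennreal (cmod (u x - indicator A x)) \<le> ennreal (\<delta> + k)" by (simp add: ennreal_leI)
      also have "\<dots> = ennreal \<delta> + (indicator (A \<inter> I - K) x + (indicator (U0 - A \<inter> I) x + indicator (torus - I) x))"
        using \<delta> by (simp add: k_def ennreal_indicator)
      finally show ?thesis using True by simp
    qed simp
    have "(\<integral>\<^sup>+x. ennreal (cmod (u x - indicator A x)) * indicator torus x \<partial>lebesgue)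
       \<le> (\<integral>\<^sup>+x. ennreal \<delta> * indicator torus x + (indicator (A \<inter> I - K) x + (indicator (U0 - A \<inter> I) x + indicator (torus - I) x)) \<partial>lebesgue)"
      by (rule nn_integral_mono) (rule pt)
    also have "\<dots> = ennreal \<delta> * emeasure lebesgue (torus :: (real^'d) set)
        + (emeasure lebesgue (A \<inter> I - K) + (emeasure lebesgue (U0 - A \<inter> I) + emeasure lebesgue (torus - I)))"
    proof -
      have s: "A \<inter> I - K \<in> sets lebesgue" "U0 - A \<inter> I \<in> sets lebesgue" "torus - I \<in> sets lebesgue"
        using K(3) U0(3) I by (auto simp: fmeasurableD)
      have m [measurable]: "indicator (A \<inter> I - K) \<in> borel_measurable lebesgue"
         "indicator (U0 - A \<inter> I) \<in> borel_measurable lebesgue" "indicator (torus - I) \<in> borel_measurable lebesgue"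
         "indicator (torus :: (real^'d) set) \<in> borel_measurable lebesgue"
        using s by (auto intro!: borel_measurable_indicator)
      show ?thesis
        using s by (simp add: nn_integral_add nn_integral_cmult)
    qed
    also have "\<dots> \<le> ennreal \<delta> * 1 + (ennreal \<delta> + (ennreal \<delta> + 0))"
      using K(4) U0(4) emeasure_torus_minus_box[where 'd='d]
      by (intro add_mono mult_mono) (auto simp: emeasure_torus I_def)
    also have "\<dots> = ennreal (3 * \<delta>)" using \<delta> by (simp flip: ennreal_plus)
    also have "\<dots> \<le> ennreal e" using \<delta> by (intro ennreal_leI) simp
    finally show "(\<integral>\<^sup>+x. ennreal (cmod (u x - indicator A x)) * indicator torus x \<partial>lebesgue) \<le> ennreal e" .
  qed
qed

section \<open>Fourier coefficients of bounded functions\<close>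

abbreviation torus_measure :: "(real^'d::finite) measure" where
  "torus_measure \<equiv> lebesgue_on torus"

text \<open>By the mean value theorem \<open>t powr p\<close> is Lipschitz on the interval from 0 to
  \<Lambda>. For uniformly bounded functions, closeness in L^1 therefore controls the integrals of
  the p-th powers.\<close>

lemma powr_le_powr_plus_diff:
  fixes a b p \<Lambda> :: real
  assumes p: "1 < p" and a: "0 \<le> a" "a \<le> \<Lambda>" and b: "0 \<le> b" "b \<le> \<Lambda>"
  shows "a powr p \<le> b powr p + p * \<Lambda> powr (p - 1) * \<bar>a - b\<bar>"
proof (cases "b < a")
  case True
  have c: "continuous_on {b..a} (\<lambda>x. x powr p)"
    by (rule continuous_on_powr'[OF continuous_on_id[unfolded id_def] continuous_on_const]) (use b p in auto)
  have d: "((\<lambda>x. x powr p) has_real_derivative p * x powr (p - 1)) (at x)" if "b < x" "x < a" for x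
    using that b by (intro has_real_derivative_powr) auto
  obtain l z where z: "b < z" "z < a" "((\<lambda>x. x powr p) has_real_derivative l) (at z)"
      "a powr p - b powr p = (a - b) * l"
    using MVT[OF True c] d by (metis real_differentiable_def)
  have l: "l = p * z powr (p - 1)" using DERIV_unique[OF z(3) d[OF z(1,2)]] .
  have "z powr (p - 1) \<le> \<Lambda> powr (p - 1)" using z b a p by (intro powr_mono2) auto
  then have "(a - b) * l \<le> (a - b) * (p * \<Lambda> powr (p - 1))"
    unfolding l using True p by (intro mult_left_mono) auto
  moreover have "p * \<Lambda> powr (p - 1) * \<bar>a - b\<bar> = (a - b) * (p * \<Lambda> powr (p - 1))"
    using True by simp
  ultimately show ?thesis using z(4) by linarith
next
  case False
  then have "a powr p \<le> b powr p" using a p by (intro powr_mono2) auto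
  then show ?thesis using p by (smt (verit) mult_nonneg_nonneg powr_ge_zero abs_ge_zero)
qed

lemma borel_measurable_character: "(\<lambda>x. cis (- 2 * pi * (x \<bullet> v))) \<in> borel_measurable torus_measure"
proof -
  have "continuous_on UNIV (\<lambda>x. cis (- 2 * pi * (x \<bullet> v)))"
    by (intro continuous_intros)
  then have "(\<lambda>x. cis (- 2 * pi * (x \<bullet> v))) \<in> borel_measurable borel"
    by (rule borel_measurable_continuous_onI)
  then have "(\<lambda>x. cis (- 2 * pi * (x \<bullet> v))) \<in> borel_measurable lebesgue"
    by (metis measurable_completion measurable_lborel2)
  then show ?thesis by (rule measurable_restrict_space1)
qed

context
  fixes f :: "real^'d::finite \<Rightarrow> 'x::complex_banach"
  assumes f: "strongly_measurable torus_measure f"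
    and fin: "(\<integral>\<^sup>+x. norm (f x) \<partial>torus_measure) < \<infinity>"
begin

text \<open>Integrability guarantees that the coefficient is the value of an existing integral and
  not the default 0 of \<open>strong_bochner_integral\<close>.\<close>

lemma has_fourier_coeff:
  "has_strong_bochner_integral torus_measure (\<lambda>x. cis (- 2 * pi * (x \<bullet> ivec n)) *\<^sub>C f x) (fourier_coeff f n)"
proof -
  have 1: "strongly_measurable torus_measure (\<lambda>x. cis (- 2 * pi * (x \<bullet> ivec n)) *\<^sub>C f x)"
    by (rule strongly_measurable_scaleC[OF borel_measurable_character f])
  have 2: "(\<integral>\<^sup>+x. norm (cis (- 2 * pi * (x \<bullet> ivec n)) *\<^sub>C f x) \<partial>torus_measure) < \<infinity>"
    using fin by (simp add: norm_scaleC)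
  have 3: "emeasure (torus_measure :: (real^'d) measure) (space torus_measure) < \<infinity>"
    by (simp only: emeasure_space_torus) simp
  obtain I where I: "has_strong_bochner_integral torus_measure (\<lambda>x. cis (- 2 * pi * (x \<bullet> ivec n)) *\<^sub>C f x) I"
    by (rule has_strong_bochner_integral_exists[OF complete_measure_torus 3 1 2])
  then show ?thesis
    using strong_bochner_integral_eq[OF complete_measure_torus I]
    by (simp add: fourier_coeff_def ivec_def)
qed

lemma norm_fourier_coeff_le: "ennreal (norm (fourier_coeff f n)) \<le> (\<integral>\<^sup>+x. norm (f x) \<partial>torus_measure)"
  using has_strong_bochner_integral_norm_bound[OF complete_measure_torus has_fourier_coeff[of n]]
  by (simp add: norm_scaleC)

end

lemma fourier_coeff_diff:
  fixes f g :: "real^'d::finite \<Rightarrow> 'x::complex_banach"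
  assumes "strongly_measurable torus_measure f" "(\<integral>\<^sup>+x. norm (f x) \<partial>torus_measure) < \<infinity>"
    and "strongly_measurable torus_measure g" "(\<integral>\<^sup>+x. norm (g x) \<partial>torus_measure) < \<infinity>"
  shows "fourier_coeff (\<lambda>x. f x - g x) n = fourier_coeff f n - fourier_coeff g n"
  using strong_bochner_integral_eq[OF complete_measure_torus has_strong_bochner_integral_diff[OF
        complete_measure_torus has_fourier_coeff[OF assms(1,2), of n] has_fourier_coeff[OF assms(3,4), of n]]]
  by (simp add: fourier_coeff_def ivec_def scaleC.diff_right)

section \<open>Hausdorff--Young inequality by approximation in L^1\<close>

lemma nn_integral_torus_bounded:
  assumes "\<And>x. x \<in> torus \<Longrightarrow> h x \<le> \<Lambda>"
  shows "(\<integral>\<^sup>+x. ennreal (h x) \<partial>(torus_measure :: (real^'d::finite) measure)) \<le> ennreal \<Lambda>"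
proof -
  have "(\<integral>\<^sup>+x. ennreal (h x) \<partial>(torus_measure :: (real^'d) measure)) \<le> (\<integral>\<^sup>+x. ennreal \<Lambda> \<partial>(torus_measure :: (real^'d) measure))"
    using assms by (intro nn_integral_mono) (auto intro: ennreal_leI)
  also have "\<dots> = ennreal \<Lambda> * 1" by (simp only: nn_integral_const emeasure_space_torus)
  finally show ?thesis by simp
qed

text \<open>Both sides are raised to the power \<open>conj_exp p\<close>, whence the exponent of
  \<open>B\<close>. Finite sets \<open>F\<close> and real majorants \<open>B\<close> keep the
  inequality among real numbers and make it stable under limits.\<close>

definition hausdorff_young :: "real \<Rightarrow> real \<Rightarrow> (real^'d::finite \<Rightarrow> 'x::complex_banach) \<Rightarrow> bool" where
  "hausdorff_young K p f \<longleftrightarrow> (\<forall>F B. finite F \<longrightarrow> 0 \<le> B \<longrightarrow>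
     (\<integral>\<^sup>+x. ennreal (norm (f x) powr p) \<partial>torus_measure) \<le> ennreal B \<longrightarrow>
     (\<Sum>n\<in>F. norm (fourier_coeff f n) powr conj_exp p) \<le> K * B powr (conj_exp p / p))"

text \<open>For a fixed finite \<open>F\<close> both sides pass to the limit: the coefficients
  converge because of L^1 convergence, and the p-th power integrals are controlled through the
  common bound \<Lambda>. The constant \<open>K\<close> is inherited unchanged, whatever \<Lambda>
  is.\<close>

lemma hausdorff_young_limit:
  fixes f :: "real^'d::finite \<Rightarrow> 'x::complex_banach"
  assumes p: "1 < p" and \<Lambda>: "0 \<le> \<Lambda>"
    and f: "strongly_measurable torus_measure f" "\<And>x. x \<in> torus \<Longrightarrow> norm (f x) \<le> \<Lambda>"
    and approx: "\<And>e. 0 < e \<Longrightarrow> \<exists>h. strongly_measurable torus_measure h \<and> (\<forall>x\<in>torus. norm (h x) \<le> \<Lambda>) \<and>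
        hausdorff_young K p h \<and> (\<integral>\<^sup>+x. norm (f x - h x) \<partial>torus_measure) \<le> ennreal e"
  shows "hausdorff_young K p f"
  unfolding hausdorff_young_def
proof (intro allI impI)
  fix F :: "(int^'d) set" and B :: real
  assume F: "finite F" and B: "0 \<le> B"
    and le: "(\<integral>\<^sup>+x. ennreal (norm (f x) powr p) \<partial>torus_measure) \<le> ennreal B"
  have q: "1 < conj_exp p" using conj_exp_props[OF p] by simp
  interpret complete_measure "torus_measure :: (real^'d) measure" by (rule complete_measure_torus)
  define P where "P k h \<longleftrightarrow> strongly_measurable torus_measure h \<and> (\<forall>x\<in>torus. norm (h x) \<le> \<Lambda>) \<and>
        hausdorff_young K p h \<and> (\<integral>\<^sup>+x. norm (f x - h x) \<partial>torus_measure) \<le> ennreal (1 / real (Suc k))"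
    for k :: nat and h
  have "\<exists>h. P k h" for k
    using approx[of "1 / real (Suc k)"] unfolding P_def by simp
  then obtain h where "\<And>k. P k (h k)" by metis
  then have h: "\<And>k. strongly_measurable torus_measure (h k)" "\<And>k x. x \<in> torus \<Longrightarrow> norm (h k x) \<le> \<Lambda>"
      "\<And>k. hausdorff_young K p (h k)" "\<And>k. (\<integral>\<^sup>+x. norm (f x - h k x) \<partial>torus_measure) \<le> ennreal (1 / real (Suc k))"
    unfolding P_def by blast+
  have fin: "(\<integral>\<^sup>+x. norm (f x) \<partial>torus_measure) < \<infinity>" "(\<integral>\<^sup>+x. norm (h k x) \<partial>torus_measure) < \<infinity>" for k
    using nn_integral_torus_bounded[of "\<lambda>x. norm (f x)" \<Lambda>] nn_integral_torus_bounded[of "\<lambda>x. norm (h k x)" \<Lambda>] f(2) h(2)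
    by (auto intro: le_less_trans)
  define D where "D = p * \<Lambda> powr (p - 1)"
  have D: "0 \<le> D" using p by (simp add: D_def)
  have inv: "(\<lambda>k. 1 / real (Suc k)) \<longlonglongrightarrow> 0" using LIMSEQ_Suc[OF lim_1_over_n] .
  have coeff: "(\<lambda>k. fourier_coeff (h k) n) \<longlonglongrightarrow> fourier_coeff f n" for n
  proof -
    have "norm (fourier_coeff f n - fourier_coeff (h k) n) \<le> 1 / real (Suc k)" for k
    proof -
      have "(\<integral>\<^sup>+x. norm (f x - h k x) \<partial>torus_measure) < \<infinity>"
        using h(4)[of k] by (auto intro: le_less_trans)
      from norm_fourier_coeff_le[OF strongly_measurable_diff[OF f(1) h(1)] this, of n]
      have "ennreal (norm (fourier_coeff f n - fourier_coeff (h k) n)) \<le> ennreal (1 / real (Suc k))"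
        unfolding fourier_coeff_diff[OF f(1) fin(1) h(1) fin(2)] using h(4)[of k] by (rule order_trans)
      then show ?thesis by (rule ennreal_le_iff[THEN iffD1, rotated]) simp
    qed
    then have "(\<lambda>k. fourier_coeff f n - fourier_coeff (h k) n) \<longlonglongrightarrow> 0"
      by (intro Lim_null_comparison[OF _ inv]) auto
    from tendsto_diff[OF tendsto_const[of "fourier_coeff f n"] this] show ?thesis by simp
  qed
  have powr_int: "(\<integral>\<^sup>+x. ennreal (norm (h k x) powr p) \<partial>torus_measure) \<le> ennreal (B + D * (1 / real (Suc k)))" for k
  proof -
    have m [measurable]: "(\<lambda>x. norm (f x)) \<in> borel_measurable torus_measure"
      "(\<lambda>x. norm (f x - h k x)) \<in> borel_measurable torus_measure"
      by (intro strongly_measurable_norm strongly_measurable_diff f h)+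
    have "(\<integral>\<^sup>+x. ennreal (norm (h k x) powr p) \<partial>torus_measure)
       \<le> (\<integral>\<^sup>+x. ennreal (norm (f x) powr p) + ennreal D * ennreal (norm (f x - h k x)) \<partial>torus_measure)"
    proof (rule nn_integral_mono)
      fix x :: "real^'d" assume "x \<in> space torus_measure"
      then have x: "x \<in> torus" by simp
      have "norm (h k x) powr p \<le> norm (f x) powr p + D * \<bar>norm (h k x) - norm (f x)\<bar>"
        unfolding D_def by (rule powr_le_powr_plus_diff[OF p]) (use f(2) h(2) x in auto)
      also have "\<dots> \<le> norm (f x) powr p + D * norm (f x - h k x)"
        using norm_triangle_ineq3[of "h k x" "f x"] D by (intro add_left_mono mult_left_mono) (auto simp: norm_minus_commute)
      finally show "ennreal (norm (h k x) powr p) \<le> ennreal (norm (f x) powr p) + ennreal D * ennreal (norm (f x - h k x))"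
        using D by (simp add: ennreal_leI flip: ennreal_mult ennreal_plus)
    qed
    also have "\<dots> = (\<integral>\<^sup>+x. ennreal (norm (f x) powr p) \<partial>torus_measure) + ennreal D * (\<integral>\<^sup>+x. norm (f x - h k x) \<partial>torus_measure)"
      by (subst nn_integral_add) (auto simp: nn_integral_cmult)
    also have "\<dots> \<le> ennreal B + ennreal D * ennreal (1 / real (Suc k))"
      by (intro add_mono mult_left_mono le h) auto
    also have "\<dots> = ennreal (B + D * (1 / real (Suc k)))"
      using B D by (simp flip: ennreal_mult ennreal_plus)
    finally show ?thesis .
  qed
  have step: "(\<Sum>n\<in>F. norm (fourier_coeff (h k) n) powr conj_exp p) \<le> K * (B + D * (1 / real (Suc k))) powr (conj_exp p / p)" for k
    using h(3)[of k] F powr_int[of k] B D unfolding hausdorff_young_def by auto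
  have lim1: "(\<lambda>k. \<Sum>n\<in>F. norm (fourier_coeff (h k) n) powr conj_exp p) \<longlonglongrightarrow> (\<Sum>n\<in>F. norm (fourier_coeff f n) powr conj_exp p)"
    using q by (intro tendsto_sum tendsto_powr' tendsto_norm coeff tendsto_const) auto
  have "(\<lambda>k. B + D * (1 / real (Suc k))) \<longlonglongrightarrow> B + D * 0"
    by (intro tendsto_add tendsto_mult tendsto_const inv)
  then have lim2: "(\<lambda>k. K * (B + D * (1 / real (Suc k))) powr (conj_exp p / p)) \<longlonglongrightarrow> K * B powr (conj_exp p / p)"
    using q p B D by (intro tendsto_mult tendsto_const tendsto_powr') (auto intro!: always_eventually)
  show "(\<Sum>n\<in>F. norm (fourier_coeff f n) powr conj_exp p) \<le> K * B powr (conj_exp p / p)"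
    by (rule LIMSEQ_le[OF lim1 lim2]) (use step in auto)
qed

lemma strongly_measurable_trig_poly: "strongly_measurable torus_measure (trig_poly F c)"
  unfolding trig_poly_def
proof (induction F rule: infinite_finite_induct)
  case (insert n F)
  have "strongly_measurable torus_measure (\<lambda>x. cis (- 2 * pi * (x \<bullet> (- ivec n))) *\<^sub>C c n)"
    by (intro strongly_measurable_scaleC borel_measurable_character strongly_measurable_simple simple_function_const)
  from strongly_measurable_add[OF this insert.IH] show ?case by (simp add: insert.hyps)
qed (simp_all add: strongly_measurable_simple)

lemma hausdorff_young_trig_poly:
  fixes c :: "int^'d::finite \<Rightarrow> 'x::complex_banach"
  assumes K: "\<And>F (c :: int^'d \<Rightarrow> 'x) B. finite F \<Longrightarrow> 0 \<le> B \<Longrightarrow>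
     (\<integral>\<^sup>+x. ennreal (norm (trig_poly F c x) powr p) * indicator torus x \<partial>lborel) \<le> ennreal B \<Longrightarrow>
     (\<Sum>n\<in>F. norm (c n) powr conj_exp p) \<le> K * B powr (conj_exp p / p)"
    and G: "finite G"
  shows "hausdorff_young K p (trig_poly G c)"
  unfolding hausdorff_young_def
proof (intro allI impI)
  fix F :: "(int^'d) set" and B :: real
  assume F: "finite F" and B: "0 \<le> B"
    and le: "(\<integral>\<^sup>+x. ennreal (norm (trig_poly G c x) powr p) \<partial>torus_measure) \<le> ennreal B"
  \<comment> \<open>The set \<open>F\<close> may contain indices that are not frequencies of the
    polynomial; zero coefficients on \<open>F \<union> G\<close> turn all of them into
    frequencies.\<close>
  define c' where "c' n = (if n \<in> G then c n else 0)" for n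
  have eq: "trig_poly G c = trig_poly (F \<union> G) c'"
    unfolding trig_poly_def c'_def fun_eq_iff
    by (intro allI sum.mono_neutral_cong_left) (use F G in \<open>auto simp: scaleC.zero_right\<close>)
  have fc: "fourier_coeff (trig_poly G c) n = c' n" if "n \<in> F" for n
    unfolding eq fourier_coeff_def
    using strong_bochner_integral_eq[OF complete_measure_torus fourier_coeff_trig_poly[of "F \<union> G" n c']] F G that
    by (simp add: ivec_def)
  have "(\<Sum>n\<in>F. norm (fourier_coeff (trig_poly G c) n) powr conj_exp p) = (\<Sum>n\<in>F. norm (c' n) powr conj_exp p)"
    by (intro sum.cong) (simp_all add: fc)
  also have "\<dots> \<le> (\<Sum>n\<in>F \<union> G. norm (c' n) powr conj_exp p)"
    by (intro sum_mono2) (use F G in auto)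
  also have "\<dots> \<le> K * B powr (conj_exp p / p)"
  proof (rule K)
    show "(\<integral>\<^sup>+x. ennreal (norm (trig_poly (F \<union> G) c' x) powr p) * indicator torus x \<partial>lborel) \<le> ennreal B"
      using le unfolding eq by (simp add: nn_integral_restrict_space nn_integral_completion)
  qed (use F G B in auto)
  finally show "(\<Sum>n\<in>F. norm (fourier_coeff (trig_poly G c) n) powr conj_exp p) \<le> K * B powr (conj_exp p / p)" .
qed

lemma hausdorff_young_simple:
  fixes g :: "real^'d::finite \<Rightarrow> 'x::complex_banach"
  assumes p: "1 < p"
    and K: "\<And>F (c :: int^'d \<Rightarrow> 'x). finite F \<Longrightarrow> hausdorff_young K p (trig_poly F c)"
    and g: "simple_function torus_measure g"
  shows "hausdorff_young K p g"
proof -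
  define V where "V = g ` torus"
  define A where "A y = {x\<in>torus. g x = y}" for y
  define N where "N = (\<Sum>y\<in>V. norm y)"
  have V: "finite V" using simple_functionD(1)[OF g] by (simp add: V_def)
  have N: "0 \<le> N" by (simp add: N_def sum_nonneg)
  have A: "A y \<in> sets lebesgue" "A y \<subseteq> torus" for y
  proof -
    have "g -` {y} \<inter> space torus_measure \<in> sets torus_measure" by (rule simple_functionD(2)[OF g])
    moreover have "g -` {y} \<inter> space torus_measure = A y" by (auto simp: A_def)
    ultimately have "A y \<in> sets torus_measure" by simp
    then show "A y \<in> sets lebesgue"
      by (simp add: sets_restrict_space_iff)
    show "A y \<subseteq> torus" by (auto simp: A_def)
  qed
  have g_eq: "g x = (\<Sum>y\<in>V. indicator (A y) x *\<^sub>C y)" if "x \<in> torus" for x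
  proof -
    have "(\<Sum>y\<in>V. indicator (A y) x *\<^sub>C y) = (\<Sum>y\<in>V. if y = g x then g x else 0)"
      using that by (intro sum.cong) (auto simp: A_def indicator_def scaleC.zero_left)
    then show ?thesis using V that by (simp add: V_def)
  qed
  show ?thesis
  proof (rule hausdorff_young_limit[OF p])
    \<comment> \<open>The approximants of the indicators are bounded by 2, so \<open>2 * N\<close>
      bounds \<open>g\<close> and all its approximants at once.\<close>
    show "0 \<le> 2 * N" using N by simp
    show "strongly_measurable torus_measure g" using g by (rule strongly_measurable_simple)
    show "norm (g x) \<le> 2 * N" if "x \<in> torus" for x
    proof -
      have "norm (g x) \<le> N" unfolding N_def using that V by (intro member_le_sum[of "g x" V norm]) (auto simp: V_def)
      then show ?thesis using N by simp
    qed
    fix e :: real assume e: "0 < e"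
    \<comment> \<open>The errors are weighted by \<open>norm y\<close>, and these weights add up to
      \<open>N\<close>; dividing by \<open>N + 1\<close> keeps the total below \<open>e\<close>,
      also when \<open>N = 0\<close>.\<close>
    define P where "P y u \<longleftrightarrow> trig_function u \<and> (\<forall>x\<in>torus. cmod (u x) \<le> 2) \<and>
      (\<integral>\<^sup>+x. ennreal (cmod (u x - indicator (A y) x)) * indicator torus x \<partial>lebesgue) \<le> ennreal (e / (N + 1))"
      for y u
    have "\<exists>u. P y u" for y
    proof -
      have "0 < e / (N + 1)" using e N by simp
      show ?thesis
      proof (rule trig_function_approx_indicator[OF A(1)[of y] A(2)[of y] \<open>0 < e / (N + 1)\<close>])
        fix u :: "real^'d \<Rightarrow> complex"
        assume "trig_function u" "\<And>x. x \<in> torus \<Longrightarrow> cmod (u x) \<le> 2"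
          "(\<integral>\<^sup>+x. ennreal (cmod (u x - indicator (A y) x)) * indicator torus x \<partial>lebesgue) \<le> ennreal (e / (N + 1))"
        then have "P y u" by (simp add: P_def)
        then show "\<exists>u. P y u" by (rule exI[where P="P y"])
      qed
    qed
    then obtain u where "\<And>y. P y (u y)" by metis
    then have u: "\<And>y. trig_function (u y)" "\<And>y x. x \<in> torus \<Longrightarrow> cmod (u y x) \<le> 2"
      "\<And>y. (\<integral>\<^sup>+x. ennreal (cmod (u y x - indicator (A y) x)) * indicator torus x \<partial>lebesgue) \<le> ennreal (e / (N + 1))"
      unfolding P_def by blast+
    define h where "h x = (\<Sum>y\<in>V. u y x *\<^sub>C y)" for x
    obtain F c where Fc: "finite F" "h = trig_poly F c"
      using sum_trig_function_scaleC_is_trig_poly[OF V, of u "\<lambda>y. y"] u(1) unfolding h_def by blast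
    have hb: "norm (h x) \<le> 2 * N" if "x \<in> torus" for x
      unfolding h_def N_def sum_distrib_left
      by (rule sum_norm_le) (use u(2)[OF that] in \<open>auto simp: norm_scaleC intro: mult_right_mono\<close>)
    have um: "(\<lambda>x. cmod (u y x - indicator (A y) x)) \<in> borel_measurable torus_measure" for y
    proof -
      have "u y \<in> borel_measurable borel"
        using u(1)[of y]
      proof induction
        case (char a n)
        have "continuous_on UNIV (\<lambda>x::real^'d. a * cis (2 * pi * (x \<bullet> ivec n)))"
          by (intro continuous_intros)
        then show ?case by (rule borel_measurable_continuous_onI)
      qed (rule borel_measurable_add)
      then have "u y \<in> borel_measurable lebesgue"
        by (metis measurable_completion measurable_lborel2)
      then have [measurable]: "u y \<in> borel_measurable torus_measure" by (rule measurable_restrict_space1)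
      have [measurable]: "A y \<in> sets torus_measure"
        using A[of y] by (simp add: sets_restrict_space_iff)
      show ?thesis by measurable
    qed
    have "(\<integral>\<^sup>+x. norm (g x - h x) \<partial>torus_measure)
       \<le> (\<integral>\<^sup>+x. (\<Sum>y\<in>V. ennreal (norm y) * ennreal (cmod (u y x - indicator (A y) x))) \<partial>torus_measure)"
    proof (rule nn_integral_mono)
      fix x :: "real^'d" assume "x \<in> space torus_measure"
      then have x: "x \<in> torus" by simp
      have "norm (g x - h x) = norm (\<Sum>y\<in>V. (indicator (A y) x - u y x) *\<^sub>C y)"
        by (simp add: g_eq[OF x] h_def scaleC.diff_left sum_subtractf)
      also have "\<dots> \<le> (\<Sum>y\<in>V. norm y * cmod (u y x - indicator (A y) x))"
        by (rule sum_norm_le) (simp add: norm_scaleC norm_minus_commute mult.commute)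
      finally have "ennreal (norm (g x - h x)) \<le> ennreal (\<Sum>y\<in>V. norm y * cmod (u y x - indicator (A y) x))"
        by (rule ennreal_leI)
      also have "\<dots> = (\<Sum>y\<in>V. ennreal (norm y) * ennreal (cmod (u y x - indicator (A y) x)))"
        by (simp add: ennreal_mult flip: sum_ennreal)
      finally show "ennreal (norm (g x - h x)) \<le> (\<Sum>y\<in>V. ennreal (norm y) * ennreal (cmod (u y x - indicator (A y) x)))" .
    qed
    also have "\<dots> = (\<Sum>y\<in>V. ennreal (norm y) * (\<integral>\<^sup>+x. ennreal (cmod (u y x - indicator (A y) x)) \<partial>torus_measure))"
      using um by (subst nn_integral_sum) (auto simp: nn_integral_cmult)
    also have "\<dots> \<le> (\<Sum>y\<in>V. ennreal (norm y) * ennreal (e / (N + 1)))"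
      using u(3) by (intro sum_mono mult_left_mono) (auto simp: nn_integral_restrict_space)
    also have "\<dots> = ennreal (N * (e / (N + 1)))"
      using e N by (simp add: N_def ennreal_mult[symmetric] sum_distrib_right del: times_divide_eq_right)
    also have "\<dots> \<le> ennreal e"
      using e N by (intro ennreal_leI) (simp add: field_simps)
    finally have "(\<integral>\<^sup>+x. norm (g x - h x) \<partial>torus_measure) \<le> ennreal e" .
    then show "\<exists>h. strongly_measurable torus_measure h \<and> (\<forall>x\<in>torus. norm (h x) \<le> 2 * N) \<and>
        hausdorff_young K p h \<and> (\<integral>\<^sup>+x. norm (g x - h x) \<partial>torus_measure) \<le> ennreal e"
      using hb K[OF Fc(1), of c] strongly_measurable_trig_poly[of F c] unfolding Fc(2) by blast
  qed
qed

text \<open>The constant comes from the trigonometric polynomials and survives two limits, first to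
  simple and then to bounded functions. It is therefore the same for all bounds \<Lambda>, on which
  truncation at arbitrary heights depends.\<close>

theorem fourier_type_hausdorff_young:
  assumes type: "fourier_type TYPE('d::finite) TYPE('x::complex_banach) p" and p: "1 < p"
  obtains K where "0 \<le> K" "\<And>(f :: real^'d \<Rightarrow> 'x) \<Lambda>. strongly_measurable torus_measure f \<Longrightarrow>
     (\<And>x. x \<in> torus \<Longrightarrow> norm (f x) \<le> \<Lambda>) \<Longrightarrow> hausdorff_young K p f"
proof (rule fourier_type_trig_poly[OF type p])
  fix K
  assume K: "0 \<le> K" "\<And>F (c :: int^'d \<Rightarrow> 'x) B. finite F \<Longrightarrow> 0 \<le> B \<Longrightarrow>
     (\<integral>\<^sup>+x. ennreal (norm (trig_poly F c x) powr p) * indicator torus x \<partial>lborel) \<le> ennreal B \<Longrightarrow>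
     (\<Sum>n\<in>F. norm (c n) powr conj_exp p) \<le> K * B powr (conj_exp p / p)"
  have simple: "hausdorff_young K p g" if "simple_function torus_measure g" for g :: "real^'d \<Rightarrow> 'x"
    using p hausdorff_young_trig_poly[OF K(2)] that by (rule hausdorff_young_simple)
  have "hausdorff_young K p f"
    if f: "strongly_measurable torus_measure f" "\<And>x. x \<in> torus \<Longrightarrow> norm (f x) \<le> \<Lambda>" for f :: "real^'d \<Rightarrow> 'x" and \<Lambda>
  proof -
    have "(0::real^'d) \<in> torus" by (simp add: mem_torus)
    then have \<Lambda>: "0 \<le> \<Lambda>" using f(2) norm_ge_zero order_trans by blast
    have fin: "(\<integral>\<^sup>+x. norm (f x) \<partial>torus_measure) < \<infinity>"
      using nn_integral_torus_bounded[of "\<lambda>x. norm (f x)" \<Lambda>] f(2) by (auto intro: le_less_trans)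
    show ?thesis
    proof (rule strongly_measurable_L1_approx[OF complete_measure_torus f(1) fin])
      fix s :: "nat \<Rightarrow> real^'d \<Rightarrow> 'x"
      assume s: "\<And>i. simple_function torus_measure (s i)"
        "(\<lambda>i. \<integral>\<^sup>+x. norm (f x - s i x) \<partial>torus_measure) \<longlonglongrightarrow> 0"
        "\<And>i x. norm (s i x) \<le> 2 * norm (f x)"
      show ?thesis
      proof (rule hausdorff_young_limit[OF p])
        \<comment> \<open>The simple approximants are dominated by \<open>2 * norm (f x)\<close>,
          which provides the common bound.\<close>
        show "0 \<le> 2 * \<Lambda>" using \<Lambda> by simp
        show "norm (f x) \<le> 2 * \<Lambda>" if "x \<in> torus" for x using f(2)[OF that] \<Lambda> by linarith
        fix e :: real assume "0 < e"
        then have "eventually (\<lambda>i. (\<integral>\<^sup>+x. norm (f x - s i x) \<partial>torus_measure) < ennreal e) sequentially"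
          by (intro order_tendstoD(2)[OF s(2)]) simp
        then obtain i where i: "(\<integral>\<^sup>+x. norm (f x - s i x) \<partial>torus_measure) < ennreal e"
          by (auto simp: eventually_sequentially)
        have "\<forall>x\<in>torus. norm (s i x) \<le> 2 * \<Lambda>"
          using s(3)[of i] f(2) by (fastforce intro: order_trans)
        then show "\<exists>h. strongly_measurable torus_measure h \<and> (\<forall>x\<in>torus. norm (h x) \<le> 2 * \<Lambda>) \<and>
          hausdorff_young K p h \<and> (\<integral>\<^sup>+x. norm (f x - h x) \<partial>torus_measure) \<le> ennreal e"
          using i simple[OF s(1)] strongly_measurable_simple[OF s(1)] by (intro exI[of _ "s i"]) simp
      qed (rule f(1))
    qed
  qed
  with K(1) show ?thesis by (rule that)
qed

section \<open>Rearrangements\<close>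

lemma ennreal_less_plus: "r < \<infinity> \<Longrightarrow> 0 < e \<Longrightarrow> r < r + ennreal e"
  by (cases r) (simp_all add: ennreal_less_iff flip: ennreal_plus)

lemma ennreal_le_suminf: "g i \<le> (\<Sum>i. g i :: ennreal)"
  using sum_le_suminf[of g "{i}"] by simp

lemma rearrangement_antimono: "s \<le> t \<Longrightarrow> rearrangement M f t \<le> rearrangement M f s"
  unfolding rearrangement_def
  by (intro Inf_superset_mono) (auto intro: order_trans ennreal_leI)

text \<open>The infimum in the definition is attained: the set where the norm exceeds
  \<open>r\<close> is the increasing union of the sets where it exceeds
  \<open>r + 1 / (n + 1)\<close>, each of measure at most \<open>t\<close>.\<close>

lemma emeasure_gt_rearrangement:
  assumes m [measurable]: "(\<lambda>x. norm (f x)) \<in> borel_measurable M"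
  shows "emeasure M {x \<in> space M. rearrangement M f t < ennreal (norm (f x))} \<le> ennreal t"
proof -
  define r where "r = rearrangement M f t"
  define A where "A n = {x \<in> space M. r + ennreal (1 / real (Suc n)) < ennreal (norm (f x))}" for n
  have A_sets: "A n \<in> sets M" for n unfolding A_def by measurable
  have A_le: "emeasure M (A n) \<le> ennreal t" for n
  proof (cases "r = \<infinity>")
    case True
    then have "A n = {}" by (simp add: A_def)
    then show ?thesis by simp
  next
    case False
    then have "r < r + ennreal (1 / real (Suc n))"
      by (simp add: ennreal_less_plus less_top)
    then obtain s where s: "s < r + ennreal (1 / real (Suc n))" "emeasure M {x \<in> space M. s < ennreal (norm (f x))} \<le> ennreal t"
      unfolding r_def rearrangement_def Inf_less_iff by auto
    have "emeasure M (A n) \<le> emeasure M {x \<in> space M. s < ennreal (norm (f x))}"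
      using s(1) by (intro emeasure_mono) (auto simp: A_def)
    then show ?thesis using s(2) by simp
  qed
  have inc: "incseq A"
  proof (rule incseq_SucI, rule subsetI)
    fix n x assume "x \<in> A n"
    then have x: "x \<in> space M" "r + ennreal (1 / real (Suc n)) < ennreal (norm (f x))" by (auto simp: A_def)
    have "r + ennreal (1 / real (Suc (Suc n))) \<le> r + ennreal (1 / real (Suc n))"
      by (intro add_left_mono ennreal_leI) (simp add: field_simps)
    from le_less_trans[OF this x(2)] show "x \<in> A (Suc n)" using x(1) unfolding A_def by blast
  qed
  have "{x \<in> space M. r < ennreal (norm (f x))} = (\<Union>n. A n)"
  proof safe
    fix x assume x: "x \<in> space M" "r < ennreal (norm (f x))"
    then have fin: "r < \<infinity>" using less_trans[OF x(2)] by simp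
    define \<rho> where "\<rho> = enn2real r"
    have \<rho>: "r = ennreal \<rho>" "0 \<le> \<rho>" using fin by (auto simp: \<rho>_def less_top)
    then have "\<rho> < norm (f x)" using x(2) by (simp add: ennreal_less_iff)
    then obtain n where "1 / real (Suc n) < norm (f x) - \<rho>" using nat_approx_posE[of "norm (f x) - \<rho>"] by auto
    then have "\<rho> + 1 / real (Suc n) < norm (f x)" by simp
    then have "r + ennreal (1 / real (Suc n)) < ennreal (norm (f x))"
      using \<rho> by (simp add: ennreal_less_iff flip: ennreal_plus)
    then show "x \<in> (\<Union>n. A n)" using x by (auto simp: A_def)
  next
    fix x n assume "x \<in> A n"
    then show "x \<in> space M" "r < ennreal (norm (f x))"
      by (auto simp: A_def intro: le_less_trans[rotated])
  qed
  moreover have "emeasure M (\<Union>n. A n) = (SUP n. emeasure M (A n))"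
    using A_sets inc by (intro SUP_emeasure_incseq[symmetric]) auto
  moreover have "(SUP n. emeasure M (A n)) \<le> ennreal t" by (intro SUP_least A_le)
  ultimately show ?thesis by (simp add: r_def)
qed

text \<open>On the torus, of total measure 1, this makes the level at \<open>t = 1\<close> vanish,
  so the dyadic slices start from height 0.\<close>

lemma rearrangement_eq_0:
  assumes "emeasure M (space M) \<le> ennreal t"
  shows "rearrangement M f t = 0"
proof -
  have "emeasure M {x \<in> space M. 0 < ennreal (norm (f x))} \<le> emeasure M (space M)"
    by (rule emeasure_space)
  then have "0 \<in> {s. emeasure M {x \<in> space M. s < ennreal (norm (f x))} \<le> ennreal t}"
    using assms by auto
  from Inf_lower[OF this] show ?thesis by (simp add: rearrangement_def)
qed

text \<open>Slicing at the levels \<open>f\<^sup>*(2\<^sup>-\<^sup>i)\<close>: the slice between consecutive levels has measure at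
  most \<open>2\<^sup>-\<^sup>i\<close>.\<close>
context
  fixes M :: "'a measure" and f :: "'a \<Rightarrow> 'x::real_normed_vector" and \<phi> :: "nat \<Rightarrow> real"
  assumes m: "(\<lambda>x. norm (f x)) \<in> borel_measurable M"
    and \<phi>: "\<And>i. rearrangement M f ((1 / 2) ^ i) = ennreal (\<phi> i)" and \<phi>0: "\<And>i. 0 \<le> \<phi> i"
begin

lemma slice_measure: "emeasure M {x \<in> space M. \<phi> i < norm (f x)} \<le> ennreal ((1 / 2) ^ i)"
  using emeasure_gt_rearrangement[OF m, of "(1 / 2) ^ i"] \<phi>0[of i]
  by (simp add: \<phi> ennreal_less_iff)

lemma nn_integral_slice:
  "(\<integral>\<^sup>+x. ennreal c * indicator {x \<in> space M. \<phi> i < norm (f x)} x \<partial>M) \<le> ennreal c * ennreal ((1 / 2) ^ i)"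
proof -
  have "{x \<in> space M. \<phi> i < norm (f x)} \<in> sets M" using m by measurable
  then show ?thesis using slice_measure[of i] by (simp add: nn_integral_cmult_indicator mult_left_mono)
qed

text \<open>Exceeding all levels means lying in sets of measure at most \<open>(1 / 2) ^ i\<close>
  for every \<open>i\<close>. The slices hence exhaust an unbounded function as well, up to a null
  set.\<close>

lemma AE_bounded_by_level: "AE x in M. \<exists>j. norm (f x) \<le> \<phi> j"
proof -
  let ?N = "{x \<in> space M. \<forall>j. \<phi> j < norm (f x)}"
  have s: "?N \<in> sets M" using m by measurable
  have "emeasure M ?N \<le> ennreal ((1 / 2) ^ i)" for i
  proof -
    have "{x \<in> space M. \<phi> i < norm (f x)} \<in> sets M" using m by measurable
    then have "emeasure M ?N \<le> emeasure M {x \<in> space M. \<phi> i < norm (f x)}"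
      by (intro emeasure_mono) auto
    then show ?thesis using slice_measure[of i] by simp
  qed
  moreover have "(\<lambda>i. ennreal ((1 / 2) ^ i)) \<longlonglongrightarrow> ennreal 0"
    by (intro tendsto_ennrealI LIMSEQ_power_zero) simp
  ultimately have "emeasure M ?N \<le> 0" using LIMSEQ_le_const[of _ "ennreal 0" "emeasure M ?N"] by auto
  then have "?N \<in> null_sets M" using s by auto
  then have "AE x in M. x \<notin> ?N" by (rule AE_not_in)
  then show ?thesis using AE_space by eventually_elim (auto simp: not_less)
qed

lemma first_level:
  assumes "\<not> y \<le> \<phi> k" "y \<le> \<phi> j" "k \<le> j"
  obtains i where "k \<le> i" "i < j" "\<phi> i < y" "y \<le> \<phi> (Suc i)"
proof -
  define l where "l = (LEAST l. k \<le> l \<and> y \<le> \<phi> l)"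
  have l: "k \<le> l" "y \<le> \<phi> l" "l \<le> j"
    using LeastI[of "\<lambda>l. k \<le> l \<and> y \<le> \<phi> l" j] Least_le[of "\<lambda>l. k \<le> l \<and> y \<le> \<phi> l" j] assms
    by (auto simp: l_def)
  have "l \<noteq> k" using l assms by auto
  then obtain i where i: "l = Suc i" "k \<le> i" using l(1) by (cases l) auto
  have "\<not> y \<le> \<phi> i" using not_less_Least[of i "\<lambda>l. k \<le> l \<and> y \<le> \<phi> l"] i by (auto simp: l_def[symmetric])
  then show ?thesis using that[of i] i l by auto
qed

text \<open>A point above level \<open>k\<close> lies almost surely in a slice
  \<open>\<phi> i < norm (f x) \<le> \<phi> (Suc i)\<close> with \<open>k \<le> i\<close>. The value
  is bounded by the top of the slice and the measure by its bottom, which explains the two different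
  indices.\<close>

lemma nn_integral_above_level:
  "(\<integral>\<^sup>+x. ennreal (norm (f x)) * indicator {x. \<phi> k < norm (f x)} x \<partial>M)
    \<le> (\<Sum>i. ennreal (\<phi> (Suc (i + k)) * (1 / 2) ^ (i + k)))"
proof -
  let ?S = "\<lambda>i. {x \<in> space M. \<phi> i < norm (f x)}"
  have s [measurable]: "?S i \<in> sets M" for i using m by measurable
  have "(\<integral>\<^sup>+x. ennreal (norm (f x)) * indicator {x. \<phi> k < norm (f x)} x \<partial>M)
     \<le> (\<integral>\<^sup>+x. (\<Sum>i. ennreal (\<phi> (Suc (i + k))) * indicator (?S (i + k)) x) \<partial>M)"
  proof (rule nn_integral_mono_AE, use AE_bounded_by_level AE_space in eventually_elim)
    case (elim x)
    show ?case
    proof (cases "\<phi> k < norm (f x)")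
      case True
      obtain j where j: "norm (f x) \<le> \<phi> j" using elim by auto
      have "k \<le> j \<or> j < k" by auto
      \<comment> \<open>A bounding level with index below \<open>k\<close> is excluded: the levels
        increase, and \<open>\<phi> k\<close> is already exceeded.\<close>
      obtain j' where j': "norm (f x) \<le> \<phi> j'" "k \<le> j'"
      proof (cases "k \<le> j")
        case False
        have "ennreal (\<phi> j) \<le> ennreal (\<phi> k)"
          using False rearrangement_antimono[of "(1/2) ^ k" "(1/2) ^ j" M f] by (auto simp: \<phi> power_decreasing)
        then have "\<phi> j \<le> \<phi> k" using \<phi>0 by simp
        then show ?thesis using j True by linarith
      qed (use j that in auto)
      obtain i where i: "k \<le> i" "\<phi> i < norm (f x)" "norm (f x) \<le> \<phi> (Suc i)"
        using first_level[OF _ j'] True by (auto simp: not_le)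
      have "ennreal (norm (f x)) \<le> ennreal (\<phi> (Suc (i - k + k))) * indicator (?S (i - k + k)) x"
        using i elim by (auto intro: ennreal_leI)
      also have "\<dots> \<le> (\<Sum>i. ennreal (\<phi> (Suc (i + k))) * indicator (?S (i + k)) x)"
        by (rule ennreal_le_suminf)
      finally show ?thesis using True by simp
    qed simp
  qed
  also have "\<dots> = (\<Sum>i. (\<integral>\<^sup>+x. ennreal (\<phi> (Suc (i + k))) * indicator (?S (i + k)) x \<partial>M))"
    by (rule nn_integral_suminf) measurable
  also have "\<dots> \<le> (\<Sum>i. ennreal (\<phi> (Suc (i + k)) * (1 / 2) ^ (i + k)))"
  proof (rule suminf_le)
    show "(\<integral>\<^sup>+x. ennreal (\<phi> (Suc (i + k))) * indicator (?S (i + k)) x \<partial>M)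
        \<le> ennreal (\<phi> (Suc (i + k)) * (1 / 2) ^ (i + k))" for i
      using nn_integral_slice[of "\<phi> (Suc (i + k))" "i + k"] \<phi>0 by (simp add: ennreal_mult)
  qed auto
  finally show ?thesis .
qed

text \<open>Because \<open>\<phi> 0 = 0\<close>, the finitely many slices below level
  \<open>k\<close> cover all points in question where \<open>f\<close> does not vanish.\<close>

lemma nn_integral_below_level:
  assumes p: "0 < p" and zero: "\<phi> 0 = 0"
  shows "(\<integral>\<^sup>+x. ennreal (norm (f x) powr p) * indicator {x. norm (f x) \<le> \<phi> k} x \<partial>M)
    \<le> ennreal (\<Sum>i<k. \<phi> (Suc i) powr p * (1 / 2) ^ i)"
proof -
  let ?S = "\<lambda>i. {x \<in> space M. \<phi> i < norm (f x)}"
  have s [measurable]: "?S i \<in> sets M" for i using m by measurable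
  have "(\<integral>\<^sup>+x. ennreal (norm (f x) powr p) * indicator {x. norm (f x) \<le> \<phi> k} x \<partial>M)
     \<le> (\<integral>\<^sup>+x. (\<Sum>i<k. ennreal (\<phi> (Suc i) powr p) * indicator (?S i) x) \<partial>M)"
  proof (rule nn_integral_mono)
    fix x assume x: "x \<in> space M"
    show "ennreal (norm (f x) powr p) * indicator {x. norm (f x) \<le> \<phi> k} x
       \<le> (\<Sum>i<k. ennreal (\<phi> (Suc i) powr p) * indicator (?S i) x)"
    proof (cases "norm (f x) \<le> \<phi> k \<and> f x \<noteq> 0")
      case True
      then have "\<not> norm (f x) \<le> \<phi> 0" using zero by simp
      then obtain i where i: "i < k" "\<phi> i < norm (f x)" "norm (f x) \<le> \<phi> (Suc i)"
        using first_level[of "norm (f x)" 0 k] True by auto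
      have "ennreal (norm (f x) powr p) \<le> ennreal (\<phi> (Suc i) powr p) * indicator (?S i) x"
        using i x p by (auto intro!: ennreal_leI powr_mono2)
      also have "\<dots> \<le> (\<Sum>i<k. ennreal (\<phi> (Suc i) powr p) * indicator (?S i) x)"
        using i(1) by (intro member_le_sum) auto
      finally show ?thesis using True by simp
    qed (use p in auto)
  qed
  also have "\<dots> = (\<Sum>i<k. (\<integral>\<^sup>+x. ennreal (\<phi> (Suc i) powr p) * indicator (?S i) x \<partial>M))"
    by (rule nn_integral_sum) measurable
  also have "\<dots> \<le> (\<Sum>i<k. ennreal (\<phi> (Suc i) powr p * (1 / 2) ^ i))"
    using nn_integral_slice by (intro sum_mono) (simp add: ennreal_mult)
  also have "\<dots> = ennreal (\<Sum>i<k. \<phi> (Suc i) powr p * (1 / 2) ^ i)"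
    by (rule sum_ennreal) simp
  finally show ?thesis .
qed

end

section \<open>Rearranged sequences\<close>

lemma seq_rearrangement_antimono: "k \<le> l \<Longrightarrow> seq_rearrangement x l \<le> seq_rearrangement x k"
  unfolding seq_rearrangement_def by (rule rearrangement_antimono) simp

text \<open>A uniform perturbation only shifts levels: where \<open>x\<close> exceeds
  \<open>A + s\<close>, \<open>z\<close> exceeds \<open>s\<close>. This separates the uniformly
  bounded part of the coefficients from the summable one.\<close>

lemma seq_rearrangement_le_plus:
  assumes A: "0 \<le> A" and le: "\<And>n. norm (x n) \<le> A + norm (z n)"
  shows "seq_rearrangement x k \<le> ennreal A + seq_rearrangement z k"
proof (rule ennreal_le_epsilon)
  fix e :: real assume e: "0 < e" and fin: "ennreal A + seq_rearrangement z k < top"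
  then have "seq_rearrangement z k < seq_rearrangement z k + ennreal e"
    by (simp add: ennreal_less_plus less_top)
  then obtain s where s: "s < seq_rearrangement z k + ennreal e"
     "emeasure (count_space UNIV) {n. s < ennreal (norm (z n))} \<le> ennreal (real k - 1)"
    unfolding seq_rearrangement_def rearrangement_def Inf_less_iff by auto
  have "{n. ennreal A + s < ennreal (norm (x n))} \<subseteq> {n. s < ennreal (norm (z n))}"
  proof safe
    fix n assume n: "ennreal A + s < ennreal (norm (x n))"
    also have "\<dots> \<le> ennreal A + ennreal (norm (z n))"
      using le[of n] A by (simp add: ennreal_leI flip: ennreal_plus)
    finally show "s < ennreal (norm (z n))" by (meson add_left_mono not_less)
  qed
  then have "emeasure (count_space UNIV) {n. ennreal A + s < ennreal (norm (x n))} \<le> ennreal (real k - 1)"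
    using s(2) emeasure_mono[of "{n. ennreal A + s < ennreal (norm (x n))}" "{n. s < ennreal (norm (z n))}" "count_space UNIV"]
    by (auto intro: order_trans)
  then have "seq_rearrangement x k \<le> ennreal A + s"
    unfolding seq_rearrangement_def rearrangement_def by (intro Inf_lower) simp
  also have "\<dots> \<le> ennreal A + seq_rearrangement z k + ennreal e"
    using s(1) by (simp add: add.assoc add_left_mono less_imp_le)
  finally show "seq_rearrangement x k \<le> ennreal A + seq_rearrangement z k + ennreal e" .
qed

lemma seq_rearrangement_bounded:
  assumes "\<And>n. norm (x n) \<le> A"
  shows "seq_rearrangement x k \<le> ennreal A"
  unfolding seq_rearrangement_def rearrangement_def
proof (rule Inf_lower, safe)
  have "{n. ennreal A < ennreal (norm (x n))} = {}"
    using assms by (auto simp: not_less intro: ennreal_leI)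
  then show "emeasure (count_space UNIV) {n \<in> space (count_space UNIV). ennreal A < ennreal (norm (x n))} \<le> ennreal (real k - 1)"
    by simp
qed

text \<open>Greedy choice of distinct indices whose norms exceed half of the rearranged values.\<close>
lemma sum_seq_rearrangement_le:
  assumes p: "0 < p" and z: "\<And>F. finite F \<Longrightarrow> (\<Sum>n\<in>F. norm (z n) powr p) \<le> D"
    and fin: "\<And>k. seq_rearrangement z k < \<infinity>"
  shows "(\<Sum>k=1..N. enn2real (seq_rearrangement z k) powr p) \<le> 2 powr p * D"
proof -
  define \<zeta> where "\<zeta> k = enn2real (seq_rearrangement z k)" for k
  have "\<exists>F. finite F \<and> card F \<le> N \<and> (\<Sum>k=1..N. (\<zeta> k / 2) powr p) \<le> (\<Sum>n\<in>F. norm (z n) powr p)"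
  proof (induction N)
    case 0
    then show ?case by auto
  next
    case (Suc N)
    then obtain F where F: "finite F" "card F \<le> N" "(\<Sum>k=1..N. (\<zeta> k / 2) powr p) \<le> (\<Sum>n\<in>F. norm (z n) powr p)"
      by auto
    show ?case
    proof (cases "\<zeta> (Suc N) = 0")
      case True
      then show ?thesis using F p by (intro exI[of _ F]) auto
    next
      case False
      then have pos: "0 < \<zeta> (Suc N)" unfolding \<zeta>_def using enn2real_nonneg less_le by metis
      have eq: "seq_rearrangement z (Suc N) = ennreal (\<zeta> (Suc N))"
        using fin[of "Suc N"] by (simp add: \<zeta>_def less_top)
      \<comment> \<open>Half of a positive value lies below the infimum, so more than
        \<open>N\<close> indices exceed it, one of them outside \<open>F\<close>. The offset
        \<open>k - 1\<close> in the definition is what yields \<open>N\<close> here.\<close>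
      have "\<not> emeasure (count_space UNIV) {n. ennreal (\<zeta> (Suc N) / 2) < ennreal (norm (z n))} \<le> ennreal (real (Suc N) - 1)"
      proof
        assume "emeasure (count_space UNIV) {n. ennreal (\<zeta> (Suc N) / 2) < ennreal (norm (z n))} \<le> ennreal (real (Suc N) - 1)"
        then have "seq_rearrangement z (Suc N) \<le> ennreal (\<zeta> (Suc N) / 2)"
          unfolding seq_rearrangement_def rearrangement_def by (intro Inf_lower) simp
        then show False using pos by (simp add: eq)
      qed
      then have not: "\<not> emeasure (count_space UNIV) {n. \<zeta> (Suc N) / 2 < norm (z n)} \<le> ennreal (real N)"
        using pos by (simp add: ennreal_less_iff)
      have "\<not> {n. \<zeta> (Suc N) / 2 < norm (z n)} \<subseteq> F"
      proof
        assume sub: "{n. \<zeta> (Suc N) / 2 < norm (z n)} \<subseteq> F"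
        then have "finite {n. \<zeta> (Suc N) / 2 < norm (z n)}" "card {n. \<zeta> (Suc N) / 2 < norm (z n)} \<le> N"
          using F card_mono[OF F(1) sub] finite_subset by auto
        then show False using not by (simp add: ennreal_of_nat_eq_real_of_nat)
      qed
      then obtain n where n: "n \<notin> F" "\<zeta> (Suc N) / 2 < norm (z n)" by auto
      have "(\<zeta> (Suc N) / 2) powr p \<le> norm (z n) powr p"
        using n pos p by (intro powr_mono2) auto
      then show ?thesis
        using F n by (intro exI[of _ "insert n F"]) (auto simp: card_insert_if)
    qed
  qed
  then obtain F where F: "finite F" "(\<Sum>k=1..N. (\<zeta> k / 2) powr p) \<le> (\<Sum>n\<in>F. norm (z n) powr p)" by auto
  have "(\<Sum>k=1..N. \<zeta> k powr p) = 2 powr p * (\<Sum>k=1..N. (\<zeta> k / 2) powr p)"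
    by (simp add: sum_distrib_left powr_divide \<zeta>_def)
  also have "\<dots> \<le> 2 powr p * D"
    using F z[OF F(1)] by (intro mult_left_mono) auto
  finally show ?thesis by (simp add: \<zeta>_def)
qed

section \<open>Dyadic description of the Lorentz norm\<close>

lemma ennpowr_mult_ennreal:
  assumes "0 < c" "0 < r"
  shows "ennpowr (ennreal c * x) r = ennreal (c powr r) * ennpowr x r"
proof (cases x)
  case (real y)
  then show ?thesis using assms by (simp add: ennpowr_ennreal powr_mult flip: ennreal_mult)
next
  case top
  then show ?thesis using assms by (simp add: ennpowr_def ennreal_mult_top)
qed

lemma dyadic_intervals_disjoint:
  assumes "t \<in> {(1/2::real) ^ Suc i<..<(1/2) ^ i}" "t \<in> {(1/2) ^ Suc j<..<(1/2) ^ j}"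
  shows "i = j"
proof (rule ccontr)
  have *: False if "i < j" "t \<in> {(1/2::real) ^ Suc i<..<(1/2) ^ i}" "t \<in> {(1/2) ^ Suc j<..<(1/2) ^ j}" for i j
  proof -
    have "(1/2::real) ^ j \<le> (1/2) ^ Suc i" using that(1) by (intro power_decreasing) auto
    then show False using that(2,3) by auto
  qed
  assume "i \<noteq> j"
  then show False using *[of i j] *[of j i] assms by (metis nat_neq_iff)
qed

lemma lorentz_norm_levels_infinite:
  assumes p: "0 < p"
  shows "ennreal ((1/2) powr (real i / p)) * rearrangement torus_measure f ((1/2) ^ i)
    \<le> lorentz_norm p \<infinity> (f :: real^'d::finite \<Rightarrow> 'x::real_normed_vector)"
proof (cases "i = 0")
  \<comment> \<open>The point \<open>t = 1\<close> lies outside the range of the supremum, but the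
    rearrangement vanishes there.\<close>
  case True
  then show ?thesis
    using rearrangement_eq_0[of "torus_measure :: (real^'d) measure" 1 f] emeasure_space_torus[where 'd='d] by simp
next
  case False
  have t: "(1/2::real) ^ i \<in> {0<..<1}" using False by (auto simp: power_less_one_iff)
  have "((1/2::real) ^ i) powr (1 / p) = (1/2) powr (real i / p)"
    by (simp add: powr_powr flip: powr_realpow)
  then show ?thesis
    unfolding lorentz_norm_def Let_def
    using SUP_upper[OF t, of "\<lambda>t. ennreal (t powr (1 / p)) * rearrangement torus_measure f t"] by simp
qed

text \<open>On a dyadic interval the integrand is bounded below by taking
  \<open>t powr (1 / p)\<close> at the left end and the rearrangement and \<open>1 / t\<close> at
  the right end. The first choice costs \<open>2 powr (r / p)\<close>; the factor 2 arises because
  the interval is half as long as its right end point.\<close>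

lemma lorentz_norm_levels_finite:
  fixes f :: "real^'d::finite \<Rightarrow> 'x::real_normed_vector"
  assumes p: "0 < p" and q: "q \<noteq> \<infinity>" "0 < enn2real q"
  defines "r \<equiv> enn2real q"
  shows "(\<Sum>i<N. ennpowr (ennreal ((1/2) powr (real i / p)) * rearrangement torus_measure f ((1/2) ^ i)) r)
    \<le> ennreal (2 * 2 powr (r / p)) * ennpowr (lorentz_norm p q f) r"
proof -
  have r: "0 < r" using q by (simp add: r_def)
  let ?F = "rearrangement torus_measure f"
  define a where "a i = ennpowr (ennreal ((1/2) powr (real i / p)) * ?F ((1/2) ^ i)) r" for i :: nat
  define J where "J i = {(1/2::real) ^ Suc i<..<(1/2) ^ i}" for i
  define X where "X = (\<integral>\<^sup>+t\<in>{0<..<1}. ennpowr (ennreal (t powr (1 / p)) * ?F t) r * ennreal (1 / t) \<partial>lborel)"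
  have X: "ennpowr (lorentz_norm p q f) r = X"
    using q(1) r by (simp add: lorentz_norm_def Let_def X_def r_def ennpowr_powr_inverse)
  define k where "k = (1/2::real) powr (r / p)"
  have k: "0 < k" by (simp add: k_def)
  have on_J: "ennreal k * a i * ennreal (2 ^ i) \<le> ennpowr (ennreal (t powr (1 / p)) * ?F t) r * ennreal (1 / t)"
    if t: "t \<in> J i" for i t
  proof -
    have t0: "0 < t" using t zero_less_power[of "1/2::real" "Suc i"] unfolding J_def by auto
    have "(1/2) powr (1 / p) * (1/2) powr (real i / p) = ((1/2::real) ^ Suc i) powr (1 / p)"
      unfolding powr_realpow[symmetric, OF half_gt_zero[OF zero_less_one]] powr_powr powr_add[symmetric]
      by (simp add: add_divide_distrib)
    also have "\<dots> \<le> t powr (1 / p)"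
      using t p unfolding J_def by (intro powr_mono2) auto
    finally have "ennreal ((1/2) powr (1 / p)) * (ennreal ((1/2) powr (real i / p)) * ?F ((1/2) ^ i))
        \<le> ennreal (t powr (1 / p)) * ?F t"
      using t unfolding mult.assoc[symmetric] J_def
      by (intro mult_mono rearrangement_antimono) (auto simp: ennreal_leI simp flip: ennreal_mult)
    then have "ennpowr (ennreal ((1/2) powr (1 / p)) * (ennreal ((1/2) powr (real i / p)) * ?F ((1/2) ^ i))) r
        \<le> ennpowr (ennreal (t powr (1 / p)) * ?F t) r"
      using r by (intro ennpowr_mono) auto
    then have "ennreal k * a i \<le> ennpowr (ennreal (t powr (1 / p)) * ?F t) r"
      using r by (simp add: ennpowr_mult_ennreal[of "(1/2) powr (1 / p)"] a_def k_def powr_powr)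
    moreover have "2 ^ i \<le> 1 / t"
      using t t0 by (auto simp: J_def field_simps power_one_over)
    ultimately show ?thesis by (intro mult_mono ennreal_leI) auto
  qed
  have "(\<Sum>i<N. ennreal k * a i * ennreal (2 ^ i) * emeasure lborel (J i))
     = (\<integral>\<^sup>+t. (\<Sum>i<N. ennreal k * a i * ennreal (2 ^ i) * indicator (J i) t) \<partial>lborel)"
    by (subst nn_integral_sum) (simp_all add: J_def nn_integral_cmult_indicator)
  also have "\<dots> \<le> X"
    unfolding X_def
  proof (rule nn_integral_mono)
    fix t :: real
    show "(\<Sum>i<N. ennreal k * a i * ennreal (2 ^ i) * indicator (J i) t)
       \<le> ennpowr (ennreal (t powr (1 / p)) * ?F t) r * ennreal (1 / t) * indicator {0<..<1} t"
    proof (cases "\<exists>i<N. t \<in> J i")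
      case True
      then obtain i where i: "i < N" "t \<in> J i" by auto
      have "(\<Sum>j<N. ennreal k * a j * ennreal (2 ^ j) * indicator (J j) t)
         = (\<Sum>j<N. if j = i then ennreal k * a i * ennreal (2 ^ i) else 0)"
        using i dyadic_intervals_disjoint[of t] by (intro sum.cong) (auto simp: J_def indicator_def)
      also have "\<dots> = ennreal k * a i * ennreal (2 ^ i)" using i by simp
      finally have "(\<Sum>j<N. ennreal k * a j * ennreal (2 ^ j) * indicator (J j) t) = ennreal k * a i * ennreal (2 ^ i)" .
      moreover have "t \<in> {0<..<1}"
      proof -
        have "0 < (1/2::real) ^ Suc i" "(1/2::real) ^ i \<le> 1" by (simp, simp add: power_le_one)
        then show ?thesis using i(2) unfolding J_def by auto
      qed
      ultimately show ?thesis using on_J[OF i(2)] by simp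
    next
      case False
      then have "(\<Sum>i<N. ennreal k * a i * ennreal (2 ^ i) * indicator (J i) t) = 0"
        by (intro sum.neutral) auto
      then show ?thesis by (simp only: zero_le)
    qed
  qed
  finally have le: "(\<Sum>i<N. ennreal k * a i * ennreal (2 ^ i) * emeasure lborel (J i)) \<le> X" .
  have "ennreal k * a i * ennreal (2 ^ i) * emeasure lborel (J i) = ennreal (k / 2) * a i" for i
  proof -
    have "emeasure lborel (J i) = ennreal ((1/2) ^ Suc i)"
      unfolding J_def by (subst emeasure_lborel_Ioo) (auto simp: power_Suc_le_self)
    moreover have "2 ^ i * (1/2::real) ^ Suc i = 1 / 2" by (simp add: power_one_over)
    ultimately have "ennreal (2 ^ i) * emeasure lborel (J i) = ennreal (1 / 2)"
      by (simp only: ennreal_mult[symmetric] zero_le_power zero_le_numeral zero_le_divide_1_iff)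
    then have "ennreal k * a i * ennreal (2 ^ i) * emeasure lborel (J i) = ennreal k * ennreal (1/2) * a i"
      by (simp only: mult_ac)
    moreover have "ennreal k * ennreal (1/2) = ennreal (k / 2)"
      by (subst ennreal_mult[symmetric]) (use k in auto)
    ultimately show ?thesis by simp
  qed
  then have "ennreal (k / 2) * (\<Sum>i<N. a i) \<le> X" using le by (simp add: sum_distrib_left)
  then have "ennreal (2 / k) * (ennreal (k / 2) * (\<Sum>i<N. a i)) \<le> ennreal (2 / k) * X"
    by (rule mult_left_mono) simp
  also have "ennreal (2 / k) * (ennreal (k / 2) * (\<Sum>i<N. a i)) = (\<Sum>i<N. a i)"
    using k by (simp add: mult.assoc[symmetric] flip: ennreal_mult)
  also have "2 / k = 2 * 2 powr (r / p)" by (simp add: k_def powr_divide)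
  finally show ?thesis unfolding X a_def .
qed

text \<open>A finite Lorentz norm makes every level finite, which moves the argument from
  \<open>ennreal\<close> to real sequences.\<close>

lemma lorentz_space_levels:
  fixes f :: "real^'d::finite \<Rightarrow> 'x::real_normed_vector"
  assumes p: "0 < p" and q: "0 < q" and f: "f \<in> lorentz_space p q"
  defines "L \<equiv> enn2real (lorentz_norm p q f)"
  obtains \<phi> where "\<And>i. rearrangement torus_measure f ((1/2) ^ i) = ennreal (\<phi> i)"
    "\<And>i. 0 \<le> \<phi> i" "\<phi> 0 = 0"
    "q = \<infinity> \<Longrightarrow> (\<And>i. (1/2) powr (real i / p) * \<phi> i \<le> L)"
    "q \<noteq> \<infinity> \<Longrightarrow> (\<And>N. (\<Sum>i<N. ((1/2) powr (real i / p) * \<phi> i) powr enn2real q) \<le> 2 * 2 powr (enn2real q / p) * L powr enn2real q)"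
proof -
  let ?F = "\<lambda>i. rearrangement torus_measure f ((1/2) ^ i)"
  define \<phi> where "\<phi> i = enn2real (?F i)" for i
  have L: "lorentz_norm p q f = ennreal L" "0 \<le> L"
    using f by (auto simp: lorentz_space_def L_def less_top)
  define h where "h i = (1/2::real) powr (real i / p)" for i
  have h: "0 < h i" for i by (simp add: h_def)
  have fin: "?F i < \<infinity>" for i
  proof (cases "q = \<infinity>")
    case True
    have "ennreal (h i) * ?F i \<le> ennreal L"
      using lorentz_norm_levels_infinite[OF p, of i f] L True by (simp add: h_def)
    then have "ennreal (h i) * ?F i < \<infinity>" by (auto intro: le_less_trans)
    then show ?thesis using h[of i] by (auto simp: ennreal_mult_less_top)
  next
    case False
    have q': "0 < enn2real q" using q False by (simp add: enn2real_positive_iff less_top)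
    have "ennpowr (ennreal (h i) * ?F i) (enn2real q) \<le> (\<Sum>i<Suc i. ennpowr (ennreal (h i) * ?F i) (enn2real q))"
      by simp
    also have "\<dots> \<le> ennreal (2 * 2 powr (enn2real q / p)) * ennpowr (ennreal L) (enn2real q)"
      using lorentz_norm_levels_finite[OF p False q', of f "Suc i"] unfolding h_def L(1) .
    also have "\<dots> < \<infinity>" using L(2) by (simp add: ennpowr_ennreal flip: ennreal_mult)
    finally have "ennreal (h i) * ?F i \<noteq> \<infinity>" by (auto simp: ennpowr_def)
    then show ?thesis using h[of i] by (auto simp: ennreal_mult_eq_top_iff less_top)
  qed
  have F: "?F i = ennreal (\<phi> i)" "0 \<le> \<phi> i" for i
    using fin[of i] by (auto simp: \<phi>_def less_top)
  have "?F 0 = 0"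
    using rearrangement_eq_0[of "torus_measure :: (real^'d) measure" 1 f] emeasure_space_torus[where 'd='d] by simp
  then have "\<phi> 0 = 0" by (simp add: \<phi>_def)
  moreover have "h i * \<phi> i \<le> L" if "q = \<infinity>" for i
  proof -
    have "ennreal (h i * \<phi> i) \<le> ennreal L"
      using lorentz_norm_levels_infinite[OF p, of i f] L(1) that h[of i] F[of i] by (simp add: h_def ennreal_mult)
    then show ?thesis using L(2) by simp
  qed
  moreover have "(\<Sum>i<N. (h i * \<phi> i) powr enn2real q) \<le> 2 * 2 powr (enn2real q / p) * L powr enn2real q"
    if "q \<noteq> \<infinity>" for N
  proof -
    have q': "0 < enn2real q" using q that by (simp add: enn2real_positive_iff less_top)
    have "ennpowr (ennreal (h i) * ?F i) (enn2real q) = ennreal ((h i * \<phi> i) powr enn2real q)" for i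
      using h[of i] F[of i] by (simp add: ennpowr_ennreal flip: ennreal_mult)
    then have "ennreal (\<Sum>i<N. (h i * \<phi> i) powr enn2real q) \<le> ennreal (2 * 2 powr (enn2real q / p) * L powr enn2real q)"
      using lorentz_norm_levels_finite[OF p that q', of f N] L
      by (simp add: h_def ennpowr_ennreal sum_ennreal ennreal_mult)
    then show ?thesis by (subst (asm) ennreal_le_iff) auto
  qed
  ultimately show ?thesis using that[of \<phi>] F unfolding h_def by blast
qed

section \<open>Splitting a function at a dyadic level\<close>

text \<open>The factor left over in
  \<open>(1/2) ^ j = (1/2) powr (real j / p) * decay p ^ j\<close>: if the weighted levels are
  bounded, the estimate for the L^1 norm above a level shrinks by this ratio from one level to the
  next.\<close>

definition decay :: "real \<Rightarrow> real" where
  "decay p = (1/2) powr (1 / conj_exp p)"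

lemma decay_bounds:
  assumes p: "1 < p"
  shows "0 < decay p" "decay p < 1"
proof -
  have "0 < 1 / conj_exp p" using conj_exp_props(1)[OF p] by simp
  from powr_less_mono2[OF this, of "1/2" 1] show "decay p < 1" by (simp add: decay_def)
qed (simp add: decay_def)

text \<open>Only a bound \<open>S\<close> for the weighted levels is assumed here, so the split
  serves all \<open>q\<close> at once; \<open>q\<close> enters later, through the sums of powers of
  the weighted levels.\<close>

context
  fixes f :: "real^'d::finite \<Rightarrow> 'x::complex_banach" and p K S :: real and \<phi> :: "nat \<Rightarrow> real"
  assumes p: "1 < p" and K: "0 \<le> K" "\<And>(g :: real^'d \<Rightarrow> 'x) \<Lambda>. strongly_measurable torus_measure g \<Longrightarrow>
       (\<And>x. x \<in> torus \<Longrightarrow> norm (g x) \<le> \<Lambda>) \<Longrightarrow> hausdorff_young K p g"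
    and f: "strongly_measurable torus_measure f"
    and \<phi>: "\<And>i. rearrangement torus_measure f ((1/2) ^ i) = ennreal (\<phi> i)" "\<And>i. 0 \<le> \<phi> i" "\<phi> 0 = 0"
    and S: "\<And>i. (1/2) powr (real i / p) * \<phi> i \<le> S"
begin

text \<open>Bounded weighted levels turn the series over the slices into a geometric series with
  ratio \<open>decay p\<close>. The factor 2 undoes the index shift between the top of a slice and
  its measure.\<close>

lemma nn_integral_upper_part:
  "(\<integral>\<^sup>+x. ennreal (norm (f x)) * indicator {x. \<phi> m < norm (f x)} x \<partial>torus_measure)
    \<le> ennreal (2 * decay p / (1 - decay p) * S * decay p ^ m)"
proof -
  have norm_f: "(\<lambda>x. norm (f x)) \<in> borel_measurable torus_measure"
    by (rule complete_measure.strongly_measurable_norm[OF complete_measure_torus f])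
  have S_nonneg: "0 \<le> S" using S[of 0] \<phi>(3) by simp
  have lev: "\<phi> j * (1/2) ^ j = ((1/2) powr (real j / p) * \<phi> j) * decay p ^ j" for j
  proof -
    have "decay p ^ j = (1/2) powr (real j / conj_exp p)"
      using decay_bounds[OF p] by (simp add: decay_def powr_powr flip: powr_realpow)
    moreover have "real j / p + real j / conj_exp p = real j"
    proof -
      have "real j / p + real j / conj_exp p = real j * (1 / p + 1 / conj_exp p)" by (simp add: distrib_left)
      then show ?thesis by (simp add: conj_exp_props(3)[OF p])
    qed
    ultimately have "(1/2) powr (real j / p) * decay p ^ j = (1/2) powr real j"
      by (simp flip: powr_add)
    then show ?thesis by (simp add: powr_realpow mult_ac)
  qed
  have term_le: "\<phi> (Suc (i + m)) * (1/2) ^ (i + m) \<le> (2 * S * decay p ^ Suc m) * decay p ^ i" for i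
  proof -
    have "\<phi> (Suc (i + m)) * (1/2) ^ (i + m) = 2 * (\<phi> (Suc (i + m)) * (1/2) ^ Suc (i + m))" by simp
    also have "\<dots> = 2 * (((1/2) powr (real (Suc (i + m)) / p) * \<phi> (Suc (i + m))) * decay p ^ Suc (i + m))"
      by (simp only: lev)
    also have "\<dots> \<le> 2 * (S * decay p ^ Suc (i + m))"
      using decay_bounds[OF p] by (intro mult_left_mono mult_right_mono S) auto
    also have "\<dots> = (2 * S * decay p ^ Suc m) * decay p ^ i" by (simp add: power_add)
    finally show ?thesis .
  qed
  have "(\<lambda>i. (2 * S * decay p ^ Suc m) * decay p ^ i) sums ((2 * S * decay p ^ Suc m) * (1 / (1 - decay p)))"
    using decay_bounds[OF p] by (intro sums_mult geometric_sums) simp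
  then have "(\<Sum>i. ennreal ((2 * S * decay p ^ Suc m) * decay p ^ i)) = ennreal ((2 * S * decay p ^ Suc m) * (1 / (1 - decay p)))"
    using decay_bounds[OF p] S_nonneg by (intro suminf_ennreal_eq) auto
  moreover have "(\<Sum>i. ennreal (\<phi> (Suc (i + m)) * (1/2) ^ (i + m))) \<le> (\<Sum>i. ennreal ((2 * S * decay p ^ Suc m) * decay p ^ i))"
    by (intro suminf_le ennreal_leI term_le) auto
  ultimately have "(\<Sum>i. ennreal (\<phi> (Suc (i + m)) * (1/2) ^ (i + m))) \<le> ennreal (2 * decay p / (1 - decay p) * S * decay p ^ m)"
    by (simp add: mult_ac)
  then show ?thesis
    using nn_integral_above_level[OF norm_f \<phi>(1,2), of m] by (rule order_trans[rotated])
qed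

lemma nn_integral_lower_part:
  "(\<integral>\<^sup>+x. ennreal (norm (f x) powr p) * indicator {x. norm (f x) \<le> \<phi> m} x \<partial>torus_measure)
    \<le> ennreal (2 * (\<Sum>i\<le>m. ((1/2) powr (real i / p) * \<phi> i) powr p))"
proof -
  have norm_f: "(\<lambda>x. norm (f x)) \<in> borel_measurable torus_measure"
    by (rule complete_measure.strongly_measurable_norm[OF complete_measure_torus f])
  have lev: "((1/2) powr (real j / p) * \<phi> j) powr p = (1/2) ^ j * \<phi> j powr p" for j
    using p \<phi>(2) by (simp add: powr_mult powr_powr powr_realpow)
  have "(\<Sum>i<m. \<phi> (Suc i) powr p * (1/2) ^ i) = 2 * (\<Sum>i<m. (1/2) ^ Suc i * \<phi> (Suc i) powr p)"
    by (simp add: sum_distrib_left mult_ac)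
  also have "\<dots> \<le> 2 * (\<Sum>i\<le>m. (1/2) ^ i * \<phi> i powr p)"
  proof -
    define G where "G i = (1/2) ^ i * \<phi> i powr p" for i
    have "(\<Sum>i\<le>m. G i) = G 0 + (\<Sum>i<m. G (Suc i))" by (rule sum.atMost_shift)
    moreover have "0 \<le> G 0" by (simp add: G_def)
    ultimately have "2 * (\<Sum>i<m. G (Suc i)) \<le> 2 * (\<Sum>i\<le>m. G i)" by linarith
    then show ?thesis unfolding G_def .
  qed
  finally have "(\<Sum>i<m. \<phi> (Suc i) powr p * (1/2) ^ i) \<le> 2 * (\<Sum>i\<le>m. ((1/2) powr (real i / p) * \<phi> i) powr p)"
    by (simp only: lev)
  then show ?thesis
    using nn_integral_below_level[OF norm_f \<phi>(1,2) _ \<phi>(3), of p m] p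
    by (auto intro: order_trans ennreal_leI)
qed

text \<open>Above the cut the L^1 norm bounds all coefficients uniformly, and the bounded remainder
  obeys the Hausdorff--Young inequality. The witness \<open>z\<close> is the rearrangement of the
  coefficients of the remainder, whence its monotonicity.\<close>

lemma fourier_coeff_rearrangement_split:
  shows "seq_rearrangement (fourier_coeff f) k < \<infinity>"
    and "\<exists>z. (\<forall>k. 0 \<le> z k \<and> enn2real (seq_rearrangement (fourier_coeff f) k) \<le> 2 * decay p / (1 - decay p) * S * decay p ^ m + z k) \<and>
      (\<forall>k l. k \<le> l \<longrightarrow> z l \<le> z k) \<and>
      (\<forall>N. (\<Sum>k=1..N. z k powr conj_exp p)
        \<le> 2 powr conj_exp p * (K * (2 * (\<Sum>i\<le>m. ((1/2) powr (real i / p) * \<phi> i) powr p)) powr (conj_exp p / p)))"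
proof -
  have [measurable]: "(\<lambda>x. norm (f x)) \<in> borel_measurable torus_measure"
    by (rule complete_measure.strongly_measurable_norm[OF complete_measure_torus f])
  have S_nonneg: "0 \<le> S" using S[of 0] \<phi>(3) by simp
  define U where "U m = {x \<in> torus. \<phi> m < norm (f x)}" for m
  have U: "U m \<in> sets torus_measure" for m
  proof -
    have "{x \<in> space torus_measure. \<phi> m < norm (f x)} \<in> sets torus_measure" by measurable
    then show ?thesis by (simp add: U_def)
  qed
  define h where "h m x = indicator (U m) x *\<^sub>R f x" for m x
  define A where "A m = 2 * decay p / (1 - decay p) * S * decay p ^ m" for m
  have A: "0 \<le> A m" for m using decay_bounds[OF p] S_nonneg by (simp add: A_def)
  have hm: "strongly_measurable torus_measure (h m)" for m
    unfolding h_def by (rule strongly_measurable_indicator_scaleR[OF f U])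
  have hi: "(\<integral>\<^sup>+x. norm (h m x) \<partial>torus_measure) \<le> ennreal (A m)" for m
  proof -
    have "(\<integral>\<^sup>+x. norm (h m x) \<partial>torus_measure)
       = (\<integral>\<^sup>+x. ennreal (norm (f x)) * indicator {x. \<phi> m < norm (f x)} x \<partial>torus_measure)"
      by (intro nn_integral_cong) (auto simp: h_def U_def indicator_def)
    then show ?thesis using nn_integral_upper_part[of m] by (simp add: A_def)
  qed
  have hfin: "(\<integral>\<^sup>+x. norm (h m x) \<partial>torus_measure) < \<infinity>" for m
    by (rule le_less_trans[OF hi]) simp
  have "(\<integral>\<^sup>+x. norm (f x) \<partial>torus_measure) = (\<integral>\<^sup>+x. norm (h 0 x) \<partial>torus_measure)"
    by (intro nn_integral_cong) (auto simp: h_def U_def indicator_def \<phi>(3))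
  \<comment> \<open>As \<open>\<phi> 0 = 0\<close>, a cut at level 0 leaves all of \<open>f\<close>
    above it, so the estimate for the upper part shows that \<open>f\<close> itself is
    integrable.\<close>
  then have fin: "(\<integral>\<^sup>+x. norm (f x) \<partial>torus_measure) < \<infinity>" "(\<integral>\<^sup>+x. norm (f x) \<partial>torus_measure) \<le> ennreal (A 0)"
    using hfin[of 0] hi[of 0] by simp_all
  have "norm (fourier_coeff f n) \<le> A 0" for n
    using order_trans[OF norm_fourier_coeff_le[OF f fin(1), of n] fin(2)] A[of 0] by simp
  from seq_rearrangement_bounded[of "fourier_coeff f", OF this]
  show "seq_rearrangement (fourier_coeff f) k < \<infinity>"
    by (rule le_less_trans) simp
  define g where "g x = f x - h m x" for x
  have gm: "strongly_measurable torus_measure g"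
    unfolding g_def by (rule strongly_measurable_diff[OF f hm])
  have g: "norm (g x) = norm (f x) * indicator {x. norm (f x) \<le> \<phi> m} x" if "x \<in> torus" for x
    using that by (auto simp: g_def h_def U_def indicator_def)
  have g_hy: "hausdorff_young K p g"
    by (rule K(2)[OF gm, of "\<phi> m"]) (use \<phi>(2) in \<open>auto simp: g indicator_def\<close>)
  have gfin: "(\<integral>\<^sup>+x. norm (g x) \<partial>torus_measure) < \<infinity>"
    by (rule le_less_trans[OF nn_integral_torus_bounded[of "\<lambda>x. norm (g x)" "\<phi> m"]])
       (use \<phi>(2) in \<open>auto simp: g indicator_def\<close>)
  define B where "B = 2 * (\<Sum>i\<le>m. ((1/2) powr (real i / p) * \<phi> i) powr p)"
  have B: "0 \<le> B" unfolding B_def by (intro mult_nonneg_nonneg sum_nonneg) auto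
  have "(\<integral>\<^sup>+x. ennreal (norm (g x) powr p) \<partial>torus_measure)
      = (\<integral>\<^sup>+x. ennreal (norm (f x) powr p) * indicator {x. norm (f x) \<le> \<phi> m} x \<partial>torus_measure)"
    using p by (intro nn_integral_cong) (auto simp: g indicator_def)
  then have gB: "(\<integral>\<^sup>+x. ennreal (norm (g x) powr p) \<partial>torus_measure) \<le> ennreal B"
    using nn_integral_lower_part[of m] by (simp add: B_def)
  have sum_le: "(\<Sum>n\<in>F. norm (fourier_coeff g n) powr conj_exp p) \<le> K * B powr (conj_exp p / p)" if "finite F" for F
    using g_hy that B gB unfolding hausdorff_young_def by blast
  have gz: "seq_rearrangement (fourier_coeff g) k < \<infinity>" for k
  proof -
    obtain c where "(\<integral>\<^sup>+x. norm (g x) \<partial>torus_measure) = ennreal c" "0 \<le> c"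
      using gfin by (cases "(\<integral>\<^sup>+x. norm (g x) \<partial>torus_measure)") auto
    then have "norm (fourier_coeff g n) \<le> c" for n
      using norm_fourier_coeff_le[OF gm gfin, of n] by simp
    from seq_rearrangement_bounded[of "fourier_coeff g", OF this] show ?thesis
      by (rule le_less_trans) simp
  qed
  have split: "norm (fourier_coeff f n) \<le> A m + norm (fourier_coeff g n)" for n
  proof -
    have "norm (fourier_coeff (h m) n) \<le> A m"
      using order_trans[OF norm_fourier_coeff_le[OF hm hfin] hi] A by simp
    moreover have "fourier_coeff g n = fourier_coeff f n - fourier_coeff (h m) n"
      using fourier_coeff_diff[OF f fin(1) hm hfin] by (simp add: g_def[abs_def])
    ultimately show ?thesis
      using norm_triangle_ineq[of "fourier_coeff g n" "fourier_coeff (h m) n"] by simp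
  qed
  define z where "z k = enn2real (seq_rearrangement (fourier_coeff g) k)" for k
  have z: "seq_rearrangement (fourier_coeff g) k = ennreal (z k)" for k
    using gz[of k] by (simp add: z_def less_top)
  show "\<exists>z. (\<forall>k. 0 \<le> z k \<and> enn2real (seq_rearrangement (fourier_coeff f) k) \<le> 2 * decay p / (1 - decay p) * S * decay p ^ m + z k) \<and>
      (\<forall>k l. k \<le> l \<longrightarrow> z l \<le> z k) \<and>
      (\<forall>N. (\<Sum>k=1..N. z k powr conj_exp p)
        \<le> 2 powr conj_exp p * (K * (2 * (\<Sum>i\<le>m. ((1/2) powr (real i / p) * \<phi> i) powr p)) powr (conj_exp p / p)))"
  proof (intro exI[of _ z] conjI allI impI)
    fix k
    show z0: "0 \<le> z k" by (simp add: z_def)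
    have "seq_rearrangement (fourier_coeff f) k \<le> ennreal (A m) + ennreal (z k)"
      using seq_rearrangement_le_plus[of "A m" "fourier_coeff f" "fourier_coeff g" k, OF A split] unfolding z .
    also have "\<dots> = ennreal (A m + z k)" using A z0 by simp
    finally have "enn2real (seq_rearrangement (fourier_coeff f) k) \<le> enn2real (ennreal (A m + z k))"
      by (rule enn2real_mono) simp
    also have "\<dots> = A m + z k"
      by (rule enn2real_ennreal) (use A[of m] z0 in simp)
    finally show "enn2real (seq_rearrangement (fourier_coeff f) k) \<le> 2 * decay p / (1 - decay p) * S * decay p ^ m + z k"
      unfolding A_def .
  next
    fix k l :: nat assume "k \<le> l"
    from seq_rearrangement_antimono[OF this, of "fourier_coeff g"] show "z l \<le> z k"
      unfolding z by (simp add: z_def)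
  next
    fix N
    have "0 < conj_exp p" using conj_exp_props[OF p] by simp
    from sum_seq_rearrangement_le[OF this sum_le gz, of N]
    show "(\<Sum>k=1..N. z k powr conj_exp p)
        \<le> 2 powr conj_exp p * (K * (2 * (\<Sum>i\<le>m. ((1/2) powr (real i / p) * \<phi> i) powr p)) powr (conj_exp p / p))"
      unfolding z_def B_def .
  qed
qed

end

section \<open>Inequalities for real sequences\<close>

text \<open>The graph of \<open>y powr r\<close> lies above its tangent at \<mu>; this is Young's
  inequality with exponents \<open>r\<close> and \<open>r / (r - 1)\<close>.\<close>

lemma powr_tangent:
  fixes y \<mu> r :: real
  assumes r: "1 < r" and y: "0 \<le> y" and \<mu>: "0 \<le> \<mu>"
  shows "r * (\<mu> powr (r - 1) * y) \<le> y powr r + (r - 1) * \<mu> powr r"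
proof -
  have "y * \<mu> powr (r - 1) \<le> y powr r / r + (\<mu> powr (r - 1)) powr (r / (r - 1)) / (r / (r - 1))"
    using r y by (intro Youngs_inequality) (auto simp: field_simps)
  also have "(\<mu> powr (r - 1)) powr (r / (r - 1)) = \<mu> powr r"
    using r by (simp add: powr_powr)
  finally have "r * (y * \<mu> powr (r - 1)) \<le> r * (y powr r / r + \<mu> powr r / (r / (r - 1)))"
    using r by (intro mult_left_mono) auto
  also have "\<dots> = y powr r + (r - 1) * \<mu> powr r" using r by (simp add: field_simps)
  finally show ?thesis by (simp add: mult.commute)
qed

text \<open>Jensen's inequality for weights that need not sum to 1: the tangent inequalities at the
  weighted mean \<mu> are added up. With weights 1 and \<open>1 / k\<close> it serves as Hoelder's
  inequality later.\<close>

lemma weighted_power_mean: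
  fixes w y :: "'i \<Rightarrow> real"
  assumes r: "1 < r" and w: "\<And>i. i \<in> I \<Longrightarrow> 0 \<le> w i" and y: "\<And>i. i \<in> I \<Longrightarrow> 0 \<le> y i"
  shows "(\<Sum>i\<in>I. w i * y i) powr r \<le> (\<Sum>i\<in>I. w i) powr (r - 1) * (\<Sum>i\<in>I. w i * y i powr r)"
proof -
  define W where "W = (\<Sum>i\<in>I. w i)"
  define P where "P = (\<Sum>i\<in>I. w i * y i)"
  define T where "T = (\<Sum>i\<in>I. w i * y i powr r)"
  have nn: "0 \<le> W" "0 \<le> P" "0 \<le> T" unfolding W_def P_def T_def using w y by (auto intro!: sum_nonneg)
  show ?thesis
  proof (cases "W = 0 \<or> P = 0")
    case True
    have "P = 0"
    proof (cases "finite I")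
      case False
      then show ?thesis by (simp add: P_def)
    next
      case fin: True
      show ?thesis
      proof (cases "W = 0")
        case True
        then have "\<forall>i\<in>I. w i = 0" using fin w by (simp add: W_def sum_nonneg_eq_0_iff)
        then show ?thesis by (simp add: P_def)
      qed (use True in auto)
    qed
    then have "P powr r = 0" by simp
    then show ?thesis using nn by (simp add: P_def W_def T_def)
  next
    case False
    then have pos: "0 < W" "0 < P" using nn by auto
    define \<mu> where "\<mu> = P / W"
    have \<mu>: "0 < \<mu>" using pos by (simp add: \<mu>_def)
    have "(\<Sum>i\<in>I. w i * (r * (\<mu> powr (r - 1) * y i))) \<le> (\<Sum>i\<in>I. w i * (y i powr r + (r - 1) * \<mu> powr r))"
      using w y r \<mu> by (intro sum_mono mult_left_mono powr_tangent) auto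
    moreover have "(\<Sum>i\<in>I. w i * (r * (\<mu> powr (r - 1) * y i))) = r * \<mu> powr (r - 1) * P"
      by (simp add: P_def sum_distrib_left mult_ac)
    moreover have "(\<Sum>i\<in>I. w i * (y i powr r + (r - 1) * \<mu> powr r)) = T + W * ((r - 1) * \<mu> powr r)"
      by (simp add: T_def W_def distrib_left sum.distrib sum_distrib_right)
    moreover have "r * \<mu> powr (r - 1) * P = r * (\<mu> powr r * W)"
      using \<mu> pos by (simp add: powr_diff \<mu>_def)
    moreover have "W * ((r - 1) * \<mu> powr r) = (r - 1) * (\<mu> powr r * W)" by (simp only: mult_ac)
    ultimately have "r * (\<mu> powr r * W) \<le> T + (r - 1) * (\<mu> powr r * W)" by linarith
    then have "\<mu> powr r * W \<le> T" by (simp add: algebra_simps)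
    then have "W powr (r - 1) * (\<mu> powr r * W) \<le> W powr (r - 1) * T"
      by (rule mult_left_mono) simp
    moreover have "W powr (r - 1) * (\<mu> powr r * W) = P powr r"
      using pos by (simp add: \<mu>_def powr_divide powr_diff)
    ultimately show ?thesis by (simp add: P_def W_def T_def)
  qed
qed

lemma sum_inverse_sqrt_le: "(\<Sum>i\<le>n. 1 / sqrt (real i + 1)) \<le> 2 * sqrt (real n + 1)"
proof (induction n)
  case (Suc n)
  define u v where "u = sqrt (real n + 1)" and "v = sqrt (real n + 2)"
  have uv: "0 < u" "u \<le> v" "0 < v" "v\<^sup>2 - u\<^sup>2 = 1" by (auto simp: u_def v_def)
  have "1 = (v - u) * (v + u)" using uv(4) by (simp add: power2_eq_square algebra_simps)
  also have "\<dots> \<le> (v - u) * (2 * v)" using uv by (intro mult_left_mono) auto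
  finally have "1 / v \<le> 2 * v - 2 * u" using uv by (simp add: field_simps)
  then show ?case using Suc by (simp add: u_def v_def add.commute)
qed simp

text \<open>Hardy's inequality along the indices \<open>M * 2 ^ j\<close>. Jensen's inequality with
  weights \<open>1 / sqrt (i + 1)\<close>, whose partial sums are of order \<open>sqrt n\<close>,
  spends only half of the decay \<open>2 powr (j * (1 - r))\<close>. The other half,
  \<open>\<theta> ^ j\<close>, makes the sum over \<open>j\<close> converge once the order of
  summation is exchanged.\<close>

lemma dyadic_hardy:
  fixes \<beta> :: "nat \<Rightarrow> real"
  assumes r: "1 < r" and M: "1 \<le> (M::nat)" and \<beta>: "\<And>i. 0 \<le> \<beta> i"
    and T: "\<And>N. (\<Sum>i<N. \<beta> i powr r) \<le> T"
  defines "\<sigma> \<equiv> (r - 1) / 2"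
  shows "(\<Sum>j\<le>J. 2 powr (real j * (1 - r)) * (\<Sum>i\<le>M * 2 ^ j. \<beta> i) powr r)
     \<le> (8 * real M) powr \<sigma> * ((2 * real M) powr \<sigma> / (1 - 2 powr (- \<sigma>))) * T"
proof -
  have \<sigma>: "0 < \<sigma>" using r by (simp add: \<sigma>_def)
  define \<theta> where "\<theta> = 2 powr (- \<sigma>)"
  have \<theta>: "0 < \<theta>" "\<theta> < 1"
    using \<sigma> powr_less_mono[of "- \<sigma>" 0 2] by (auto simp: \<theta>_def)
  have \<theta>_pow: "\<theta> ^ j = 2 powr (- (real j * \<sigma>))" for j
    using \<theta>(1) by (simp add: \<theta>_def powr_powr mult.commute flip: powr_realpow)
  define v where "v i = (real i + 1) powr \<sigma> * \<beta> i powr r" for i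
  have v: "0 \<le> v i" for i by (simp add: v_def)
  have step: "2 powr (real j * (1 - r)) * (\<Sum>i\<le>M * 2 ^ j. \<beta> i) powr r
     \<le> (8 * real M) powr \<sigma> * (\<theta> ^ j * (\<Sum>i\<le>M * 2 ^ j. v i))" for j
  proof -
    define n where "n = M * 2 ^ j"
    have n: "real n + 1 \<le> 2 * real M * 2 ^ j" "0 < real n + 1"
    proof -
      have "1 * 1 \<le> M * 2 ^ j" using M by (intro mult_le_mono) auto
      then have "n + 1 \<le> 2 * M * 2 ^ j" by (simp add: n_def)
      then have "real (n + 1) \<le> real (2 * M * 2 ^ j)" by (rule of_nat_mono)
      then show "real n + 1 \<le> 2 * real M * 2 ^ j" by simp
    qed simp
    have "(\<Sum>i\<le>n. \<beta> i) = (\<Sum>i\<le>n. (1 / sqrt (real i + 1)) * (sqrt (real i + 1) * \<beta> i))"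
      by (intro sum.cong refl) (simp add: add_nonneg_eq_0_iff)
    then have "(\<Sum>i\<le>n. \<beta> i) powr r
        \<le> (\<Sum>i\<le>n. 1 / sqrt (real i + 1)) powr (r - 1) * (\<Sum>i\<le>n. (1 / sqrt (real i + 1)) * (sqrt (real i + 1) * \<beta> i) powr r)"
      using weighted_power_mean[OF r, of "{..n}" "\<lambda>i. 1 / sqrt (real i + 1)" "\<lambda>i. sqrt (real i + 1) * \<beta> i"] \<beta> by simp
    also have "(\<Sum>i\<le>n. (1 / sqrt (real i + 1)) * (sqrt (real i + 1) * \<beta> i) powr r) = (\<Sum>i\<le>n. v i)"
    proof (intro sum.cong refl)
      fix i
      have "1 / sqrt (real i + 1) = (real i + 1) powr (- (1 / 2))"
        by (simp add: powr_minus_divide powr_half_sqrt)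
      moreover have "sqrt (real i + 1) powr r = (real i + 1) powr (r / 2)"
        by (simp add: powr_half_sqrt[symmetric] powr_powr)
      moreover have "(real i + 1) powr (- (1 / 2)) * (real i + 1) powr (r / 2) = (real i + 1) powr \<sigma>"
        by (simp add: \<sigma>_def diff_divide_distrib flip: powr_add)
      ultimately have "(1 / sqrt (real i + 1)) * (sqrt (real i + 1)) powr r = (real i + 1) powr \<sigma>"
        by (simp only:)
      moreover have "(1 / sqrt (real i + 1)) * (sqrt (real i + 1) * \<beta> i) powr r
          = ((1 / sqrt (real i + 1)) * sqrt (real i + 1) powr r) * \<beta> i powr r"
        using \<beta>[of i] by (simp add: powr_mult)
      ultimately show "(1 / sqrt (real i + 1)) * (sqrt (real i + 1) * \<beta> i) powr r = v i"
        by (simp only: v_def)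
    qed
    also have "(\<Sum>i\<le>n. 1 / sqrt (real i + 1)) powr (r - 1) \<le> (8 * real M * 2 ^ j) powr \<sigma>"
    proof -
      have "(\<Sum>i\<le>n. 1 / sqrt (real i + 1)) powr (r - 1) \<le> (2 * sqrt (real n + 1)) powr (r - 1)"
        using r sum_inverse_sqrt_le[of n] by (intro powr_mono2 sum_nonneg) auto
      also have "2 * sqrt (real n + 1) = (4 * (real n + 1)) powr (1/2)"
      proof -
        have "2 * sqrt (real n + 1) = sqrt (4 * (real n + 1))"
          by (simp only: real_sqrt_mult real_sqrt_four)
        then show ?thesis using n by (simp add: powr_half_sqrt)
      qed
      also have "\<dots> powr (r - 1) = (4 * (real n + 1)) powr \<sigma>" by (simp add: powr_powr \<sigma>_def)
      also have "\<dots> \<le> (8 * real M * 2 ^ j) powr \<sigma>" using n \<sigma> by (intro powr_mono2) auto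
      finally show ?thesis .
    qed
    finally have "(\<Sum>i\<le>n. \<beta> i) powr r \<le> (8 * real M * 2 ^ j) powr \<sigma> * (\<Sum>i\<le>n. v i)"
      using v by (simp add: mult_right_mono sum_nonneg)
    also have "(8 * real M * 2 ^ j) powr \<sigma> = (8 * real M) powr \<sigma> * 2 powr (real j * \<sigma>)"
      by (simp add: powr_mult powr_powr flip: powr_realpow)
    finally have "2 powr (real j * (1 - r)) * (\<Sum>i\<le>n. \<beta> i) powr r
       \<le> 2 powr (real j * (1 - r)) * ((8 * real M) powr \<sigma> * 2 powr (real j * \<sigma>) * (\<Sum>i\<le>n. v i))"
      by (rule mult_left_mono) simp
    also have "\<dots> = (8 * real M) powr \<sigma> * ((2 powr (real j * (1 - r)) * 2 powr (real j * \<sigma>)) * (\<Sum>i\<le>n. v i))"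
      by (simp only: mult_ac)
    also have "2 powr (real j * (1 - r)) * 2 powr (real j * \<sigma>) = \<theta> ^ j"
    proof -
      have "real j * (1 - r) + real j * \<sigma> = - (real j * \<sigma>)" by (simp add: \<sigma>_def field_simps)
      then show ?thesis by (simp only: \<theta>_pow powr_add[symmetric])
    qed
    finally show ?thesis by (simp add: n_def)
  qed
  \<comment> \<open>The sum over \<open>j\<close> starts at the first \<open>j0\<close> with
    \<open>i \<le> M * 2 ^ j0\<close>. There \<open>i + 1 \<le> 2 * M * 2 ^ j0\<close>, so
    \<open>\<theta> ^ j0\<close> cancels the growth of \<open>(i + 1) powr \<sigma>\<close>.\<close>
  have tail: "(real i + 1) powr \<sigma> * (\<Sum>j\<in>{j. j \<le> J \<and> i \<le> M * 2 ^ j}. \<theta> ^ j) \<le> (2 * real M) powr \<sigma> / (1 - \<theta>)" for i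
  proof (cases "\<exists>j\<le>J. i \<le> M * 2 ^ j")
    case False
    then have "{j. j \<le> J \<and> i \<le> M * 2 ^ j} = {}" by auto
    then show ?thesis unfolding \<open>{j. j \<le> J \<and> i \<le> M * 2 ^ j} = {}\<close> using \<theta> by simp
  next
    case True
    define j0 where "j0 = (LEAST j. i \<le> M * 2 ^ j)"
    have j0: "i \<le> M * 2 ^ j0" "\<And>j. i \<le> M * 2 ^ j \<Longrightarrow> j0 \<le> j"
      unfolding j0_def using True by (auto intro: LeastI Least_le)
    have "(\<Sum>j\<in>{j. j \<le> J \<and> i \<le> M * 2 ^ j}. \<theta> ^ j) \<le> (\<Sum>j=j0..J. \<theta> ^ j)"
      using j0(2) \<theta> by (intro sum_mono2) auto
    also have "\<dots> \<le> (\<Sum>j=j0..j0+J. \<theta> ^ j)" using \<theta> by (intro sum_mono2) auto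
    also have "\<dots> = \<theta> ^ j0 * (\<Sum>j\<le>J. \<theta> ^ j)"
      using sum.shift_bounds_cl_nat_ivl[of "\<lambda>j. \<theta> ^ j" 0 j0 J]
      by (simp add: sum_distrib_left power_add atMost_atLeast0 add.commute mult.commute)
    also have "(\<Sum>j\<le>J. \<theta> ^ j) \<le> 1 / (1 - \<theta>)"
      using \<theta> sum_le_suminf[of "\<lambda>j. \<theta> ^ j" "{..J}"] by (simp add: suminf_geometric summable_geometric)
    finally have "(\<Sum>j\<in>{j. j \<le> J \<and> i \<le> M * 2 ^ j}. \<theta> ^ j) \<le> \<theta> ^ j0 * (1 / (1 - \<theta>))"
      using \<theta> by simp
    then have "(real i + 1) powr \<sigma> * (\<Sum>j\<in>{j. j \<le> J \<and> i \<le> M * 2 ^ j}. \<theta> ^ j)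
       \<le> (2 * real M * 2 ^ j0) powr \<sigma> * (\<theta> ^ j0 * (1 / (1 - \<theta>)))"
    proof (intro mult_mono powr_mono2)
      have "1 * 1 \<le> M * 2 ^ j0" using M by (intro mult_le_mono) auto
      then have "i + 1 \<le> M * 2 ^ j0 + M * 2 ^ j0" using j0(1) by linarith
      then have "i + 1 \<le> 2 * M * 2 ^ j0" by simp
      then have "real (i + 1) \<le> real (2 * M * 2 ^ j0)" by (rule of_nat_mono)
      then show "real i + 1 \<le> 2 * real M * 2 ^ j0" by simp
    qed (use \<sigma> \<theta> in \<open>auto intro: sum_nonneg\<close>)
    also have "(2 * real M * 2 ^ j0) powr \<sigma> = (2 * real M) powr \<sigma> * 2 powr (real j0 * \<sigma>)"
      by (simp add: powr_mult powr_powr flip: powr_realpow)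
    also have "(2 * real M) powr \<sigma> * 2 powr (real j0 * \<sigma>) * (\<theta> ^ j0 * (1 / (1 - \<theta>))) = (2 * real M) powr \<sigma> / (1 - \<theta>)"
      by (simp add: \<theta>_pow powr_minus)
    finally show ?thesis .
  qed
  have "(\<Sum>j\<le>J. 2 powr (real j * (1 - r)) * (\<Sum>i\<le>M * 2 ^ j. \<beta> i) powr r)
     \<le> (\<Sum>j\<le>J. (8 * real M) powr \<sigma> * (\<theta> ^ j * (\<Sum>i\<le>M * 2 ^ j. v i)))"
    by (intro sum_mono step)
  also have "\<dots> = (8 * real M) powr \<sigma> * (\<Sum>j\<le>J. \<Sum>i\<in>{i. i \<le> M * 2 ^ J \<and> i \<le> M * 2 ^ j}. \<theta> ^ j * v i)"
    unfolding sum_distrib_left[symmetric]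
  proof (intro arg_cong[where f="\<lambda>x. (8 * real M) powr \<sigma> * x"] sum.cong refl)
    fix j assume "j \<in> {..J}"
    then have "M * 2 ^ j \<le> M * 2 ^ J" by (intro mult_le_mono power_increasing) auto
    then have "i \<le> M * 2 ^ J \<and> i \<le> M * 2 ^ j \<longleftrightarrow> i \<le> M * 2 ^ j" for i by linarith
    then have "{i. i \<le> M * 2 ^ J \<and> i \<le> M * 2 ^ j} = {..M * 2 ^ j}" by auto
    then show "\<theta> ^ j * (\<Sum>i\<le>M * 2 ^ j. v i) = \<theta> ^ j * sum v {i. i \<le> M * 2 ^ J \<and> i \<le> M * 2 ^ j}" by simp
  qed
  also have "(\<Sum>j\<le>J. \<Sum>i\<in>{i. i \<le> M * 2 ^ J \<and> i \<le> M * 2 ^ j}. \<theta> ^ j * v i)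
      = (\<Sum>i\<le>M * 2 ^ J. \<Sum>j\<in>{j. j \<le> J \<and> i \<le> M * 2 ^ j}. \<theta> ^ j * v i)"
    using sum.swap_restrict[of "{..J}" "{..M * 2 ^ J}" "\<lambda>j i. \<theta> ^ j * v i" "\<lambda>j i. i \<le> M * 2 ^ j"] by simp
  also have "\<dots> = (\<Sum>i\<le>M * 2 ^ J. ((real i + 1) powr \<sigma> * (\<Sum>j\<in>{j. j \<le> J \<and> i \<le> M * 2 ^ j}. \<theta> ^ j)) * \<beta> i powr r)"
    by (intro sum.cong refl) (simp add: v_def sum_distrib_left sum_distrib_right mult_ac)
  also have "\<dots> \<le> (\<Sum>i\<le>M * 2 ^ J. ((2 * real M) powr \<sigma> / (1 - \<theta>)) * \<beta> i powr r)"
    by (intro sum_mono mult_right_mono tail) simp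
  also have "\<dots> = ((2 * real M) powr \<sigma> / (1 - \<theta>)) * (\<Sum>i\<le>M * 2 ^ J. \<beta> i powr r)"
    by (rule sum_distrib_left[symmetric])
  also have "\<dots> \<le> ((2 * real M) powr \<sigma> / (1 - \<theta>)) * T"
    using T[of "Suc (M * 2 ^ J)"] \<theta> by (intro mult_left_mono) (auto simp: lessThan_Suc_atMost)
  finally show ?thesis by (simp add: \<theta>_def mult.assoc mult_left_mono)
qed

text \<open>Each dyadic block contributes at most 1. With \<open>2 ^ 2 ^ j\<close> terms the
  harmonic sum is thus only of order \<open>2 ^ j\<close>.\<close>

lemma harmonic_sum_le: "(\<Sum>k=1..2 ^ n. 1 / real k) \<le> real n + 1"
proof (induction n)
  case (Suc n)
  have "(\<Sum>k=1..2 ^ Suc n. 1 / real k) = (\<Sum>k=1..2 ^ n. 1 / real k) + (\<Sum>k=2 ^ n + 1..2 ^ Suc n. 1 / real k)"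
    by (rule sum.ub_add_nat[of 1 "2 ^ n" _ "2 ^ n", folded mult_2, folded power_Suc]) simp
  also have "(\<Sum>k=2 ^ n + 1..2 ^ Suc n. 1 / real k) \<le> (\<Sum>k::nat=2 ^ n + 1..2 ^ Suc n. 1 / 2 ^ n)"
  proof (intro sum_mono divide_left_mono)
    fix k :: nat assume "k \<in> {2 ^ n + 1..2 ^ Suc n}"
    then have "2 ^ n \<le> k" "0 < k" by auto
    then show "2 ^ n \<le> real k" "0 < real k * 2 ^ n" using of_nat_mono[of "2 ^ n" k, where 'a=real] by simp_all
  qed simp
  also have "\<dots> = 1" by simp
  finally show ?case using Suc by simp
qed simp

text \<open>For \<open>q \<ge> p'\<close> monotonicity gives \<open>k * z k powr p' \<le> G\<close>,
  which absorbs the surplus powers at no cost. For \<open>q < p'\<close> Hoelder's inequality with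
  weights \<open>1 / k\<close> loses a power of the harmonic sum. This dichotomy is the origin of
  the maximum of \<open>p'\<close> and \<open>q\<close> in the logarithmic exponent.\<close>

lemma decreasing_block_sum_le:
  fixes z :: "nat \<Rightarrow> real"
  assumes p': "0 < p'" and q: "0 < q" and z: "\<And>k. 0 \<le> z k" "\<And>k l. k \<le> l \<Longrightarrow> z l \<le> z k"
    and G: "\<And>N. (\<Sum>k=1..N. z k powr p') \<le> G"
  defines "s \<equiv> q / p'"
  shows "(\<Sum>k=1..2 ^ 2 ^ j. real k powr (s - 1) * z k powr q) \<le> 2 * (2 powr (real j * max 0 (1 - s)) * G powr s)"
proof -
  have s: "0 < s" "p' * s = q" using p' q by (auto simp: s_def)
  have G0: "0 \<le> G" using G[of 0] by simp
  have kz: "real k * z k powr p' \<le> G" if "1 \<le> k" for k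
  proof -
    have "real k * z k powr p' = (\<Sum>l=1..k. z k powr p')" by simp
    also have "\<dots> \<le> (\<Sum>l=1..k. z l powr p')" using z p' by (intro sum_mono powr_mono2) auto
    finally show ?thesis using G[of k] by simp
  qed
  have G_split: "G powr (s - 1) * G = G powr s" using G0 by (cases "G = 0") (auto simp: powr_diff)
  show ?thesis
  proof (cases "1 \<le> s")
    case True
    have "(\<Sum>k=1..2 ^ 2 ^ j. real k powr (s - 1) * z k powr q) \<le> (\<Sum>k=1..2 ^ 2 ^ j. G powr (s - 1) * z k powr p')"
    proof (rule sum_mono)
      fix k :: nat assume k: "k \<in> {1..2 ^ 2 ^ j}"
      have "real k powr (s - 1) * z k powr q = (real k * z k powr p') powr (s - 1) * z k powr p'"
      proof (cases "z k = 0")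
        case False
        then have "0 < z k" using z(1)[of k] by simp
        then have "z k powr q = (z k powr p') powr (s - 1) * z k powr p'"
          by (simp add: powr_powr s(2)[symmetric] right_diff_distrib flip: powr_add)
        then show ?thesis by (simp add: powr_mult)
      qed simp
      also have "\<dots> \<le> G powr (s - 1) * z k powr p'"
        using kz[of k] k True by (intro mult_right_mono powr_mono2) auto
      finally show "real k powr (s - 1) * z k powr q \<le> G powr (s - 1) * z k powr p'" .
    qed
    also have "\<dots> = G powr (s - 1) * (\<Sum>k=1..2 ^ 2 ^ j. z k powr p')" by (rule sum_distrib_left[symmetric])
    also have "\<dots> \<le> G powr (s - 1) * G" by (intro mult_left_mono G) simp
    finally have "(\<Sum>k=1..2 ^ 2 ^ j. real k powr (s - 1) * z k powr q) \<le> G powr s" by (simp only: G_split)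
    moreover have "max 0 (1 - s) = 0" using True by simp
    ultimately show ?thesis using powr_ge_zero[of G s] by (simp del: powr_ge_zero)
  next
    case False
    then have s1: "s < 1" by simp
    define N :: nat where "N = 2 ^ 2 ^ j"
    define H where "H = (\<Sum>k=1..N. 1 / real k)"
    define P where "P = (\<Sum>k=1..N. (1 / real k) * (real k powr s * z k powr q))"
    have H: "0 \<le> H" "H \<le> 2 * 2 ^ j"
    proof -
      show "0 \<le> H" unfolding H_def by (intro sum_nonneg) auto
      have "H \<le> real (2 ^ j) + 1" unfolding H_def N_def by (rule harmonic_sum_le)
      also have "\<dots> \<le> 2 * 2 ^ j" by simp
      finally show "H \<le> 2 * 2 ^ j" .
    qed
    have P0: "0 \<le> P" unfolding P_def by (intro sum_nonneg) auto
    \<comment> \<open>The exponent \<open>1 / s\<close> exceeds 1. With \<open>1 / k\<close> split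
      off as the weight, the remaining \<open>real k powr s * z k powr q\<close> becomes
      \<open>k * z k powr p'\<close> when raised to it, so the weight cancels again.\<close>
    have "P powr (1 / s) \<le> H powr (1 / s - 1) * (\<Sum>k=1..N. (1 / real k) * (real k powr s * z k powr q) powr (1 / s))"
      unfolding P_def H_def by (rule weighted_power_mean) (use s s1 in auto)
    also have "(\<Sum>k=1..N. (1 / real k) * (real k powr s * z k powr q) powr (1 / s)) = (\<Sum>k=1..N. z k powr p')"
    proof (intro sum.cong refl)
      fix k assume k: "k \<in> {1..N}"
      have "q * (1 / s) = p'" using s by (simp add: field_simps)
      then have "(real k powr s * z k powr q) powr (1 / s) = real k * z k powr p'"
        using s k by (simp add: powr_mult powr_powr)
      then show "(1 / real k) * (real k powr s * z k powr q) powr (1 / s) = z k powr p'" using k by simp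
    qed
    also have "H powr (1 / s - 1) * (\<Sum>k=1..N. z k powr p') \<le> H powr (1 / s - 1) * G"
      by (intro mult_left_mono G) simp
    finally have "(P powr (1 / s)) powr s \<le> (H powr (1 / s - 1) * G) powr s"
      using s by (intro powr_mono2) auto
    then have "P \<le> H powr (1 - s) * G powr s"
      using P0 H G0 s by (simp add: powr_powr powr_mult left_diff_distrib)
    also have "\<dots> \<le> (2 * 2 ^ j) powr (1 - s) * G powr s"
      using H s1 by (intro mult_right_mono powr_mono2) auto
    also have "(2 * 2 ^ j :: real) powr (1 - s) = 2 powr (1 - s) * 2 powr (real j * (1 - s))"
      by (simp add: powr_mult powr_powr flip: powr_realpow)
    also have "2 powr (1 - s) * 2 powr (real j * (1 - s)) * G powr s \<le> 2 powr 1 * 2 powr (real j * (1 - s)) * G powr s"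
      using s by (intro mult_right_mono powr_mono) auto
    finally have "P \<le> 2 * (2 powr (real j * max 0 (1 - s)) * G powr s)" using s1 by (simp add: mult.assoc)
    moreover have "P = (\<Sum>k=1..N. real k powr (s - 1) * z k powr q)"
      unfolding P_def by (intro sum.cong refl) (simp add: powr_diff)
    ultimately show ?thesis unfolding N_def by simp
  qed
qed

section \<open>From the split at every level to pointwise and summed bounds\<close>

text \<open>The shape of the estimates for the rearranged Fourier coefficients \<open>\<xi>\<close>: at every dyadic level
  \<open>m\<close>, an \<open>\<ell>\<^sup>\<infinity>\<close> part and an \<open>\<ell>\<^sup>p\<^sup>'\<close> part.\<close>
definition dyadic_split :: "real \<Rightarrow> real \<Rightarrow> real \<Rightarrow> real \<Rightarrow> real \<Rightarrow> (nat \<Rightarrow> real) \<Rightarrow> (nat \<Rightarrow> real) \<Rightarrow> bool" where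
  "dyadic_split a \<kappa> p p' S b \<xi> \<longleftrightarrow> (\<forall>m. \<exists>z.
     (\<forall>k. 0 \<le> z k \<and> \<xi> k \<le> a * S * ((1/2) powr (1 / p')) ^ m + z k) \<and>
     (\<forall>k l. k \<le> l \<longrightarrow> z l \<le> z k) \<and>
     (\<forall>N. (\<Sum>k=1..N. z k powr p') \<le> \<kappa> * (\<Sum>i\<le>m. b i powr p) powr (p' / p)))"

lemma half_powr_power: "((1/2::real) powr x) ^ m = 2 powr (- (real m * x))"
  by (simp add: powr_divide power_one_over powr_minus_divide powr_powr mult.commute power_divide flip: powr_realpow)

text \<open>The cut is made at the least level with \<open>k \<le> 2 ^ m\<close>. The uniform part
  is then of order \<open>k powr (- 1 / p')\<close>, and comparing the decreasing \<open>z\<close>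
  with its first \<open>k\<close> terms gives the same power for the other part. Only the growth of
  the sums of \<open>b i powr p\<close> costs a power of the logarithm.\<close>

lemma dyadic_split_pointwise:
  assumes p: "0 < p" "0 < p'" and a: "0 \<le> a" "0 \<le> \<kappa>" and S: "0 \<le> S" and e: "0 \<le> e"
    and b: "\<And>m. (\<Sum>i\<le>m. b i powr p) powr (1 / p) \<le> (real m + 1) powr e * S"
    and split: "dyadic_split a \<kappa> p p' S b \<xi>" and k: "1 \<le> k"
  shows "\<xi> k \<le> (a + \<kappa> powr (1 / p') * 4 powr e) * real k powr (- 1 / p') * (1 + ln (real k)) powr e * S"
proof -
  define m where "m = nat \<lceil>log 2 (real k)\<rceil>"
  have lnk: "0 \<le> ln (real k)" "0 \<le> log 2 (real k)" using k by simp_all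
  have m: "log 2 (real k) \<le> real m" "real m \<le> log 2 (real k) + 1"
    using lnk(2) unfolding m_def by linarith+
  have k_le: "real k \<le> 2 powr real m"
    using m(1) k by (simp add: log_le_iff)
  have "log 2 (real k) \<le> 2 * ln (real k)"
  proof -
    have "1 / 2 \<le> ln (2::real)" using ln2_ge_two_thirds by simp
    then have "ln (real k) * (1 / 2) \<le> ln (real k) * ln 2" using lnk by (intro mult_left_mono) auto
    then show ?thesis by (simp add: log_def field_simps)
  qed
  then have "real m \<le> 2 * ln (real k) + 1" using m(2) by simp
  \<comment> \<open>The constant 4 generously covers \<open>ln 2 \<ge> 1 / 2\<close> and the
    rounding of \<open>m\<close>.\<close>
  then have m1: "real m + 1 \<le> 4 * (1 + ln (real k))" using lnk(1) by simp
  obtain z where z: "\<And>k. 0 \<le> z k" "\<And>k. \<xi> k \<le> a * S * ((1/2) powr (1 / p')) ^ m + z k"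
      "\<And>k l. k \<le> l \<Longrightarrow> z l \<le> z k" "\<And>N. (\<Sum>k=1..N. z k powr p') \<le> \<kappa> * (\<Sum>i\<le>m. b i powr p) powr (p' / p)"
    using split unfolding dyadic_split_def by meson
  define X where "X = (\<Sum>i\<le>m. b i powr p)"
  define w where "w = real k powr (- 1 / p')"
  define l where "l = (1 + ln (real k)) powr e"
  have w: "0 < w" using k by (simp add: w_def)
  have l: "1 \<le> l" unfolding l_def using lnk e by (intro ge_one_powr_ge_zero) auto
  have X: "0 \<le> X" unfolding X_def by (intro sum_nonneg) simp
  have "((1/2) powr (1 / p')) ^ m = (2 powr real m) powr (- 1 / p')"
    by (simp add: half_powr_power powr_powr)
  also have "\<dots> \<le> w" unfolding w_def using k_le k p by (intro powr_mono2') auto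
  finally have "a * S * ((1/2) powr (1 / p')) ^ m \<le> a * S * w" using a S by (intro mult_left_mono) auto
  also have "\<dots> \<le> a * S * w * l"
  proof -
    have "0 \<le> a * S * w" using a S w by simp
    from mult_left_mono[OF l this] show ?thesis by simp
  qed
  finally have 1: "a * S * ((1/2) powr (1 / p')) ^ m \<le> a * S * w * l" .
  have "real k * z k powr p' = (\<Sum>l=1..k. z k powr p')" by simp
  also have "\<dots> \<le> (\<Sum>l=1..k. z l powr p')" using z p by (intro sum_mono powr_mono2) auto
  also have "\<dots> \<le> \<kappa> * X powr (p' / p)" unfolding X_def by (rule z(4))
  finally have "z k powr p' \<le> \<kappa> * X powr (p' / p) / real k" using k by (simp add: field_simps)
  then have "(z k powr p') powr (1 / p') \<le> (\<kappa> * X powr (p' / p) / real k) powr (1 / p')"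
    using p by (intro powr_mono2) auto
  then have "z k \<le> \<kappa> powr (1 / p') * X powr (1 / p) * w"
    using p z(1)[of k] a(2) X k by (simp add: powr_powr powr_mult powr_divide w_def powr_minus_divide)
  also have "\<dots> \<le> \<kappa> powr (1 / p') * ((real m + 1) powr e * S) * w"
    unfolding X_def using w by (intro mult_right_mono mult_left_mono b) auto
  also have "\<dots> \<le> \<kappa> powr (1 / p') * ((4 * (1 + ln (real k))) powr e * S) * w"
    using w m1 e S by (intro mult_right_mono mult_left_mono powr_mono2) auto
  also have "(4 * (1 + ln (real k))) powr e = 4 powr e * l" using lnk by (simp add: powr_mult l_def del: distrib_left_numeral)
  finally have "z k \<le> \<kappa> powr (1 / p') * (4 powr e * l * S) * w" .
  then have "\<xi> k \<le> a * S * w * l + \<kappa> powr (1 / p') * (4 powr e * l * S) * w"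
    using z(2)[of k] 1 by linarith
  also have "\<dots> = (a + \<kappa> powr (1 / p') * 4 powr e) * w * l * S" by (simp add: algebra_simps)
  finally show ?thesis by (simp add: w_def l_def)
qed

lemma powr_add_le:
  assumes "0 \<le> x" "0 \<le> y" "0 < (q::real)"
  shows "(x + y) powr q \<le> 2 powr q * (x powr q + y powr q)"
proof -
  have "(x + y) powr q \<le> (2 * max x y) powr q" using assms by (intro powr_mono2) auto
  also have "\<dots> = 2 powr q * max x y powr q" using assms by (simp add: powr_mult)
  also have "\<dots> \<le> 2 powr q * (x powr q + y powr q)" by (intro mult_left_mono) (auto simp: max_def)
  finally show ?thesis .
qed

text \<open>The block has at most \<open>2 ^ 2 ^ j\<close> indices and the cut lies at
  \<open>M * 2 ^ j\<close>, so the uniform part decays doubly exponentially in \<open>j\<close>. The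
  condition on \<open>M\<close> makes it outweigh a crude count of all terms; apart from the
  logarithmic weight it contributes a bounded amount.\<close>

lemma dyadic_split_block:
  assumes p: "0 < p" "0 < p'" "0 < q" and a: "0 \<le> a" "0 \<le> \<kappa>" and S: "0 \<le> S" and c: "c < 0"
    and \<xi>: "\<And>k. 0 \<le> \<xi> k"
    and split: "dyadic_split a \<kappa> p p' S b \<xi>"
    and D: "\<And>k. k \<in> D \<Longrightarrow> 1 \<le> k \<and> k \<le> 2 ^ 2 ^ j \<and> 2 ^ j / 4 \<le> 1 + ln (real k)"
    and M: "q / p' + 1 \<le> real M * (q / p')"
  defines "s \<equiv> q / p'"
  shows "(\<Sum>k\<in>D. (real k powr (1 / p') * (1 + ln (real k)) powr c * \<xi> k) powr q * (1 / real k))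
     \<le> 4 powr (- c * q) * 2 powr q * 2 powr (real j * (c * q)) *
       (a powr q * S powr q + 2 * (2 powr (real j * max 0 (1 - s)) * \<kappa> powr s * (\<Sum>i\<le>M * 2 ^ j. b i powr p) powr (q / p)))"
proof -
  define N :: nat where "N = 2 ^ 2 ^ j"
  define m where "m = M * 2 ^ j"
  have s: "0 < s" using p by (simp add: s_def)
  obtain z where z: "\<And>k. 0 \<le> z k" "\<And>k. \<xi> k \<le> a * S * ((1/2) powr (1 / p')) ^ m + z k"
      "\<And>k l. k \<le> l \<Longrightarrow> z l \<le> z k" "\<And>N. (\<Sum>k=1..N. z k powr p') \<le> \<kappa> * (\<Sum>i\<le>m. b i powr p) powr (p' / p)"
    using split unfolding dyadic_split_def by meson
  define y where "y = a * S * ((1/2) powr (1 / p')) ^ m"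
  have y: "0 \<le> y" using a S by (simp add: y_def)
  define \<Lambda> where "\<Lambda> = 4 powr (- c * q) * 2 powr (real j * (c * q))"
  have \<Lambda>: "0 \<le> \<Lambda>" by (simp add: \<Lambda>_def)
  have term_le: "(real k powr (1 / p') * (1 + ln (real k)) powr c * \<xi> k) powr q * (1 / real k)
      \<le> \<Lambda> * 2 powr q * (real k powr (s - 1) * y powr q + real k powr (s - 1) * z k powr q)" if "k \<in> D" for k
  proof -
    have k: "1 \<le> k" "2 ^ j / 4 \<le> 1 + ln (real k)" using D[OF that] by auto
    \<comment> \<open>Since \<open>c < 0\<close>, the lower bound for the logarithm on the block
      becomes an upper bound for its power.\<close>
    have "(1 + ln (real k)) powr (c * q) \<le> (2 ^ j / 4) powr (c * q)"
      using k c p by (intro powr_mono2') (auto simp: mult_nonpos_nonneg)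
    also have "\<dots> = \<Lambda>" by (simp add: \<Lambda>_def powr_divide powr_powr powr_minus_divide flip: powr_realpow)
    finally have l: "(1 + ln (real k)) powr (c * q) \<le> \<Lambda>" .
    have "\<xi> k powr q \<le> (y + z k) powr q" using z(2)[of k] \<xi>[of k] p by (intro powr_mono2) (auto simp: y_def)
    also have "\<dots> \<le> 2 powr q * (y powr q + z k powr q)" using y z(1)[of k] p by (intro powr_add_le) auto
    finally have x: "\<xi> k powr q \<le> 2 powr q * (y powr q + z k powr q)" .
    have "(real k powr (1 / p') * (1 + ln (real k)) powr c * \<xi> k) powr q * (1 / real k)
       = real k powr (s - 1) * ((1 + ln (real k)) powr (c * q) * \<xi> k powr q)"
      using k \<xi>[of k] by (simp add: powr_mult powr_powr s_def powr_diff)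
    also have "\<dots> \<le> real k powr (s - 1) * (\<Lambda> * (2 powr q * (y powr q + z k powr q)))"
      using l x \<Lambda> by (intro mult_left_mono mult_mono) auto
    finally show ?thesis by (simp add: algebra_simps)
  qed
  have Dsub: "D \<subseteq> {1..N}" using D by (auto simp: N_def)
  have first: "(\<Sum>k\<in>D. real k powr (s - 1) * y powr q) \<le> a powr q * S powr q"
  proof -
    have "(\<Sum>k\<in>D. real k powr (s - 1) * y powr q) \<le> (\<Sum>k=1..N. real k powr (s - 1) * y powr q)"
      by (rule sum_mono2[OF _ Dsub]) auto
    \<comment> \<open>Every weight is replaced by \<open>real N powr s\<close>, and the number of
      terms adds one more power of \<open>N\<close>; the choice of \<open>M\<close> leaves room for
      this.\<close>
    also have "\<dots> \<le> (\<Sum>k=1..N. real N powr s * y powr q)"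
    proof (intro sum_mono mult_right_mono)
      fix k assume k: "k \<in> {1..N}"
      have "real k powr (s - 1) \<le> real k powr s" using k by (intro powr_mono) auto
      also have "\<dots> \<le> real N powr s" using k s by (intro powr_mono2) auto
      finally show "real k powr (s - 1) \<le> real N powr s" .
    qed simp
    also have "\<dots> = real N powr (s + 1) * y powr q"
      by (simp add: powr_add N_def)
    also have "\<dots> = (a powr q * S powr q) * (2 powr (2 ^ j * (s + 1)) * 2 powr (- (real m * s)))"
    proof -
      have "real N = 2 powr (2 ^ j)" by (simp add: N_def flip: powr_realpow)
      then have "real N powr (s + 1) = 2 powr (2 ^ j * (s + 1))" by (simp add: powr_powr)
      moreover have "y powr q = a powr q * S powr q * 2 powr (- (real m * s))"
        using a S by (simp add: y_def half_powr_power powr_mult powr_powr s_def)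
      ultimately show ?thesis by simp
    qed
    also have "\<dots> \<le> (a powr q * S powr q) * 1"
    proof (rule mult_left_mono)
      have "2 ^ j * (s + 1) \<le> 2 ^ j * (real M * s)" using M by (intro mult_left_mono) (auto simp: s_def)
      then have "2 ^ j * (s + 1) + - (real m * s) \<le> 0" by (simp add: m_def algebra_simps)
      then have "2 powr (2 ^ j * (s + 1) + - (real m * s)) \<le> 2 powr 0" by (intro powr_mono) auto
      then show "2 powr (2 ^ j * (s + 1)) * 2 powr (- (real m * s)) \<le> (1::real)" by (simp flip: powr_add)
    qed simp
    finally show ?thesis by simp
  qed
  have second: "(\<Sum>k\<in>D. real k powr (s - 1) * z k powr q)
     \<le> 2 * (2 powr (real j * max 0 (1 - s)) * \<kappa> powr s * (\<Sum>i\<le>m. b i powr p) powr (q / p))"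
  proof -
    define X where "X = (\<Sum>i\<le>m. b i powr p)"
    have X: "0 \<le> X" unfolding X_def by (intro sum_nonneg) simp
    have "(\<Sum>k\<in>D. real k powr (s - 1) * z k powr q) \<le> (\<Sum>k=1..N. real k powr (s - 1) * z k powr q)"
      by (rule sum_mono2[OF _ Dsub]) auto
    also have "\<dots> \<le> 2 * (2 powr (real j * max 0 (1 - s)) * (\<kappa> * X powr (p' / p)) powr s)"
      unfolding N_def s_def X_def by (rule decreasing_block_sum_le[OF p(2,3) z(1) z(3) z(4)])
    also have "(\<kappa> * X powr (p' / p)) powr s = \<kappa> powr s * X powr (q / p)"
      using a X p by (simp add: powr_mult powr_powr s_def)
    finally show ?thesis by (simp add: X_def mult.assoc)
  qed
  have "(\<Sum>k\<in>D. (real k powr (1 / p') * (1 + ln (real k)) powr c * \<xi> k) powr q * (1 / real k))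
     \<le> (\<Sum>k\<in>D. \<Lambda> * 2 powr q * (real k powr (s - 1) * y powr q + real k powr (s - 1) * z k powr q))"
    by (rule sum_mono) (rule term_le)
  also have "\<dots> = \<Lambda> * 2 powr q * ((\<Sum>k\<in>D. real k powr (s - 1) * y powr q) + (\<Sum>k\<in>D. real k powr (s - 1) * z k powr q))"
    by (simp only: sum_distrib_left[symmetric] sum.distrib)
  also have "\<dots> \<le> \<Lambda> * 2 powr q * (a powr q * S powr q + 2 * (2 powr (real j * max 0 (1 - s)) * \<kappa> powr s * (\<Sum>i\<le>m. b i powr p) powr (q / p)))"
    using \<Lambda> by (intro mult_left_mono add_mono first second) auto
  finally show ?thesis by (simp add: \<Lambda>_def m_def mult_ac)
qed

text \<open>The uniform parts of the blocks form a geometric series because \<open>c < 0\<close>,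
  and the other parts form the left-hand side of \<open>dyadic_hardy\<close>. The constant is fixed
  before \<open>b\<close>, \<xi> and \<open>S\<close>, hence uniform over all functions.\<close>

lemma dyadic_split_sum:
  assumes p: "0 < p" "0 < p'" "p < q" and a: "0 \<le> a" "0 \<le> \<kappa>" and c: "c = - 1 / p + 1 / max p' q" "c < 0"
  obtains C where "0 \<le> C" "\<And>b \<xi> S n. 0 \<le> S \<Longrightarrow> (\<And>i. 0 \<le> b i) \<Longrightarrow> (\<And>k. 0 \<le> \<xi> k) \<Longrightarrow>
      (\<And>N. (\<Sum>i<N. b i powr q) \<le> S powr q) \<Longrightarrow> dyadic_split a \<kappa> p p' S b \<xi> \<Longrightarrow>
      (\<Sum>k=1..n. (real k powr (1 / p') * (1 + ln (real k)) powr c * \<xi> k) powr q * (1 / real k)) \<le> C * S powr q"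
proof -
  define s where "s = q / p'"
  define r where "r = q / p"
  have q: "0 < q" and s: "0 < s" and r: "1 < r" using p by (auto simp: s_def r_def)
  \<comment> \<open>The least natural number that satisfies the condition
    \<open>s + 1 \<le> M * s\<close> of the block estimate.\<close>
  define M where "M = nat \<lceil>(s + 1) / s\<rceil>"
  have M: "s + 1 \<le> real M * s" "1 \<le> M"
  proof -
    have "(s + 1) / s \<le> real M" unfolding M_def by (rule real_nat_ceiling_ge)
    then show "s + 1 \<le> real M * s" using s by (simp add: field_simps)
    then have "0 < real M * s" using s by linarith
    then show "1 \<le> M" using s by (simp add: zero_less_mult_iff)
  qed
  define \<sigma> where "\<sigma> = (r - 1) / 2"
  define H where "H = (8 * real M) powr \<sigma> * ((2 * real M) powr \<sigma> / (1 - 2 powr (- \<sigma>)))"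
  define \<theta> where "\<theta> = 2 powr (c * q)"
  have cq: "c * q < 0" using c q by (simp add: mult_neg_pos)
  have \<theta>: "0 < \<theta>" "\<theta> < 1"
    using cq powr_less_mono[of "c * q" 0 2] by (auto simp: \<theta>_def)
  have H: "0 \<le> H"
  proof -
    have "2 powr (- \<sigma>) \<le> (2::real) powr 0" using r by (intro powr_mono) (auto simp: \<sigma>_def)
    then show ?thesis by (simp add: H_def)
  qed
  \<comment> \<open>The identity that dictates the logarithmic exponent: the weight and the loss in
    the block together leave exactly the decay \<open>1 - r\<close> of Hardy's inequality, in both
    cases of the maximum.\<close>
  have expo: "c * q + max 0 (1 - s) = 1 - r"
  proof (cases "q \<le> p'")
    case True
    then have "max p' q = p'" "max 0 (1 - s) = 1 - s" using p by (auto simp: s_def)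
    then show ?thesis using p by (simp add: c s_def r_def algebra_simps)
  next
    case False
    then have "max p' q = q" "max 0 (1 - s) = 0" using p by (auto simp: s_def)
    then show ?thesis using p q by (simp add: c r_def algebra_simps)
  qed
  define C0 where "C0 = 4 powr (- c * q) * 2 powr q"
  define C where "C = C0 * (a powr q * (1 / (1 - \<theta>)) + 2 * \<kappa> powr s * H)"
  have C0: "0 \<le> C0" by (simp add: C0_def)
  show ?thesis
  proof (rule that)
    show "0 \<le> C" using C0 \<theta> H by (simp add: C_def)
    fix b \<xi> :: "nat \<Rightarrow> real" and S :: real and n :: nat
    assume S: "0 \<le> S" and b: "\<And>i. 0 \<le> b i" and \<xi>: "\<And>k. 0 \<le> \<xi> k"
      and bS: "\<And>N. (\<Sum>i<N. b i powr q) \<le> S powr q" and split: "dyadic_split a \<kappa> p p' S b \<xi>"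
    define X where "X j = (\<Sum>i\<le>M * 2 ^ j. b i powr p)" for j :: nat
    \<comment> \<open>The block number of \<open>k\<close>; from block 1 on, \<open>ln k\<close> is
      comparable to \<open>2 ^ g k\<close>.\<close>
    define g where "g k = (LEAST j. k \<le> (2::nat) ^ 2 ^ j)" for k :: nat
    have ex: "k \<le> (2::nat) ^ 2 ^ k" for k
      by (meson le_trans less_exp less_imp_le)
    have g: "k \<le> 2 ^ 2 ^ g k" "g k \<le> k" "j < g k \<Longrightarrow> 2 ^ 2 ^ j < k" for k j
    proof -
      show "k \<le> 2 ^ 2 ^ g k" unfolding g_def by (rule LeastI[of _ k]) (rule ex)
      show "g k \<le> k" unfolding g_def by (rule Least_le) (rule ex)
      show "2 ^ 2 ^ j < k" if "j < g k" using not_less_Least[OF that[unfolded g_def]] by simp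
    qed
    have glow: "2 ^ g k / 4 \<le> 1 + ln (real k)" if "1 \<le> k" for k
    proof (cases "g k")
      case 0
      then show ?thesis using that by simp
    next
      case (Suc j)
      then have "2 ^ 2 ^ j < k" using g(3)[of j k] by simp
      then have "real (2 ^ 2 ^ j) < real k" by (rule of_nat_less_iff[THEN iffD2])
      then have "(2::real) ^ 2 ^ j \<le> real k" by simp
      then have "ln ((2::real) ^ 2 ^ j) \<le> ln (real k)" using that by (subst ln_le_cancel_iff) auto
      then have "2 ^ j * ln 2 \<le> ln (real k)" by (simp add: ln_realpow)
      moreover have "2 ^ j * (1 / 2) \<le> 2 ^ j * ln (2::real)"
        using ln2_ge_two_thirds by (intro mult_left_mono) auto
      ultimately have "2 ^ j * (1 / 2) \<le> 1 + ln (real k)" by linarith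
      then show ?thesis using Suc by simp
    qed
    let ?t = "\<lambda>k. (real k powr (1 / p') * (1 + ln (real k)) powr c * \<xi> k) powr q * (1 / real k)"
    \<comment> \<open>Since \<open>g k \<le> k\<close>, the blocks with \<open>j \<le> n\<close>
      exhaust the indices up to \<open>n\<close>.\<close>
    have "(\<Sum>k=1..n. ?t k) = (\<Sum>j\<le>n. \<Sum>k\<in>{k \<in> {1..n}. g k = j}. ?t k)"
      by (rule sum.group[symmetric]) (auto intro: order_trans[OF g(2)])
    also have "\<dots> \<le> (\<Sum>j\<le>n. C0 * 2 powr (real j * (c * q)) *
        (a powr q * S powr q + 2 * (2 powr (real j * max 0 (1 - s)) * \<kappa> powr s * X j powr r)))"
    proof (rule sum_mono)
      fix j
      show "(\<Sum>k\<in>{k \<in> {1..n}. g k = j}. ?t k) \<le> C0 * 2 powr (real j * (c * q)) *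
        (a powr q * S powr q + 2 * (2 powr (real j * max 0 (1 - s)) * \<kappa> powr s * X j powr r))"
        unfolding C0_def s_def r_def X_def
        by (rule dyadic_split_block[OF p(1,2) q a S c(2) \<xi> split])
           (use g(1) glow M(1) in \<open>auto simp: s_def\<close>)
    qed
    also have "\<dots> = (\<Sum>j\<le>n. C0 * (a powr q * S powr q) * \<theta> ^ j + C0 * 2 * \<kappa> powr s * (2 powr (real j * (1 - r)) * X j powr r))"
    proof (intro sum.cong refl)
      fix j
      have 1: "2 powr (real j * (c * q)) = \<theta> ^ j"
        using \<theta>(1) by (simp add: \<theta>_def powr_powr mult.commute flip: powr_realpow)
      have "2 powr (real j * (1 - r)) = 2 powr (real j * (c * q)) * 2 powr (real j * max 0 (1 - s))"
        by (simp only: expo[symmetric] distrib_left powr_add)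
      then show "C0 * 2 powr (real j * (c * q)) *
        (a powr q * S powr q + 2 * (2 powr (real j * max 0 (1 - s)) * \<kappa> powr s * X j powr r))
        = C0 * (a powr q * S powr q) * \<theta> ^ j + C0 * 2 * \<kappa> powr s * (2 powr (real j * (1 - r)) * X j powr r)"
        unfolding 1[symmetric] by (simp add: distrib_left mult_ac)
    qed
    also have "\<dots> = C0 * (a powr q * S powr q) * (\<Sum>j\<le>n. \<theta> ^ j)
        + C0 * 2 * \<kappa> powr s * (\<Sum>j\<le>n. 2 powr (real j * (1 - r)) * X j powr r)"
      by (simp only: sum.distrib sum_distrib_left)
    also have "\<dots> \<le> C0 * (a powr q * S powr q) * (1 / (1 - \<theta>)) + C0 * 2 * \<kappa> powr s * (H * S powr q)"
    proof (intro add_mono mult_left_mono)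
      show "(\<Sum>j\<le>n. \<theta> ^ j) \<le> 1 / (1 - \<theta>)"
        using \<theta> sum_le_suminf[of "\<lambda>j. \<theta> ^ j" "{..n}"] by (simp add: suminf_geometric summable_geometric)
      have "(b i powr p) powr r = b i powr q" for i using p by (simp add: powr_powr r_def)
      then have "(\<Sum>i<N. (b i powr p) powr r) \<le> S powr q" for N using bS[of N] by simp
      \<comment> \<open>Hardy's inequality is applied to \<open>b i powr p\<close> with
        \<open>r = q / p\<close>, so that the r-th powers are \<open>b i powr q\<close>.\<close>
      from dyadic_hardy[OF r M(2) _ this, of n]
      show "(\<Sum>j\<le>n. 2 powr (real j * (1 - r)) * X j powr r) \<le> H * S powr q"
        unfolding X_def H_def \<sigma>_def by simp
    qed (use C0 in auto)
    also have "\<dots> = C * S powr q" by (simp add: C_def algebra_simps)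
    finally show "(\<Sum>k=1..n. ?t k) \<le> C * S powr q" .
  qed
qed

section \<open>The limiting Hausdorff--Young inequality\<close>

text \<open>Unfolds the convention \<open>1 / \<infinity> = 0\<close>, which the real exponent in
  the theorem expresses through \<open>enn2real\<close>.\<close>

lemma enn2real_inverse_max:
  assumes "0 < p'"
  shows "enn2real (1 / max (ennreal p') q) = (if q = \<infinity> then 0 else 1 / max p' (enn2real q))"
proof (cases q)
  case (real t)
  have "1 / ennreal (max p' t) = ennreal (1 / max p' t)"
    using assms divide_ennreal[of 1 "max p' t"] by simp
  moreover have "max (ennreal p') (ennreal t) = ennreal (max p' t)"
    using assms real(1) by (simp add: max_def)
  ultimately show ?thesis using real assms by simp
next
  case top
  then show ?thesis by (simp add: max_def)
qed

text \<open>The q-th root of the constant lost in passing from the Lorentz norm to dyadic levels: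
  \<open>level_const p q\<close> times the norm bounds the l^q norm of the weighted levels.\<close>

definition level_const :: "real \<Rightarrow> ennreal \<Rightarrow> real" where
  "level_const p q = (if q = \<infinity> then 1 else (2 * 2 powr (enn2real q / p)) powr (1 / enn2real q))"

lemma level_const_pos: "0 < level_const p q"
  by (simp add: level_const_def)

lemma lorentz_space_dyadic_split:
  fixes f :: "real^'d::finite \<Rightarrow> 'x::complex_banach"
  assumes p: "1 < p" and K: "0 \<le> K" "\<And>(g :: real^'d \<Rightarrow> 'x) \<Lambda>. strongly_measurable torus_measure g \<Longrightarrow>
       (\<And>x. x \<in> torus \<Longrightarrow> norm (g x) \<le> \<Lambda>) \<Longrightarrow> hausdorff_young K p g"
    and q: "ennreal p < q" and f: "f \<in> lorentz_space p q"
  defines "p' \<equiv> conj_exp p" and "S \<equiv> level_const p q * enn2real (lorentz_norm p q f)"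
  obtains b where "\<And>i. 0 \<le> b i"
    "dyadic_split (2 * decay p / (1 - decay p)) (2 powr p' * K * 2 powr (p' / p)) p p' S b
      (\<lambda>k. enn2real (seq_rearrangement (fourier_coeff f) k))"
    "\<And>m. (\<Sum>i\<le>m. b i powr p) powr (1 / p)
      \<le> (real m + 1) powr (1 / p - (if q = \<infinity> then 0 else 1 / enn2real q)) * S"
    "q \<noteq> \<infinity> \<Longrightarrow> (\<And>N. (\<Sum>i<N. b i powr enn2real q) \<le> S powr enn2real q)"
    "\<And>k. seq_rearrangement (fourier_coeff f) k < \<infinity>"
proof -
  have p0: "0 < p" and q0: "0 < q" using p q by (auto intro: le_less_trans[rotated])
  define L where "L = enn2real (lorentz_norm p q f)"
  have L: "0 \<le> L" by (simp add: L_def)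
  define r where "r = enn2real q"
  have r: "p < r" if "q \<noteq> \<infinity>"
    using q that p0 by (cases q) (auto simp: r_def ennreal_less_iff)
  show ?thesis
  proof (rule lorentz_space_levels[OF p0 q0 f])
    fix \<phi> :: "nat \<Rightarrow> real"
    assume \<phi>: "\<And>i. rearrangement torus_measure f ((1/2) ^ i) = ennreal (\<phi> i)" "\<And>i. 0 \<le> \<phi> i" "\<phi> 0 = 0"
      and inf: "q = \<infinity> \<Longrightarrow> (\<And>i. (1/2) powr (real i / p) * \<phi> i \<le> enn2real (lorentz_norm p q f))"
      and finq: "q \<noteq> \<infinity> \<Longrightarrow> (\<And>N. (\<Sum>i<N. ((1/2) powr (real i / p) * \<phi> i) powr enn2real q)
          \<le> 2 * 2 powr (enn2real q / p) * enn2real (lorentz_norm p q f) powr enn2real q)"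
    define b where "b i = (1/2) powr (real i / p) * \<phi> i" for i
    have b: "0 \<le> b i" for i using \<phi>(2) by (simp add: b_def)
    have S0: "0 \<le> S" using level_const_pos[of p q] by (simp add: S_def)
    have sum_b: "(\<Sum>i<N. b i powr r) \<le> S powr r" if "q \<noteq> \<infinity>" for N
    proof -
      have "S powr r = 2 * 2 powr (r / p) * L powr r"
        using that r[OF that] p0 L by (simp add: S_def level_const_def powr_mult powr_powr L_def r_def)
      then show ?thesis using finq[OF that, of N] by (simp add: b_def r_def L_def)
    qed
    \<comment> \<open>The split at a level takes a bound for each weighted level; for finite
      \<open>q\<close> a single term is at most the whole sum.\<close>
    have bS: "b i \<le> S" for i
    proof (cases "q = \<infinity>")
      case True
      then show ?thesis using inf[OF True, of i] by (simp add: b_def S_def level_const_def)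
    next
      case False
      have "b i powr r \<le> (\<Sum>i<Suc i. b i powr r)" by (simp add: sum_nonneg)
      also have "\<dots> \<le> S powr r" by (rule sum_b[OF False])
      finally have le: "b i powr r \<le> S powr r" .
      have "(b i powr r) powr (1 / r) \<le> (S powr r) powr (1 / r)"
        by (rule powr_mono2) (use le r[OF False] p0 in auto)
      moreover have "(b i powr r) powr (1 / r) = b i" "(S powr r) powr (1 / r) = S"
        using r[OF False] p0 b[of i] S0 by (simp_all add: powr_powr)
      ultimately show ?thesis by simp
    qed
    have f': "strongly_measurable torus_measure f" using f by (simp add: lorentz_space_def)
    note split0 = fourier_coeff_rearrangement_split[OF p K(1) _ f' \<phi> bS[unfolded b_def], folded b_def p'_def]
    have fin: "seq_rearrangement (fourier_coeff f) k < \<infinity>" for k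
      by (rule split0(1), rule K(2))
    have split: "\<exists>z. (\<forall>k. 0 \<le> z k \<and> enn2real (seq_rearrangement (fourier_coeff f) k)
          \<le> 2 * decay p / (1 - decay p) * S * decay p ^ m + z k) \<and>
        (\<forall>k l. k \<le> l \<longrightarrow> z l \<le> z k) \<and>
        (\<forall>N. (\<Sum>k=1..N. z k powr p') \<le> 2 powr p' * (K * (2 * (\<Sum>i\<le>m. b i powr p)) powr (p' / p)))" for m
      by (rule split0(2), rule K(2))
    have sums: "0 \<le> (\<Sum>i\<le>m. b i powr p)" for m by (intro sum_nonneg) simp
    have expand: "2 powr p' * (K * (2 * (\<Sum>i\<le>m. b i powr p)) powr (p' / p))
        = 2 powr p' * K * 2 powr (p' / p) * (\<Sum>i\<le>m. b i powr p) powr (p' / p)" for m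
      using sums[of m] by (simp add: powr_mult)
    show ?thesis
    proof (rule that[of b])
      show "dyadic_split (2 * decay p / (1 - decay p)) (2 powr p' * K * 2 powr (p' / p)) p p' S b
          (\<lambda>k. enn2real (seq_rearrangement (fourier_coeff f) k))"
        using split[unfolded expand] unfolding dyadic_split_def decay_def p'_def by (rule allI)
      show "(\<Sum>i\<le>m. b i powr p) powr (1 / p)
          \<le> (real m + 1) powr (1 / p - (if q = \<infinity> then 0 else 1 / enn2real q)) * S" for m
      proof (cases "q = \<infinity>")
        case True
        have "(\<Sum>i\<le>m. b i powr p) \<le> (\<Sum>i\<le>m. S powr p)"
          using b bS p0 by (intro sum_mono powr_mono2) auto
        then have "(\<Sum>i\<le>m. b i powr p) powr (1 / p) \<le> ((real m + 1) * S powr p) powr (1 / p)"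
          using p0 sums by (intro powr_mono2) (auto simp: add.commute)
        also have "\<dots> = (real m + 1) powr (1 / p) * S" using p0 S0 by (simp add: powr_mult powr_powr)
        finally show ?thesis using True by simp
      next
        case False
        have rp: "1 < r / p" using r[OF False] p0 by simp
        have rr: "0 < r" using r[OF False] p0 by simp
        \<comment> \<open>Hoelder's inequality with \<open>m + 1\<close> unit weights: passing from
          exponent \<open>r\<close> down to \<open>p\<close> costs
          \<open>(m + 1) powr (1 / p - 1 / r)\<close>.\<close>
        have "(\<Sum>i\<le>m. 1 * b i powr p) powr (r / p) \<le> (\<Sum>i\<le>m. 1) powr (r / p - 1) * (\<Sum>i\<le>m. 1 * (b i powr p) powr (r / p))"
          by (rule weighted_power_mean[OF rp]) auto
        also have "(\<Sum>i\<le>m. 1 * (b i powr p) powr (r / p)) = (\<Sum>i<Suc m. b i powr r)"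
          using p0 by (simp add: powr_powr lessThan_Suc_atMost)
        also have "(\<Sum>i\<le>m. 1) powr (r / p - 1) * (\<Sum>i<Suc m. b i powr r) \<le> (\<Sum>i\<le>m. 1) powr (r / p - 1) * S powr r"
          by (intro mult_left_mono sum_b[OF False]) simp
        finally have "((\<Sum>i\<le>m. b i powr p) powr (r / p)) powr (1 / r) \<le> ((real m + 1) powr (r / p - 1) * S powr r) powr (1 / r)"
          using rr sums by (intro powr_mono2) (auto simp: add.commute)
        also have "\<dots> = (real m + 1) powr ((r / p - 1) * (1 / r)) * S"
          using rr S0 by (simp add: powr_mult powr_powr)
        also have "(r / p - 1) * (1 / r) = 1 / p - 1 / r" using rr p0 by (simp add: field_simps)
        finally show ?thesis using rr False by (simp add: powr_powr r_def)
      qed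
      show "seq_rearrangement (fourier_coeff f) k < \<infinity>" for k by (rule fin)
    qed (use b sum_b in \<open>auto simp: r_def\<close>)
  qed
qed

lemma suminf_ennreal_le:
  assumes "\<And>n. (\<Sum>k<n. f k) \<le> (C::ennreal)"
  shows "(\<Sum>k. f k) \<le> C"
  unfolding suminf_eq_SUP by (rule SUP_least) (rule assms)

theorem corollary7p9:
  fixes p0 :: real and q :: ennreal
  assumes nonzero: "\<exists>x::'x::complex_banach. x \<noteq> 0"
    and p0: "1 < p0" "p0 \<le> 2"
    and type: "fourier_type TYPE('d::finite) TYPE('x) p0"
    and q: "ennreal p0 < q"
  shows "(\<exists>C::real. \<forall>f :: real^'d \<Rightarrow> 'x. f \<in> lorentz_space p0 q \<longrightarrow>
            lorentz_log_seq_norm (conj_exp p0) q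
              (- 1 / p0 + enn2real (1 / max (ennreal (conj_exp p0)) q)) (fourier_coeff f)
              \<le> ennreal C * lorentz_norm p0 q f)
       \<and> (\<exists>C::real. \<forall>f :: real^'d \<Rightarrow> 'x. f \<in> lorentz_space p0 q \<longrightarrow> (\<forall>n\<ge>1::nat.
            seq_rearrangement (fourier_coeff f) n
              \<le> ennreal (C * real n powr (- 1 / conj_exp p0)
                   * (1 + ln (real n)) powr (1 / p0 - enn2real (1 / max (ennreal (conj_exp p0)) q)))
                * lorentz_norm p0 q f))"
proof (rule fourier_type_hausdorff_young[OF type p0(1)])
  fix K
  assume K: "0 \<le> K" "\<And>(g :: real^'d \<Rightarrow> 'x) \<Lambda>. strongly_measurable torus_measure g \<Longrightarrow>
     (\<And>x. x \<in> torus \<Longrightarrow> norm (g x) \<le> \<Lambda>) \<Longrightarrow> hausdorff_young K p0 g"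
  define p' where "p' = conj_exp p0"
  have p': "1 < p'" using conj_exp_props[OF p0(1)] by (simp add: p'_def)
  have pos: "0 < p0" "0 < p'" using p0 p' by auto
  define a where "a = 2 * decay p0 / (1 - decay p0)"
  define \<kappa> where "\<kappa> = 2 powr p' * K * 2 powr (p' / p0)"
  have a: "0 \<le> a" "0 \<le> \<kappa>" using decay_bounds[OF p0(1)] K(1) by (auto simp: a_def \<kappa>_def)
  define S where "S f = level_const p0 q * enn2real (lorentz_norm p0 q f)" for f :: "real^'d \<Rightarrow> 'x"
  have S0: "0 \<le> S f" for f using level_const_pos[of p0 q] by (simp add: S_def)
  define \<xi> where "\<xi> f k = enn2real (seq_rearrangement (fourier_coeff f) k)" for f :: "real^'d \<Rightarrow> 'x" and k
  have \<xi>0: "0 \<le> \<xi> f k" for f k by (simp add: \<xi>_def)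
  define e where "e = 1 / p0 - (if q = \<infinity> then 0 else 1 / enn2real q)"
  define i where "i = enn2real (1 / max (ennreal p') q)"
  have i: "i = (if q = \<infinity> then 0 else 1 / max p' (enn2real q))"
    unfolding i_def by (rule enn2real_inverse_max[OF pos(2)])
  have r: "p0 < enn2real q" if "q \<noteq> \<infinity>"
    using q that p0 by (cases q) (auto simp: ennreal_less_iff)
  \<comment> \<open>The pointwise argument yields the exponent \<open>1 / p0 - 1 / q\<close>. It is
    at most the stated one because \<open>q\<close> is at most the maximum, and since
    \<open>1 + ln k \<ge> 1\<close> the bound may be weakened to the stated form.\<close>
  have e: "0 \<le> e" "e \<le> 1 / p0 - i"
    using r pos p0 by (auto simp: e_def i intro!: divide_left_mono mult_pos_pos frac_le)
  have split: "\<exists>b. (\<forall>i. 0 \<le> b i) \<and> dyadic_split a \<kappa> p0 p' (S f) b (\<xi> f) \<and>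
      (\<forall>m. (\<Sum>i\<le>m. b i powr p0) powr (1 / p0) \<le> (real m + 1) powr e * S f) \<and>
      (q \<noteq> \<infinity> \<longrightarrow> (\<forall>N. (\<Sum>i<N. b i powr enn2real q) \<le> S f powr enn2real q))"
    and fin: "seq_rearrangement (fourier_coeff f) k = ennreal (\<xi> f k)"
    if "f \<in> lorentz_space p0 q" for f :: "real^'d \<Rightarrow> 'x" and k
  proof -
    show "\<exists>b. (\<forall>i. 0 \<le> b i) \<and> dyadic_split a \<kappa> p0 p' (S f) b (\<xi> f) \<and>
      (\<forall>m. (\<Sum>i\<le>m. b i powr p0) powr (1 / p0) \<le> (real m + 1) powr e * S f) \<and>
      (q \<noteq> \<infinity> \<longrightarrow> (\<forall>N. (\<Sum>i<N. b i powr enn2real q) \<le> S f powr enn2real q))"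
    proof (rule lorentz_space_dyadic_split[OF p0(1) K q that])
      fix b :: "nat \<Rightarrow> real"
      assume "\<And>i. 0 \<le> b i"
        "dyadic_split (2 * decay p0 / (1 - decay p0))
          (2 powr conj_exp p0 * K * 2 powr (conj_exp p0 / p0)) p0 (conj_exp p0)
          (level_const p0 q * enn2real (lorentz_norm p0 q f)) b
          (\<lambda>k. enn2real (seq_rearrangement (fourier_coeff f) k))"
        "\<And>m. (\<Sum>i\<le>m. b i powr p0) powr (1 / p0)
          \<le> (real m + 1) powr (1 / p0 - (if q = \<infinity> then 0 else 1 / enn2real q)) * (level_const p0 q * enn2real (lorentz_norm p0 q f))"
        "q \<noteq> \<infinity> \<Longrightarrow> (\<And>N. (\<Sum>i<N. b i powr enn2real q) \<le> (level_const p0 q * enn2real (lorentz_norm p0 q f)) powr enn2real q)"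
      then show ?thesis
        unfolding a_def p'_def \<kappa>_def S_def e_def \<xi>_def[abs_def] by (intro exI[of _ b]) simp
    qed
    show "seq_rearrangement (fourier_coeff f) k = ennreal (\<xi> f k)"
    proof (rule lorentz_space_dyadic_split[OF p0(1) K q that])
      assume "\<And>k. seq_rearrangement (fourier_coeff f) k < \<infinity>"
      from this[of k] show ?thesis by (simp add: \<xi>_def less_top)
    qed
  qed
  have norm_eq: "lorentz_norm p0 q f = ennreal (enn2real (lorentz_norm p0 q f))" if "f \<in> lorentz_space p0 q" for f :: "real^'d \<Rightarrow> 'x"
    using that by (simp add: lorentz_space_def less_top)
  define C1 where "C1 = a + \<kappa> powr (1 / p') * 4 powr e"
  have C1: "0 \<le> C1" using a by (simp add: C1_def)
  have pointwise: "\<xi> f k \<le> C1 * real k powr (- 1 / p') * (1 + ln (real k)) powr (1 / p0 - i) * S f"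
    if f: "f \<in> lorentz_space p0 q" and k: "1 \<le> k" for f :: "real^'d \<Rightarrow> 'x" and k
  proof -
    obtain b where b: "dyadic_split a \<kappa> p0 p' (S f) b (\<xi> f)"
      "\<And>m. (\<Sum>i\<le>m. b i powr p0) powr (1 / p0) \<le> (real m + 1) powr e * S f"
      using split[OF f] by blast
    have "\<xi> f k \<le> C1 * real k powr (- 1 / p') * (1 + ln (real k)) powr e * S f"
      unfolding C1_def by (rule dyadic_split_pointwise[OF pos a S0 e(1) b(2) b(1) k])
    also have "\<dots> \<le> C1 * real k powr (- 1 / p') * (1 + ln (real k)) powr (1 / p0 - i) * S f"
      using C1 S0 e(2) k by (intro mult_right_mono mult_left_mono powr_mono) auto
    finally show ?thesis .
  qed
  have second: "seq_rearrangement (fourier_coeff f) n \<le> ennreal (C1 * level_const p0 q * real n powr (- 1 / p')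
        * (1 + ln (real n)) powr (1 / p0 - i)) * lorentz_norm p0 q f"
    if f: "f \<in> lorentz_space p0 q" and n: "1 \<le> n" for f :: "real^'d \<Rightarrow> 'x" and n
  proof -
    have "\<xi> f n \<le> (C1 * level_const p0 q * real n powr (- 1 / p') * (1 + ln (real n)) powr (1 / p0 - i)) * enn2real (lorentz_norm p0 q f)"
      using pointwise[OF f n] by (simp add: S_def mult_ac)
    then show ?thesis
      unfolding fin[OF f] using C1 level_const_pos[of p0 q]
      by (subst norm_eq[OF f]) (simp add: ennreal_leI flip: ennreal_mult)
  qed
  define c where "c = - 1 / p0 + i"
  have first: "\<exists>C::real. \<forall>f :: real^'d \<Rightarrow> 'x. f \<in> lorentz_space p0 q \<longrightarrow>
            lorentz_log_seq_norm p' q c (fourier_coeff f) \<le> ennreal C * lorentz_norm p0 q f"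
  proof (cases "q = \<infinity>")
    case True
    \<comment> \<open>Here the sequence norm is a supremum, and \<open>c\<close> is the negative of
      the exponent in the pointwise bound, so all powers cancel term by term.\<close>
    have "lorentz_log_seq_norm p' q c (fourier_coeff f) \<le> ennreal (C1 * level_const p0 q) * lorentz_norm p0 q f"
      if f: "f \<in> lorentz_space p0 q" for f :: "real^'d \<Rightarrow> 'x"
      unfolding lorentz_log_seq_norm_def Let_def if_P[OF True]
    proof (rule SUP_least)
      fix k :: nat assume "k \<in> {1..}"
      then have k: "1 \<le> k" by simp
      define w where "w = real k powr (1 / p') * (1 + ln (real k)) powr c"
      have w: "0 \<le> w" by (simp add: w_def)
      have l: "0 < 1 + ln (real k)" using k by (simp add: add_pos_nonneg)
      have "w * (real k powr (- 1 / p') * (1 + ln (real k)) powr (1 / p0 - i)) = 1"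
      proof -
        have "w * (real k powr (- 1 / p') * (1 + ln (real k)) powr (1 / p0 - i))
          = (real k powr (1 / p') * real k powr (- 1 / p')) * ((1 + ln (real k)) powr c * (1 + ln (real k)) powr (1 / p0 - i))"
          by (simp add: w_def mult_ac)
        then show ?thesis using k l by (simp add: c_def flip: powr_add)
      qed
      then have "w * \<xi> f k \<le> (C1 * level_const p0 q) * enn2real (lorentz_norm p0 q f)"
        using mult_left_mono[OF pointwise[OF f k] w] by (simp add: S_def mult_ac) (metis mult.left_commute mult.right_neutral)
      then have "ennreal (w * \<xi> f k) \<le> ennreal ((C1 * level_const p0 q) * enn2real (lorentz_norm p0 q f))"
        by (rule ennreal_leI)
      then show "ennreal (real k powr (1 / p') * (1 + ln (real k)) powr c) * seq_rearrangement (fourier_coeff f) k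
          \<le> ennreal (C1 * level_const p0 q) * lorentz_norm p0 q f"
        unfolding fin[OF f] w_def[symmetric] using w \<xi>0[of f k] C1 level_const_pos[of p0 q]
        by (subst norm_eq[OF f]) (simp add: ennreal_mult)
    qed
    then show ?thesis by blast
  next
    case False
    define t where "t = enn2real q"
    have t: "p0 < t" "0 < t" using r[OF False] pos by (auto simp: t_def)
    have c: "c = - 1 / p0 + 1 / max p' t" using False by (simp add: c_def i t_def)
    \<comment> \<open>From \<open>p0 < t \<le> max p' t\<close> the logarithmic exponent is strictly
      negative, as the geometric series over the blocks requires.\<close>
    have c0: "c < 0"
    proof -
      have "1 / max p' t < 1 / p0" using t pos by (intro divide_strict_left_mono) auto
      then show ?thesis by (simp add: c)
    qed
    show ?thesis
    proof (rule dyadic_split_sum[OF pos t(1) a c c0])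
      fix C assume C: "0 \<le> C" and sums: "\<And>b \<xi> S n. 0 \<le> S \<Longrightarrow> (\<And>i. 0 \<le> b i) \<Longrightarrow> (\<And>k. 0 \<le> \<xi> k) \<Longrightarrow>
        (\<And>N. (\<Sum>i<N. b i powr t) \<le> S powr t) \<Longrightarrow> dyadic_split a \<kappa> p0 p' S b \<xi> \<Longrightarrow>
        (\<Sum>k=1..n. (real k powr (1 / p') * (1 + ln (real k)) powr c * \<xi> k) powr t * (1 / real k)) \<le> C * S powr t"
      have "lorentz_log_seq_norm p' q c (fourier_coeff f) \<le> ennreal (C powr (1 / t) * level_const p0 q) * lorentz_norm p0 q f"
        if f: "f \<in> lorentz_space p0 q" for f :: "real^'d \<Rightarrow> 'x"
      proof -
        obtain b where b: "\<And>i. 0 \<le> b i" "dyadic_split a \<kappa> p0 p' (S f) b (\<xi> f)"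
          "\<And>N. (\<Sum>i<N. b i powr t) \<le> S f powr t"
          using split[OF f] False unfolding t_def by blast
        define T where "T k = (real k powr (1 / p') * (1 + ln (real k)) powr c * \<xi> f k) powr t * (1 / real k)" for k
        have T0: "0 \<le> T k" for k by (simp add: T_def)
        have "(\<Sum>k<n. ennreal (T (Suc k))) \<le> ennreal (C * S f powr t)" for n
        proof -
          have "(\<Sum>k<n. T (Suc k)) = (\<Sum>k=1..n. T k)"
            by (simp add: sum.atLeast1_atMost_eq)
          also have "\<dots> \<le> C * S f powr t"
            unfolding T_def by (rule sums[OF S0 b(1) \<xi>0 b(3) b(2)])
          finally show ?thesis using T0 by (simp add: ennreal_leI)
        qed
        then have le: "(\<Sum>k. ennreal (T (Suc k))) \<le> ennreal (C * S f powr t)" by (rule suminf_ennreal_le)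
        have "ennpowr (ennreal (real (Suc k) powr (1 / p') * (1 + ln (real (Suc k))) powr c) * seq_rearrangement (fourier_coeff f) (Suc k)) t
            * ennreal (1 / real (Suc k)) = ennreal (T (Suc k))" for k
          unfolding fin[OF f] T_def using \<xi>0[of f "Suc k"]
          by (simp add: ennpowr_ennreal flip: ennreal_mult del: of_nat_Suc)
        then have "lorentz_log_seq_norm p' q c (fourier_coeff f) = ennpowr (\<Sum>k. ennreal (T (Suc k))) (1 / t)"
          using False by (simp add: lorentz_log_seq_norm_def Let_def t_def del: of_nat_Suc)
        also have "\<dots> \<le> ennpowr (ennreal (C * S f powr t)) (1 / t)"
          using le t by (intro ennpowr_mono) auto
        also have "\<dots> = ennreal (C powr (1 / t) * S f)"
          using C S0[of f] t by (simp add: ennpowr_ennreal powr_mult powr_powr)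
        also have "\<dots> = ennreal (C powr (1 / t) * level_const p0 q) * lorentz_norm p0 q f"
          using level_const_pos[of p0 q] by (subst norm_eq[OF f]) (simp add: S_def mult.assoc flip: ennreal_mult)
        finally show ?thesis .
      qed
      then show ?thesis by blast
    qed
  qed
  show ?thesis
    using first second unfolding c_def i_def p'_def by blast
qed

end
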